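(* Let $M$ be a $C^{2,1}$ manifold endowed with a $C^{1,1}$ Lorentzian metric $g$ and corresponding locally Lipschitz Levi-Civita connection. Let $p\in M$ and let $\epsilon>0$. Let $x^\mu\colon U\to\mathbb{R}^n$ be a chart in a neighborhood of $p$ such that $g_{\alpha\beta}(p)=\eta_{\alpha\beta}$, $\Gamma^\mu_{\alpha\beta}(p)=0$. Let $C\subset U$ be a coordinate ball around $p$ (which is convex normal for sufficiently small radius). For sufficiently small radius, for every geodesic $x\colon[0,1]\to C$ and for every $q\in C$, $$\Big|\frac{d}{dt}D^2_q(x(t))\Big|_{t=1}-\frac{d}{dt}D^2_q(x(t))\Big|_{t=0}-2D^2(x(0),x(1))\Big|\le\epsilon\|x(1)-x(0)\|^2,$$ where the Euclidean and affine structure of the coordinate chart is used just on the right-hand side.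
   Context: $C^{k,1}$ means $C^{k,1}_{loc}$. $M$ is an $n$-dimensional paracompact connected $C^{2,1}$ manifold; charts are $C^{2,1}$. $\eta_{\alpha\beta}$ is the Minkowski metric in diagonal form ($\eta_{00}=-1$, $\eta_{ii}=1$ for $i\ge1$). $\Gamma^\mu_{\alpha\beta}$ are the Christoffel symbols of the Levi-Civita connection. Geodesics are the non-stationary solutions of $\ddot x^\mu=-\Gamma^\mu_{\alpha\beta}(x)\dot x^\alpha\dot x^\beta$; $\gamma_v$ is the unique solution with initial velocity $v$, $\Omega_q\subset T_qM$ is the set of $v\in T_qM$ for which $\gamma_v$ is defined at least on $[0,1]$, and $\exp_qv:=\gamma_v(1)$. An open set $C$ is convex normal if for each $q\in C$ there is an open star-shaped ($v\in N_q$, $s\in[0,1]$ imply $sv\in N_q$) set $N_q\subset\Omega_q$ such that $\exp_q\colon N_q\to C$ is a homeomorphism, locally Lipschitz with locally Lipschitz inverse $\exp_q^{-1}\colon C\to N_q$. On a convex normal set $C$, $D^2(q,r)=D^2_q(r):=g(\exp_q^{-1}(r),\exp_q^{-1}(r))$ for $q,r\in C$ (it can be negative). A coordinate ball around $p$ of radius $\delta$ is the set of points whose Euclidean coordinate distance from $p$ is less than $\delta$; $\|\cdot\|$ is the Euclidean coordinate norm. *)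

theory Defs
  imports "HOL-Analysis.Analysis"
begin

section \<open>Functions of class $C^{k,1}_{loc}$ on open sets\<close>

definition locally_lipschitz_on ::
  "'a::metric_space set \<Rightarrow> ('a \<Rightarrow> 'b::metric_space) \<Rightarrow> bool" where
  "locally_lipschitz_on S f \<longleftrightarrow>
     (\<forall>x\<in>S. \<exists>e>0. \<exists>L. L-lipschitz_on (ball x e \<inter> S) f)"

text \<open>Only meaningful for open \<open>S\<close> in a finite-dimensional space, where regularity of all
  directional derivatives is the same as regularity of the Frechet derivative.\<close>

fun Ck1_on ::
  "nat \<Rightarrow> 'a::euclidean_space set \<Rightarrow> ('a \<Rightarrow> 'b::real_normed_vector) \<Rightarrow> bool" where
  "Ck1_on 0 S f \<longleftrightarrow> locally_lipschitz_on S f"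
| "Ck1_on (Suc k) S f \<longleftrightarrow>
     f differentiable_on S \<and> (\<forall>v. Ck1_on k S (\<lambda>x. frechet_derivative f (at x) v))"


section \<open>Manifolds of class $C^{2,1}$\<close>

text \<open>The underlying topological space is a Hausdorff type \<open>'m\<close>.
  A chart is a pair of an open domain and a coordinate map; the values of the map outside the
  domain are irrelevant.\<close>

type_synonym ('m, 'n) chart = "'m set \<times> ('m \<Rightarrow> real ^ 'n)"

definition is_chart :: "('m::t2_space, 'n::finite) chart \<Rightarrow> bool" where
  "is_chart c \<longleftrightarrow> (case c of (U, \<phi>) \<Rightarrow>
     open U \<and> open (\<phi> ` U) \<and> homeomorphism U (\<phi> ` U) \<phi> (inv_into U \<phi>))"

definition transition ::
  "('m, 'n) chart \<Rightarrow> ('m, 'n) chart \<Rightarrow> real ^ 'n \<Rightarrow> real ^ 'n" where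
  "transition c c' = snd c' \<circ> inv_into (fst c) (snd c)"

definition C21_compatible :: "('m, 'n::finite) chart \<Rightarrow> ('m, 'n) chart \<Rightarrow> bool" where
  "C21_compatible c c' \<longleftrightarrow>
     Ck1_on 2 (snd c ` (fst c \<inter> fst c')) (transition c c') \<and>
     Ck1_on 2 (snd c' ` (fst c \<inter> fst c')) (transition c' c)"

definition maximal_C21_atlas :: "('m::t2_space, 'n::finite) chart set \<Rightarrow> bool" where
  "maximal_C21_atlas A \<longleftrightarrow>
     (\<forall>c\<in>A. is_chart c) \<and> (\<Union>c\<in>A. fst c) = UNIV \<and>
     (\<forall>c\<in>A. \<forall>c'\<in>A. C21_compatible c c') \<and>
     (\<forall>c. is_chart c \<and> (\<forall>c'\<in>A. C21_compatible c c') \<longrightarrow> c \<in> A)"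

definition paracompact_space :: "'a topology \<Rightarrow> bool" where
  "paracompact_space X \<longleftrightarrow>
     (\<forall>\<U>. (\<forall>U\<in>\<U>. openin X U) \<and> \<Union>\<U> = topspace X \<longrightarrow>
        (\<exists>\<V>. (\<forall>V\<in>\<V>. openin X V \<and> (\<exists>U\<in>\<U>. V \<subseteq> U)) \<and>
             \<Union>\<V> = topspace X \<and> locally_finite_in X \<V>))"

definition C21_manifold :: "('m::t2_space, 'n::finite) chart set \<Rightarrow> bool" where
  "C21_manifold A \<longleftrightarrow> maximal_C21_atlas A \<and>
     connected (UNIV :: 'm set) \<and> paracompact_space (euclidean :: 'm topology)"


section \<open>Lorentzian metrics of class $C^{1,1}$\<close>

text \<open>The index type \<open>'n\<close> carries no order; \<open>z\<close> is the index that is written \<open>0\<close> on paper.\<close>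

definition minkowski :: "'n::finite \<Rightarrow> real ^ 'n ^ 'n" where
  "minkowski z = (\<chi> \<alpha> \<beta>. if \<alpha> \<noteq> \<beta> then 0 else if \<alpha> = z then - 1 else 1)"

definition lorentzian_matrix :: "'n::finite \<Rightarrow> real ^ 'n ^ 'n \<Rightarrow> bool" where
  "lorentzian_matrix z G \<longleftrightarrow>
     transpose G = G \<and> (\<exists>P. invertible P \<and> transpose P ** G ** P = minkowski z)"

text \<open>A tensor field is given by its components in all charts: \<open>g c y\<close> is the matrix
  of the components in the chart \<open>c\<close>, at the point with coordinates \<open>y\<close>. Components in
  different charts are related by the transformation law of covariant 2-tensors.\<close>

type_synonym ('m, 'n) tensor2 = "('m, 'n) chart \<Rightarrow> real ^ 'n \<Rightarrow> real ^ 'n ^ 'n"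

definition C11_lorentzian_metric ::
  "('m::t2_space, 'n::finite) chart set \<Rightarrow> 'n \<Rightarrow> ('m, 'n) tensor2 \<Rightarrow> bool" where
  "C11_lorentzian_metric A z g \<longleftrightarrow>
     (\<forall>c\<in>A. Ck1_on 1 (snd c ` fst c) (g c) \<and>
            (\<forall>y \<in> snd c ` fst c. lorentzian_matrix z (g c y))) \<and>
     (\<forall>c\<in>A. \<forall>c'\<in>A. \<forall>q \<in> fst c \<inter> fst c'.
        let J = jacobian (transition c c') (at (snd c q))
        in g c (snd c q) = transpose J ** g c' (snd c' q) ** J)"

definition partial_metric ::
  "('m, 'n::finite) tensor2 \<Rightarrow> ('m, 'n) chart \<Rightarrow> real ^ 'n \<Rightarrow> 'n \<Rightarrow> 'n \<Rightarrow> 'n \<Rightarrow> real" where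
  "partial_metric g c y \<gamma> \<alpha> \<beta> = frechet_derivative (g c) (at y) (axis \<gamma> 1) $ \<alpha> $ \<beta>"

definition christoffel ::
  "('m, 'n::finite) tensor2 \<Rightarrow> ('m, 'n) chart \<Rightarrow> real ^ 'n \<Rightarrow> 'n \<Rightarrow> 'n \<Rightarrow> 'n \<Rightarrow> real" where
  "christoffel g c y \<mu> \<alpha> \<beta> =
     (1 / 2) * (\<Sum>\<sigma>\<in>UNIV. matrix_inv (g c y) $ \<mu> $ \<sigma> *
        (partial_metric g c y \<alpha> \<sigma> \<beta> + partial_metric g c y \<beta> \<sigma> \<alpha>
          - partial_metric g c y \<sigma> \<alpha> \<beta>))"


section \<open>Geodesics and the exponential map\<close>

text \<open>Stationary solutions are included here, since the zero vector belongs to the domain of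
  the exponential map. The function \<open>u\<close> is the coordinate velocity.\<close>

definition geodesic_solution ::
  "('m::t2_space, 'n::finite) chart set \<Rightarrow> ('m, 'n) tensor2 \<Rightarrow> real set \<Rightarrow> (real \<Rightarrow> 'm) \<Rightarrow> bool"
  where
  "geodesic_solution A g I \<gamma> \<longleftrightarrow>
     continuous_on I \<gamma> \<and>
     (\<forall>c\<in>A. \<exists>u. \<forall>t\<in>I. \<gamma> t \<in> fst c \<longrightarrow>
        ((snd c \<circ> \<gamma>) has_vector_derivative u t) (at t within I) \<and>
        (u has_vector_derivative
          (\<chi> \<mu>. - (\<Sum>\<alpha>\<in>UNIV. \<Sum>\<beta>\<in>UNIV.
                   christoffel g c (snd c (\<gamma> t)) \<mu> \<alpha> \<beta> * u t $ \<alpha> * u t $ \<beta>)))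
          (at t within I))"

definition geodesic ::
  "('m::t2_space, 'n::finite) chart set \<Rightarrow> ('m, 'n) tensor2 \<Rightarrow> real set \<Rightarrow> (real \<Rightarrow> 'm) \<Rightarrow> bool"
  where
  "geodesic A g I \<gamma> \<longleftrightarrow>
     geodesic_solution A g I \<gamma> \<and> (\<exists>s\<in>I. \<exists>t\<in>I. \<gamma> s \<noteq> \<gamma> t)"

text \<open>Below, the tangent space at a point \<open>q\<close> is represented by \<open>real ^ 'n\<close> through the
  coordinate basis of a chart \<open>c\<close> around \<open>q\<close>. Note that \<open>geodesic_solution\<close> refers to
  all charts, so geodesics may leave the domain of \<open>c\<close>.\<close>

definition geodesic_from ::
  "('m::t2_space, 'n::finite) chart set \<Rightarrow> ('m, 'n) tensor2 \<Rightarrow> ('m, 'n) chart \<Rightarrow> 'm \<Rightarrow>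
   real ^ 'n \<Rightarrow> (real \<Rightarrow> 'm) \<Rightarrow> bool" where
  "geodesic_from A g c q v \<gamma> \<longleftrightarrow>
     geodesic_solution A g {0..1} \<gamma> \<and> \<gamma> 0 = q \<and>
     ((snd c \<circ> \<gamma>) has_vector_derivative v) (at 0 within {0..1})"

definition exp_domain ::
  "('m::t2_space, 'n::finite) chart set \<Rightarrow> ('m, 'n) tensor2 \<Rightarrow> ('m, 'n) chart \<Rightarrow> 'm \<Rightarrow>
   (real ^ 'n) set" where
  "exp_domain A g c q = {v. \<exists>\<gamma>. geodesic_from A g c q v \<gamma>}"

definition exp_map ::
  "('m::t2_space, 'n::finite) chart set \<Rightarrow> ('m, 'n) tensor2 \<Rightarrow> ('m, 'n) chart \<Rightarrow> 'm \<Rightarrow>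
   real ^ 'n \<Rightarrow> 'm" where
  "exp_map A g c q v = (THE r. \<exists>\<gamma>. geodesic_from A g c q v \<gamma> \<and> \<gamma> 1 = r)"


section \<open>Convex normal sets and the squared distance\<close>

definition normal_domain ::
  "('m::t2_space, 'n::finite) chart set \<Rightarrow> ('m, 'n) tensor2 \<Rightarrow> ('m, 'n) chart \<Rightarrow> 'm \<Rightarrow>
   'm set \<Rightarrow> (real ^ 'n) set \<Rightarrow> bool" where
  "normal_domain A g c q C N \<longleftrightarrow>
     open N \<and> N \<subseteq> exp_domain A g c q \<and>
     (\<forall>v\<in>N. \<forall>s\<in>{0..1}. s *\<^sub>R v \<in> N) \<and>
     homeomorphism N C (exp_map A g c q) (inv_into N (exp_map A g c q)) \<and>
     (\<forall>(V, \<psi>)\<in>A.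
        locally_lipschitz_on {v \<in> N. exp_map A g c q v \<in> V} (\<psi> \<circ> exp_map A g c q) \<and>
        locally_lipschitz_on (\<psi> ` (V \<inter> C))
          (inv_into N (exp_map A g c q) \<circ> inv_into V \<psi>))"

definition convex_normal ::
  "('m::t2_space, 'n::finite) chart set \<Rightarrow> ('m, 'n) tensor2 \<Rightarrow> 'm set \<Rightarrow> bool" where
  "convex_normal A g C \<longleftrightarrow>
     open C \<and> (\<forall>q\<in>C. \<forall>c\<in>A. q \<in> fst c \<longrightarrow> (\<exists>N. normal_domain A g c q C N))"

text \<open>There is at most one \<open>N\<close> with \<open>normal_domain A g c q C N\<close>: a segment from the origin
  inside one such set is, by a continuity argument along the segment, the lift of its own
  image to any other. So the choice in the next definition is immaterial.\<close>

definition exp_inv ::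
  "('m::t2_space, 'n::finite) chart set \<Rightarrow> ('m, 'n) tensor2 \<Rightarrow> ('m, 'n) chart \<Rightarrow> 'm set \<Rightarrow>
   'm \<Rightarrow> 'm \<Rightarrow> real ^ 'n" where
  "exp_inv A g c C q = inv_into (SOME N. normal_domain A g c q C N) (exp_map A g c q)"

text \<open>The chart \<open>c\<close> around \<open>q\<close> only serves to evaluate the metric at \<open>q\<close> on a tangent vector;
  the value does not depend on it.\<close>

definition D2 ::
  "('m::t2_space, 'n::finite) chart set \<Rightarrow> ('m, 'n) tensor2 \<Rightarrow> ('m, 'n) chart \<Rightarrow> 'm set \<Rightarrow>
   'm \<Rightarrow> 'm \<Rightarrow> real" where
  "D2 A g c C q r =
     (let v = exp_inv A g c C q r in v \<bullet> (g c (snd c q) *v v))"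

definition coordinate_ball :: "('m, 'n::finite) chart \<Rightarrow> 'm \<Rightarrow> real \<Rightarrow> 'm set" where
  "coordinate_ball c p \<delta> = {q \<in> fst c. dist (snd c q) (snd c p) < \<delta>}"

end

theory Submission
  imports Defs
begin

text \<open>In the given chart the Christoffel symbols vanish at \<open>p\<close> and are Lipschitz, so on the ball of
radius \<open>\<delta>\<close> they are bounded by \<open>\<Lambda> * \<delta>\<close> and geodesics are nearly straight segments. All
errors are measured by the scale invariant number \<open>\<Lambda> * \<delta>\<^sup>2\<close>, which is as small as one
wishes. The metric is only \<open>C\<^sup>1\<^sup>,\<^sup>1\<close>, so the exponential map is merely Lipschitz and cannot
be differentiated; the proof therefore never differentiates it and works with the boundary value
problem for geodesics instead.

Any two points of the ball are joined by exactly one geodesic that stays in the ball. Existence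
is a contraction argument for the velocity (\<open>spray_curve_exists\<close>). Uniqueness comes from two
inequalities: the speed is at most twice the length of the chord (\<open>speed_bound\<close>), and two
geodesics \<open>x\<close>, \<open>y\<close> with common initial point satisfy
\<open>\<bar>x' - y' - (x 1 - y 1)\<bar> \<le> 48 * (\<Lambda> * \<delta>\<^sup>2) * \<bar>x 1 - y 1\<bar>\<close> at all times
(\<open>spray_curves_compare\<close>). The second one also says that the initial velocity is a bi-Lipschitz
function of the end point. Its image is open by invariance of domain, it is star-shaped by
rescaling of time, and on it the function is inverse to the exponential map. This makes the ball
convex normal (\<open>exists_normal_domain\<close>).

The squared distance of \<open>q\<close> and \<open>r\<close> is the constant value of \<open>g(x', x')\<close> along the
geodesic \<open>x\<close> from \<open>q\<close> to \<open>r\<close>. A geodesic is a critical point of the integral of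
\<open>g(x', x')\<close>, and the integrand is a \<open>C\<^sup>1\<^sup>,\<^sup>1\<close> function of position and velocity. Hence
moving the end point \<open>r\<close> by \<open>h\<close> changes the squared distance by \<open>2 * g\<^sub>r(P, h)\<close> up to a
quadratic error, where \<open>P\<close> is the velocity with which the geodesic arrives at \<open>r\<close>
(\<open>energy_first_variation\<close>).

Let \<open>x\<close> be a geodesic, and let \<open>P\<^sub>0\<close>, \<open>P\<^sub>1\<close> be the velocities with which the geodesics from
\<open>q\<close> arrive at \<open>x 0\<close> and \<open>x 1\<close>. The number to be estimated is twice
\<open>g(P\<^sub>1 - P\<^sub>0 - x', x')\<close> at time \<open>1\<close>, plus twice the difference of the values of
\<open>g(P\<^sub>0, x')\<close> at the times \<open>1\<close> and \<open>0\<close>. In the first term \<open>P\<^sub>1 - P\<^sub>0\<close> and \<open>x'\<close> both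
differ from the chord \<open>x 1 - x 0\<close> by a small multiple of its length. In the second one the
derivative of \<open>g(P\<^sub>0, x')\<close> is quadratic in \<open>x'\<close> with small coefficients
(\<open>energy_estimate\<close>).

It remains to connect coordinates and manifold. A curve that solves the geodesic equation in one
chart has to solve it in all charts. Since the metric is only once differentiable, this is done
with the Euler-Lagrange form of the equation, which involves first derivatives of the metric and
the symmetry of the second derivative of the coordinate change (\<open>connection_transform\<close>). Local
Lipschitz continuity of the Christoffel symbols gives uniqueness for the initial value problem on
the whole manifold (\<open>geodesic_from_unique\<close>), so the exponential map is well defined, and any
normal domain yields the squared distance computed above (\<open>normal_domain_inverse\<close>).\<close>

section \<open>Curves and second derivatives\<close>

lemma vector_derivative_bound:
  fixes f :: "real \<Rightarrow> 'a::real_normed_vector"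
  assumes "\<And>t. t \<in> {a..b} \<Longrightarrow> (f has_vector_derivative f' t) (at t within {a..b})"
    and "\<And>t. t \<in> {a..b} \<Longrightarrow> norm (f' t) \<le> B"
    and "s \<in> {a..b}" "t \<in> {a..b}"
  shows "norm (f t - f s) \<le> B * \<bar>t - s\<bar>"
proof -
  have "norm (f t - f s) \<le> B * norm (t - s)"
  proof (rule differentiable_bound[where S="{a..b}" and f'="\<lambda>t h. h *\<^sub>R f' t"])
    fix x assume x: "x \<in> {a..b}"
    show "(f has_derivative (\<lambda>h. h *\<^sub>R f' x)) (at x within {a..b})"
      using assms(1)[OF x] by (simp add: has_vector_derivative_def)
    show "onorm (\<lambda>h. h *\<^sub>R f' x) \<le> B"
      using assms(2)[OF x] onorm_scaleR_left[of "\<lambda>h::real. h" "f' x"]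
      by (simp add: onorm_id[unfolded id_def])
  qed (use assms in auto)
  then show ?thesis by simp
qed

text \<open>If the acceleration is at most \<open>B\<close>, the velocity varies by at most \<open>B\<close> on the unit interval,
so each of its values is within \<open>B\<close> of its mean, the chord.\<close>

lemma velocity_near_mean:
  fixes f :: "real \<Rightarrow> 'a::real_normed_vector"
  assumes f: "\<And>t. t \<in> {0..1} \<Longrightarrow> (f has_vector_derivative f' t) (at t within {0..1})"
    and f': "\<And>t. t \<in> {0..1} \<Longrightarrow> (f' has_vector_derivative f'' t) (at t within {0..1})"
    and B: "\<And>t. t \<in> {0..1} \<Longrightarrow> norm (f'' t) \<le> B"
    and t: "t \<in> {0..1}"
  shows "norm (f' t - (f 1 - f 0)) \<le> B"
proof -
  have "0 \<le> B" using B[OF t] norm_ge_zero order_trans by blast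
  have 1: "norm (f' s - f' t) \<le> B" if s: "s \<in> {0..1}" for s
  proof -
    have "norm (f' s - f' t) \<le> B * \<bar>s - t\<bar>"
      by (rule vector_derivative_bound[where f'=f'']) (use f' B s t in auto)
    also have "\<dots> \<le> B * 1" by (intro mult_left_mono) (use s t \<open>0 \<le> B\<close> in auto)
    finally show ?thesis by simp
  qed
  have "norm ((f 1 - 1 *\<^sub>R f' t) - (f 0 - 0 *\<^sub>R f' t)) \<le> B * \<bar>1 - 0\<bar>"
    by (rule vector_derivative_bound[where a=0 and b=1 and f'="\<lambda>s. f' s - f' t"])
      (auto intro!: derivative_eq_intros f 1)
  then show ?thesis by (simp add: norm_minus_commute algebra_simps)
qed

text \<open>If an interior value exceeded both end values, \<open>f'\<close> would be positive somewhere and negative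
later on, by the mean value theorem, and then \<open>f''\<close> would be negative in between.\<close>

lemma second_derivative_nonneg_imp_le_max:
  fixes f :: "real \<Rightarrow> real"
  assumes f: "\<And>t. t \<in> {0..1} \<Longrightarrow> (f has_vector_derivative f' t) (at t within {0..1})"
    and f': "\<And>t. t \<in> {0..1} \<Longrightarrow> (f' has_vector_derivative f'' t) (at t within {0..1})"
    and nn: "\<And>t. t \<in> {0..1} \<Longrightarrow> 0 \<le> f'' t"
    and t: "t \<in> {0..1}"
  shows "f t \<le> max (f 0) (f 1)"
proof (rule ccontr)
  assume "\<not> ?thesis"
  then have gt: "f t > f 0" "f t > f 1" by auto
  then have t': "0 < t" "t < 1" using t by (auto simp: less_le)
  have sub: "(h has_vector_derivative h' s) (at s within S)"
    if "\<And>t. t \<in> {0..1} \<Longrightarrow> (h has_vector_derivative h' t) (at t within {0..1})" "s \<in> S" "S \<subseteq> {0..1}"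
    for h h' s and S :: "real set"
    using that by (meson has_vector_derivative_within_subset subsetD)
  have mvt: "\<exists>s\<in>{a<..<b}. h b - h a = h' s * (b - a)"
    if "\<And>t. t \<in> {0..1} \<Longrightarrow> (h has_vector_derivative h' t) (at t within {0..1})" "0 \<le> a" "a < b" "b \<le> 1"
    for h h' :: "real \<Rightarrow> real" and a b
  proof -
    have "\<exists>s\<in>{a<..<b}. h b - h a = (\<lambda>x. x * h' s) (b - a)"
    proof (rule mvt_simple[where f'="\<lambda>s x. x * h' s"])
      fix s assume "a \<le> s" "s \<le> b"
      with that have "(h has_vector_derivative h' s) (at s within {a..b})"
        by (intro has_vector_derivative_within_subset[OF that(1)]) auto
      then show "(h has_derivative (\<lambda>x. x * h' s)) (at s within {a..b})"
        by (simp add: has_vector_derivative_def)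
    qed (use that in auto)
    then show ?thesis by (auto simp: mult.commute)
  qed
  obtain a where a: "a \<in> {0<..<t}" "f t - f 0 = f' a * (t - 0)" using mvt[OF f, of 0 t] t' by auto
  obtain b where b: "b \<in> {t<..<1}" "f 1 - f t = f' b * (1 - t)" using mvt[OF f, of t 1] t' by auto
  have "f' a > 0" using a gt t' by (metis diff_gt_0_iff_gt diff_zero zero_less_mult_pos2)
  moreover have "f' b < 0" using b gt t' by (smt (verit) mult_nonneg_nonneg)
  moreover obtain c where c: "c \<in> {a<..<b}" "f' b - f' a = f'' c * (b - a)"
    using mvt[OF f', of a b] a b by auto
  moreover have "0 \<le> f'' c * (b - a)" using nn[of c] a b c by auto
  ultimately show False by linarith
qed

text \<open>On an interval of length \<open>\<tau>\<close> with \<open>L * \<tau> \<le> 1 / 2\<close>, the maximal distance of two solutions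
is at most half of itself.\<close>

lemma ode_solution_unique_right:
  fixes F :: "'a::real_normed_vector \<Rightarrow> 'a" and y z :: "real \<Rightarrow> 'a"
  assumes y: "\<And>t. t \<in> {a..b} \<Longrightarrow> (y has_vector_derivative F (y t)) (at t within {a..b})"
    and z: "\<And>t. t \<in> {a..b} \<Longrightarrow> (z has_vector_derivative F (z t)) (at t within {a..b})"
    and ab: "a < b" and init: "y a = z a"
    and lip: "e > 0" "L-lipschitz_on (ball (y a) e) F"
  obtains h where "a < h" "h \<le> b" "\<And>t. t \<in> {a..h} \<Longrightarrow> y t = z t"
proof -
  have L: "0 \<le> L" using lip(2) lipschitz_on_nonneg by blast
  have cont: "continuous_on {a..b} y" "continuous_on {a..b} z"
    unfolding continuous_on_eq_continuous_within
    using y z has_vector_derivative_continuous by blast+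
  have "\<exists>d>0. \<forall>t\<in>{a..b}. dist t a < d \<longrightarrow> dist (y t) (y a) < e"
    using cont(1) ab lip(1) unfolding continuous_on_iff by (meson atLeastAtMost_iff less_eq_real_def order_refl)
  then obtain d1 where d1: "d1 > 0" "\<And>t. t\<in>{a..b} \<Longrightarrow> dist t a < d1 \<Longrightarrow> dist (y t) (y a) < e" by blast
  have "\<exists>d>0. \<forall>t\<in>{a..b}. dist t a < d \<longrightarrow> dist (z t) (z a) < e"
    using cont(2) ab lip(1) unfolding continuous_on_iff by (meson atLeastAtMost_iff less_eq_real_def order_refl)
  then obtain d2 where d2: "d2 > 0" "\<And>t. t\<in>{a..b} \<Longrightarrow> dist t a < d2 \<Longrightarrow> dist (z t) (z a) < e" by blast
  define \<tau> where "\<tau> = min (min (d1/2) (d2/2)) (min (b - a) (1 / (2 * (L + 1))))"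
  have \<tau>: "\<tau> > 0" "\<tau> < d1" "\<tau> < d2" "a + \<tau> \<le> b" "\<tau> \<le> 1 / (2 * (L + 1))"
    unfolding \<tau>_def using d1 d2 ab L by (auto simp: min_def)
  have "\<tau> * L \<le> \<tau> * (L + 1)" using \<tau> by (intro mult_left_mono) auto
  also have "\<dots> \<le> 1 / (2 * (L + 1)) * (L + 1)" using \<tau>(5) L by (intro mult_right_mono) auto
  also have "\<dots> = 1/2" using L by (simp add: divide_simps)
  finally have L\<tau>: "L * \<tau> \<le> 1/2" by (simp add: mult.commute)
  let ?I = "{a..a+\<tau>}"
  have I: "?I \<subseteq> {a..b}" using \<tau> by auto
  have "continuous_on ?I (\<lambda>t. norm (y t - z t))"
    by (intro continuous_intros continuous_on_subset[OF cont(1) I] continuous_on_subset[OF cont(2) I])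
  then obtain m where m: "m \<in> ?I" "\<And>t. t \<in> ?I \<Longrightarrow> norm (y t - z t) \<le> norm (y m - z m)"
    using continuous_attains_sup[of ?I "\<lambda>t. norm (y t - z t)"] \<tau> by auto
  have inball: "y t \<in> ball (y a) e" "z t \<in> ball (y a) e" if "t \<in> ?I" for t
    using d1(2)[of t] d2(2)[of t] that \<tau> init by (auto simp: dist_real_def dist_commute)
  have "norm ((y m - z m) - (y a - z a)) \<le> (L * norm (y m - z m)) * \<bar>m - a\<bar>"
  proof (rule vector_derivative_bound[where a=a and b="a+\<tau>" and f'="\<lambda>t. F (y t) - F (z t)"])
    fix t assume t: "t \<in> ?I"
    have "(y has_vector_derivative F (y t)) (at t within ?I)" "(z has_vector_derivative F (z t)) (at t within ?I)"
      using y z t I has_vector_derivative_within_subset by blast+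
    then show "((\<lambda>t. y t - z t) has_vector_derivative F (y t) - F (z t)) (at t within ?I)"
      by (rule has_vector_derivative_diff)
    have "norm (F (y t) - F (z t)) \<le> L * norm (y t - z t)"
      using lipschitz_on_normD[OF lip(2)] inball t by blast
    also have "\<dots> \<le> L * norm (y m - z m)" using m t L by (intro mult_left_mono) auto
    finally show "norm (F (y t) - F (z t)) \<le> L * norm (y m - z m)" .
  qed (use m \<tau> in auto)
  also have "\<dots> \<le> (L * norm (y m - z m)) * \<tau>"
    using m L by (intro mult_left_mono) auto
  also have "\<dots> = (L * \<tau>) * norm (y m - z m)" by simp
  also have "\<dots> \<le> (1/2) * norm (y m - z m)" by (intro mult_right_mono L\<tau>) auto
  finally have "norm (y m - z m) \<le> 0" using init by simp
  then have "y t = z t" if "t \<in> ?I" for t using m(2)[OF that] by simp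
  with \<tau> show ?thesis by (intro that[of "a+\<tau>"]) auto
qed

text \<open>The second difference over the parallelogram spanned by \<open>s *\<^sub>R a\<close> and \<open>s *\<^sub>R b\<close> is the
increment of \<open>t \<mapsto> f (x + t s a + s b) - f (x + t s a)\<close> over the unit interval, and the
derivative of this function is controlled by that of \<open>y \<mapsto> f' y a\<close>.\<close>

lemma second_difference_bound:
  fixes f :: "'a::real_normed_vector \<Rightarrow> 'b::real_normed_vector"
  assumes S: "open S" "x \<in> S"
    and f: "\<And>y. y \<in> S \<Longrightarrow> (f has_derivative f' y) (at y)"
    and f2: "((\<lambda>y. f' y a) has_derivative D) (at x)"
    and e: "e > 0"
  shows "\<exists>d>0. \<forall>s. 0 < s \<and> s < d \<longrightarrow>
    norm (f (x + s *\<^sub>R a + s *\<^sub>R b) - f (x + s *\<^sub>R a) - f (x + s *\<^sub>R b) + f x - (s^2) *\<^sub>R D b) \<le> e * s^2"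
proof -
  define k where "k = norm a + norm b + 1"
  have k: "k > 0" unfolding k_def by (smt (verit) norm_ge_zero)
  obtain r where r: "r > 0" "ball x r \<subseteq> S" using S openE by blast
  have "e / (2 * k) > 0" using e k by simp
  then obtain d where d: "d > 0" "\<And>y. norm (y - x) < d \<Longrightarrow>
      norm (f' y a - f' x a - D (y - x)) \<le> e / (2 * k) * norm (y - x)"
    using f2 unfolding has_derivative_at_alt by blast
  have linD: "linear D" using f2 has_derivative_linear by blast
  show ?thesis
  proof (intro exI conjI allI impI)
    show "0 < min r d / k" using r d k by simp
    fix s :: real assume s: "0 < s \<and> s < min r d / k"
    then have sk: "s * k < r" "s * k < d" using k by (auto simp: less_divide_eq min_def split: if_splits)
    have nb: "norm (t *\<^sub>R (s *\<^sub>R a) + c *\<^sub>R (s *\<^sub>R b)) \<le> s * k" if "t \<in> {0..1}" "c \<in> {0..1}" for t c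
    proof -
      have "norm (t *\<^sub>R (s *\<^sub>R a) + c *\<^sub>R (s *\<^sub>R b)) \<le> t * (s * norm a) + c * (s * norm b)"
        using that s by (intro norm_triangle_le) auto
      also have "\<dots> \<le> 1 * (s * norm a) + 1 * (s * norm b)"
        by (intro add_mono mult_right_mono) (use that s in auto)
      also have "\<dots> \<le> s * k" using s by (simp add: k_def algebra_simps)
      finally show ?thesis .
    qed
    let ?y = "\<lambda>t c. x + (t *\<^sub>R (s *\<^sub>R a) + c *\<^sub>R (s *\<^sub>R b))"
    have inS: "?y t c \<in> S" if "t \<in> {0..1}" "c \<in> {0..1}" for t c
    proof -
      have "?y t c \<in> ball x r" using nb[OF that] sk by (simp add: mem_ball dist_commute[of x] dist_norm[of _ x])
      then show ?thesis using r(2) by blast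
    qed
    define h where "h = (\<lambda>t. f (?y t 1) - f (?y t 0) - (t * s^2) *\<^sub>R D b)"
    have dy: "((\<lambda>t. f (?y t c)) has_vector_derivative s *\<^sub>R f' (?y t c) a) (at t within {0..1})"
      if "t \<in> {0..1}" "c \<in> {0..1}" for t c
    proof -
      have "((\<lambda>t. ?y t c) has_vector_derivative s *\<^sub>R a) (at t within {0..1})"
        by (auto intro!: derivative_eq_intros)
      from vector_derivative_diff_chain_within[OF this, of f "f' (?y t c)"] f[OF inS[OF that]]
      have "(f \<circ> (\<lambda>t. ?y t c) has_vector_derivative f' (?y t c) (s *\<^sub>R a)) (at t within {0..1})"
        using has_derivative_at_withinI by blast
      then show ?thesis
        unfolding linear_scale[OF has_derivative_linear[OF f[OF inS[OF that]]]] o_def .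
    qed
    have "norm (h 1 - h 0) \<le> (e * s^2) * \<bar>1 - 0\<bar>"
    proof (rule vector_derivative_bound[where a=0 and b=1
          and f'="\<lambda>t. s *\<^sub>R f' (?y t 1) a - s *\<^sub>R f' (?y t 0) a - (s^2) *\<^sub>R D b"])
      fix t :: real assume t: "t \<in> {0..1}"
      show "(h has_vector_derivative s *\<^sub>R f' (?y t 1) a - s *\<^sub>R f' (?y t 0) a - (s^2) *\<^sub>R D b) (at t within {0..1})"
        unfolding h_def
        by (intro has_vector_derivative_diff dy t) (auto intro!: derivative_eq_intros)
      have "f' (?y t 1) a - f' (?y t 0) a - s *\<^sub>R D b
          = (f' (?y t 1) a - f' x a - D (?y t 1 - x)) - (f' (?y t 0) a - f' x a - D (?y t 0 - x))"
        by (simp add: linear_add[OF linD] linear_scale[OF linD])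
      also have "norm \<dots> \<le> e / (2*k) * (s*k) + e / (2*k) * (s*k)"
      proof (rule norm_triangle_le_diff[OF add_mono])
        have "norm (f' (?y t c) a - f' x a - D (?y t c - x)) \<le> e / (2*k) * (s*k)" if "c \<in> {0..1}" for c
        proof -
          have n: "norm (?y t c - x) \<le> s * k" using nb[OF t that] by simp
          have "norm (f' (?y t c) a - f' x a - D (?y t c - x)) \<le> e / (2*k) * norm (?y t c - x)"
            using n sk by (intro d(2)) linarith
          also have "\<dots> \<le> e / (2*k) * (s*k)" using n e k by (intro mult_left_mono) auto
          finally show ?thesis .
        qed
        from this[of 0] this[of 1]
        show "norm (f' (?y t 1) a - f' x a - D (?y t 1 - x)) \<le> e / (2*k) * (s*k)"
          "norm (f' (?y t 0) a - f' x a - D (?y t 0 - x)) \<le> e / (2*k) * (s*k)" by auto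
      qed
      also have "\<dots> = e * s" using k by (simp add: field_simps)
      finally have "s * norm (f' (?y t 1) a - f' (?y t 0) a - s *\<^sub>R D b) \<le> s * (e * s)"
        using s by (intro mult_left_mono) auto
      moreover have "s *\<^sub>R f' (?y t 1) a - s *\<^sub>R f' (?y t 0) a - (s^2) *\<^sub>R D b
          = s *\<^sub>R (f' (?y t 1) a - f' (?y t 0) a - s *\<^sub>R D b)"
        by (simp add: algebra_simps power2_eq_square)
      ultimately show "norm (s *\<^sub>R f' (?y t 1) a - s *\<^sub>R f' (?y t 0) a - (s^2) *\<^sub>R D b) \<le> e * s^2"
        using s by (simp add: power2_eq_square mult_ac)
    qed auto
    then show "norm (f (x + s *\<^sub>R a + s *\<^sub>R b) - f (x + s *\<^sub>R a) - f (x + s *\<^sub>R b) + f x - (s^2) *\<^sub>R D b) \<le> e * s^2"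
      by (simp add: h_def algebra_simps)
  qed
qed

text \<open>The second difference is symmetric in \<open>a\<close> and \<open>b\<close>, so its two expansions agree to second
order.\<close>

lemma second_derivative_symmetric:
  fixes f :: "'a::real_normed_vector \<Rightarrow> 'b::real_normed_vector"
  assumes S: "open S" "x \<in> S"
    and f: "\<And>y. y \<in> S \<Longrightarrow> (f has_derivative f' y) (at y)"
    and f2: "\<And>a. ((\<lambda>y. f' y a) has_derivative (\<lambda>h. f'' h a)) (at x)"
  shows "f'' a b = f'' b a"
proof (rule ccontr)
  assume "f'' a b \<noteq> f'' b a"
  then have n: "norm (f'' a b - f'' b a) > 0" (is "?n > 0") by simp
  obtain d1 where d1: "d1 > 0" "\<And>s. 0 < s \<and> s < d1 \<Longrightarrow>
     norm (f (x + s *\<^sub>R a + s *\<^sub>R b) - f (x + s *\<^sub>R a) - f (x + s *\<^sub>R b) + f x - (s^2) *\<^sub>R f'' b a) \<le> (?n/3) * s^2"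
    using second_difference_bound[OF S f f2[of a], where e="?n/3" and b=b] n by auto
  obtain d2 where d2: "d2 > 0" "\<And>s. 0 < s \<and> s < d2 \<Longrightarrow>
     norm (f (x + s *\<^sub>R b + s *\<^sub>R a) - f (x + s *\<^sub>R b) - f (x + s *\<^sub>R a) + f x - (s^2) *\<^sub>R f'' a b) \<le> (?n/3) * s^2"
    using second_difference_bound[OF S f f2[of b], where e="?n/3" and b=a] n by auto
  define s where "s = min d1 d2 / 2"
  have s: "0 < s" "s < d1" "s < d2" using d1(1) d2(1) by (auto simp: s_def)
  let ?\<Delta> = "f (x + s *\<^sub>R a + s *\<^sub>R b) - f (x + s *\<^sub>R a) - f (x + s *\<^sub>R b) + f x"
  have comm: "f (x + s *\<^sub>R b + s *\<^sub>R a) - f (x + s *\<^sub>R b) - f (x + s *\<^sub>R a) + f x = ?\<Delta>"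
    by (simp add: add_ac)
  have bd2: "norm (?\<Delta> - (s^2) *\<^sub>R f'' a b) \<le> (?n/3) * s^2"
    using d2(2)[of s] s unfolding comm by auto
  have "(s^2) *\<^sub>R (f'' a b - f'' b a) = (?\<Delta> - (s^2) *\<^sub>R f'' b a) - (?\<Delta> - (s^2) *\<^sub>R f'' a b)"
    by (simp add: algebra_simps)
  also have "norm \<dots> \<le> (?n/3) * s^2 + (?n/3) * s^2"
    by (intro norm_triangle_le_diff add_mono d1 bd2) (use s in auto)
  finally have "s^2 * ?n \<le> s^2 * (2 * ?n / 3)" by (simp only: norm_scaleR) simp
  then have "?n \<le> 2 * ?n / 3" using s by (simp only: mult_le_cancel_left_pos zero_less_power)
  with n show False by simp
qed

section \<open>Curves of a quadratic spray in a small ball\<close>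

text \<open>The coordinate picture of the connection: \<open>\<Gamma> x\<close> is the bilinear form of the Christoffel
symbols at the point with coordinates \<open>x\<close>, and \<open>p\<close> is the centre of the chart. Everything takes
place in the ball of radius \<open>\<delta>\<close>; the larger radius \<open>5 * \<delta>\<close> gives room to the fixed point
argument, whose solution is located in the small ball only afterwards. The product
\<open>\<Lambda> * \<delta>\<^sup>2\<close> is invariant under rescaling of the coordinates, and its bound makes all
contraction constants below at most \<open>1 / 2\<close>.\<close>

locale flat_spray =
  fixes \<Gamma> :: "'a::euclidean_space \<Rightarrow> 'a \<Rightarrow> 'a \<Rightarrow> 'a" and p :: 'a and \<delta> \<Lambda> :: real
  assumes bilinear_\<Gamma>: "bilinear (\<Gamma> x)"
    and \<Gamma>_center: "\<Gamma> p u v = 0"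
    and \<Gamma>_lipschitz: "x \<in> cball p (5 * \<delta>) \<Longrightarrow> y \<in> cball p (5 * \<delta>) \<Longrightarrow>
      norm (\<Gamma> x u v - \<Gamma> y u v) \<le> \<Lambda> * norm (x - y) * norm u * norm v"
    and \<delta>_pos: "0 < \<delta>" and \<Lambda>_nonneg: "0 \<le> \<Lambda>" and small: "\<Lambda> * \<delta>\<^sup>2 \<le> 1 / 500"
begin

lemma \<Gamma>_bound:
  assumes "x \<in> cball p (5 * \<delta>)" "x \<in> cball p \<rho>"
  shows "norm (\<Gamma> x u v) \<le> \<Lambda> * \<rho> * norm u * norm v"
proof -
  have "norm (\<Gamma> x u v) \<le> \<Lambda> * norm (x - p) * norm u * norm v"
    using \<Gamma>_lipschitz[OF assms(1), of p u v] \<Gamma>_center \<delta>_pos by simp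
  also have "\<dots> \<le> \<Lambda> * \<rho> * norm u * norm v"
    by (intro mult_right_mono mult_left_mono \<Lambda>_nonneg) (use assms in \<open>auto simp: dist_norm norm_minus_commute\<close>)
  finally show ?thesis .
qed

lemma \<Gamma>_diag_diff:
  assumes x: "x \<in> cball p (5 * \<delta>)" and y: "y \<in> cball p (5 * \<delta>)" "y \<in> cball p \<rho>"
    and uv: "norm u \<le> M" "norm v \<le> M"
  shows "norm (\<Gamma> x u u - \<Gamma> y v v) \<le> \<Lambda> * M\<^sup>2 * norm (x - y) + 2 * \<Lambda> * \<rho> * M * norm (u - v)"
proof -
  have M: "0 \<le> M" using uv(1) norm_ge_zero order_trans by blast
  have \<rho>: "0 \<le> \<rho>" using y(2) by (auto intro: order_trans[OF zero_le_dist])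
  have "\<Gamma> x u u - \<Gamma> y v v = (\<Gamma> x u u - \<Gamma> y u u) + (\<Gamma> y (u - v) u + \<Gamma> y v (u - v))"
    using bilinear_\<Gamma>[of y] by (simp add: bilinear_lsub bilinear_rsub)
  also have "norm \<dots> \<le> \<Lambda> * norm (x - y) * norm u * norm u
      + (\<Lambda> * \<rho> * norm (u - v) * norm u + \<Lambda> * \<rho> * norm v * norm (u - v))"
    by (intro norm_triangle_le add_mono \<Gamma>_lipschitz \<Gamma>_bound order_trans[OF norm_triangle_ineq] x y)
  also have "\<dots> \<le> \<Lambda> * norm (x - y) * M * M
      + (\<Lambda> * \<rho> * norm (u - v) * M + \<Lambda> * \<rho> * M * norm (u - v))"
    by (intro add_mono mult_mono order_refl) (use M \<rho> \<Lambda>_nonneg uv in auto)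
  finally show ?thesis by (simp add: power2_eq_square algebra_simps)
qed

definition spray_curve :: "(real \<Rightarrow> 'a) \<Rightarrow> (real \<Rightarrow> 'a) \<Rightarrow> bool" where
  "spray_curve x u \<longleftrightarrow> (\<forall>t\<in>{0..1}. x t \<in> ball p \<delta> \<and>
     (x has_vector_derivative u t) (at t within {0..1}) \<and>
     (u has_vector_derivative - \<Gamma> (x t) (u t) (u t)) (at t within {0..1}))"

lemma spray_curveD:
  assumes "spray_curve x u" "t \<in> {0..1}"
  shows "x t \<in> ball p \<delta>" "(x has_vector_derivative u t) (at t within {0..1})"
    "(u has_vector_derivative - \<Gamma> (x t) (u t) (u t)) (at t within {0..1})"
    "x t \<in> cball p \<delta>" "x t \<in> cball p (5 * \<delta>)"
proof -
  show d: "x t \<in> ball p \<delta>" and "(x has_vector_derivative u t) (at t within {0..1})"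
    and "(u has_vector_derivative - \<Gamma> (x t) (u t) (u t)) (at t within {0..1})"
    using assms by (auto simp: spray_curve_def)
  show "x t \<in> cball p \<delta>" "x t \<in> cball p (5 * \<delta>)" using d \<delta>_pos by auto
qed

lemma spray_curve_max_speed:
  assumes "spray_curve x u"
  obtains m where "m \<in> {0..1}" "\<forall>t\<in>{0..1}. norm (u t) \<le> norm (u m)"
proof -
  have "continuous_on {0..1} u"
    unfolding continuous_on_eq_continuous_within
    using spray_curveD(3)[OF assms] has_vector_derivative_continuous by blast
  then have "continuous_on {0..1} (\<lambda>t. norm (u t))" by (intro continuous_intros)
  then show ?thesis
    using continuous_attains_sup[of "{0..1}" "\<lambda>t. norm (u t)"] that
    by auto
qed

lemma acceleration_bound:
  assumes "spray_curve x u" "t \<in> {0..1}" "norm (u t) \<le> M"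
  shows "norm (- \<Gamma> (x t) (u t) (u t)) \<le> \<Lambda> * \<delta> * M\<^sup>2"
proof -
  have M: "0 \<le> M" using assms(3) norm_ge_zero order_trans by blast
  have "norm (- \<Gamma> (x t) (u t) (u t)) \<le> \<Lambda> * \<delta> * norm (u t) * norm (u t)"
    using \<Gamma>_bound spray_curveD[OF assms(1,2)] by simp
  also have "\<dots> \<le> \<Lambda> * \<delta> * M * M"
    by (intro mult_mono order_refl) (use M \<Lambda>_nonneg \<delta>_pos assms in auto)
  finally show ?thesis by (simp add: power2_eq_square mult_ac)
qed

text \<open>A geodesic that remains in a small ball is slow. If its maximal speed \<open>M\<close> exceeded \<open>8 * \<delta>\<close>, then near
the time \<open>m\<close> where it is attained the curve would run in an almost constant direction for long
enough to leave the ball: the acceleration is at most \<open>\<kappa> * M\<^sup>2\<close>, so the velocity is nearly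
constant for half a unit of time or, if \<open>\<kappa> * M\<close> is large, for a time of order
\<open>1 / (\<kappa> * M)\<close>, in which a distance of order \<open>1 / \<kappa>\<close>, much larger than \<open>\<delta>\<close>, is covered.
Once \<open>M \<le> 8 * \<delta>\<close> is known, comparison with the chord improves the bound.\<close>

lemma speed_bound:
  assumes xu: "spray_curve x u" and t: "t \<in> {0..1}"
  shows "norm (u t) \<le> 2 * norm (x 1 - x 0)"
proof -
  obtain m where m: "m \<in> {0..1}" and max: "\<And>t. t \<in> {0..1} \<Longrightarrow> norm (u t) \<le> norm (u m)"
    by (rule spray_curve_max_speed[OF xu]) blast
  define M where "M = norm (u m)"
  define \<kappa> where "\<kappa> = \<Lambda> * \<delta>"
  have \<kappa>: "0 \<le> \<kappa>" "\<kappa> * \<delta> \<le> 1/500"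
    using \<Lambda>_nonneg \<delta>_pos small by (auto simp: \<kappa>_def power2_eq_square mult_ac)
  have M: "0 \<le> M" by (simp add: M_def)
  have acc: "norm (- \<Gamma> (x t) (u t) (u t)) \<le> \<kappa> * M\<^sup>2" if "t \<in> {0..1}" for t
    using acceleration_bound[OF xu that max[OF that]] by (simp add: \<kappa>_def M_def)
  have M8: "M \<le> 8 * \<delta>"
  proof (rule ccontr)
    assume nM: "\<not> M \<le> 8 * \<delta>"
    \<comment> \<open>The window around \<open>m\<close>: short enough to fit into the unit interval on one side of \<open>m\<close>, and
such that the velocity changes by at most \<open>M / 2\<close> in it.\<close>
    define h where "h = (if \<kappa> * M \<le> 1 then 1/2 else 1 / (2 * (\<kappa> * M)))"
    have h: "0 < h" "h \<le> 1/2" "h * (\<kappa> * M) \<le> 1/2"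
      by (auto simp: h_def divide_simps)
    define \<sigma> :: real where "\<sigma> = (if m \<le> 1/2 then m + h else m - h)"
    define a b where "a = min m \<sigma>" and "b = max m \<sigma>"
    have ab: "{a..b} \<subseteq> {0..1}" "m \<in> {a..b}" "\<sigma> \<in> {a..b}" "\<bar>\<sigma> - m\<bar> = h"
      using h m by (auto simp: a_def b_def \<sigma>_def)
    have dm: "\<bar>s - m\<bar> \<le> h" if "s \<in> {a..b}" for s
      using that h by (auto simp: a_def b_def \<sigma>_def split: if_splits)
    have uu: "norm (u s - u m) \<le> \<kappa> * M\<^sup>2 * h" if s: "s \<in> {a..b}" for s
    proof -
      have "norm (u s - u m) \<le> \<kappa> * M\<^sup>2 * \<bar>s - m\<bar>"
        by (rule vector_derivative_bound[where a=0 and b=1 and f'="\<lambda>t. - \<Gamma> (x t) (u t) (u t)"])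
          (use spray_curveD[OF xu] acc s m ab in auto)
      also have "\<dots> \<le> \<kappa> * M\<^sup>2 * h" by (intro mult_left_mono dm s) (use \<kappa> in auto)
      finally show ?thesis .
    qed
    have "norm ((x \<sigma> - \<sigma> *\<^sub>R u m) - (x m - m *\<^sub>R u m)) \<le> (\<kappa> * M\<^sup>2 * h) * \<bar>\<sigma> - m\<bar>"
    proof (rule vector_derivative_bound[where f'="\<lambda>s. u s - u m"])
      fix s assume s: "s \<in> {a..b}"
      have "(x has_vector_derivative u s) (at s within {a..b})"
        using has_vector_derivative_within_subset[OF spray_curveD(2)[OF xu]] ab s by blast
      then show "((\<lambda>s. x s - s *\<^sub>R u m) has_vector_derivative u s - u m) (at s within {a..b})"
        by (auto intro!: derivative_eq_intros)
    qed (use uu ab in auto)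
    moreover have "(x \<sigma> - \<sigma> *\<^sub>R u m) - (x m - m *\<^sub>R u m) = (x \<sigma> - x m) - (\<sigma> - m) *\<^sub>R u m"
      by (simp add: algebra_simps)
    ultimately have "norm ((x \<sigma> - x m) - (\<sigma> - m) *\<^sub>R u m) \<le> \<kappa> * M\<^sup>2 * h * h"
      using ab by simp
    moreover have "norm ((\<sigma> - m) *\<^sub>R u m) = h * M" using ab by (simp add: M_def)
    moreover have "norm (x \<sigma> - x m) \<le> 2 * \<delta>"
    proof -
      have "dist (x \<sigma>) (x m) \<le> \<delta> + \<delta>"
        using spray_curveD(1)[OF xu, of \<sigma>] spray_curveD(1)[OF xu, of m] ab m
          dist_triangle[of "x \<sigma>" "x m" p] by (auto simp: dist_commute)
      then show ?thesis by (simp add: dist_norm)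
    qed
    ultimately have "h * M \<le> 2 * \<delta> + \<kappa> * M\<^sup>2 * h * h"
      using norm_triangle_ineq2[of "(\<sigma> - m) *\<^sub>R u m" "x \<sigma> - x m"] by (simp add: norm_minus_commute)
    moreover have "\<kappa> * M\<^sup>2 * h * h = (h * (\<kappa> * M)) * (h * M)" by (simp add: power2_eq_square)
    moreover have "(h * (\<kappa> * M)) * (h * M) \<le> 1/2 * (h * M)"
      using h M by (intro mult_right_mono) auto
    ultimately have hM: "h * M \<le> 4 * \<delta>" by simp
    show False
    proof (cases "\<kappa> * M \<le> 1")
      case True then show ?thesis using hM nM by (simp add: h_def)
    next
      case False
      then have "\<kappa> > 0" using \<kappa> by (cases "\<kappa> = 0") auto
      have "M > 0" using nM \<delta>_pos by linarith
      then have "\<kappa> * (h * M) = 1/2" using False \<open>\<kappa> > 0\<close> by (simp add: h_def divide_simps)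
      moreover have "\<kappa> * (h * M) \<le> \<kappa> * (4 * \<delta>)" using hM \<kappa> by (intro mult_left_mono) auto
      ultimately show False using \<kappa> by linarith
    qed
  qed
  have "norm (u m - (x 1 - x 0)) \<le> \<kappa> * M\<^sup>2"
    by (rule velocity_near_mean[where f''="\<lambda>t. - \<Gamma> (x t) (u t) (u t)"])
      (use spray_curveD[OF xu] acc m in auto)
  moreover have "\<kappa> * M\<^sup>2 \<le> M / 2"
  proof -
    have "\<kappa> * M \<le> \<kappa> * (8 * \<delta>)" using M8 \<kappa> by (intro mult_left_mono) auto
    then have "\<kappa> * M \<le> 1/2" using \<kappa> by linarith
    then have "(\<kappa> * M) * M \<le> 1/2 * M" using M by (intro mult_right_mono) auto
    then show ?thesis by (simp add: power2_eq_square)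
  qed
  ultimately have "M \<le> 2 * norm (x 1 - x 0)"
    using norm_triangle_ineq2[of "u m" "x 1 - x 0"] by (simp add: M_def)
  then show ?thesis using max[OF t] by (simp add: M_def)
qed

lemma endpoints_close:
  assumes "q \<in> ball p \<delta>" "r \<in> ball p \<delta>"
  shows "norm (r - q) \<le> 2 * \<delta>"
  using dist_triangle[of r q p] assms by (simp add: dist_norm norm_minus_commute)

lemma chord_bound: "spray_curve x u \<Longrightarrow> norm (x 1 - x 0) \<le> 2 * \<delta>"
  using endpoints_close[of "x 0" "x 1"] spray_curveD(1)[of x u 0] spray_curveD(1)[of x u 1] by simp

lemma speed_bound_radius:
  assumes "spray_curve x u" "t \<in> {0..1}"
  shows "norm (u t) \<le> 4 * \<delta>"
  using speed_bound[OF assms] chord_bound[OF assms(1)] by linarith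

lemma velocity_near_chord:
  assumes "spray_curve x u" "t \<in> {0..1}"
  shows "norm (u t - (x 1 - x 0)) \<le> 8 * (\<Lambda> * \<delta>\<^sup>2) * norm (x 1 - x 0)"
proof -
  let ?e = "norm (x 1 - x 0)"
  have "norm (u t - (x 1 - x 0)) \<le> \<Lambda> * \<delta> * (2 * ?e)\<^sup>2"
    by (rule velocity_near_mean[where f''="\<lambda>t. - \<Gamma> (x t) (u t) (u t)"])
      (use assms(2) spray_curveD[OF assms(1)] acceleration_bound[OF assms(1) _ speed_bound[OF assms(1)]] in blast)+
  also have "\<dots> = 4 * \<Lambda> * \<delta> * ?e * ?e" by (simp add: power2_eq_square)
  also have "\<dots> \<le> 4 * \<Lambda> * \<delta> * ?e * (2 * \<delta>)"
    using chord_bound[OF assms(1)] \<Lambda>_nonneg \<delta>_pos by (intro mult_left_mono) auto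
  finally show ?thesis by (simp add: power2_eq_square mult_ac)
qed

text \<open>The difference \<open>x - y\<close> vanishes at time \<open>0\<close>, so it is at most the maximum \<open>W\<close> of
\<open>norm (u - v)\<close>. Hence the second derivative of \<open>x - y\<close> is at most a small multiple of \<open>W\<close>, and
\<open>u - v\<close> is close to its mean \<open>x 1 - y 1\<close>.\<close>

lemma spray_curves_compare:
  assumes xu: "spray_curve x u" and yv: "spray_curve y v" and init: "x 0 = y 0" and t: "t \<in> {0..1}"
  shows "norm (u t - v t) \<le> 2 * norm (x 1 - y 1)"
    and "norm (x t - y t) \<le> 2 * norm (x 1 - y 1)"
    and "norm (u t - v t - (x 1 - y 1)) \<le> 48 * (\<Lambda> * \<delta>\<^sup>2) * norm (x 1 - y 1)"
proof -
  define \<theta> where "\<theta> = \<Lambda> * \<delta>\<^sup>2"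
  have \<theta>: "0 \<le> \<theta>" "\<theta> \<le> 1/500" using \<Lambda>_nonneg small by (auto simp: \<theta>_def)
  have "continuous_on {0..1} (\<lambda>t. norm (u t - v t))"
    by (intro continuous_intros; unfold continuous_on_eq_continuous_within)
      (use spray_curveD(3)[OF xu] spray_curveD(3)[OF yv] has_vector_derivative_continuous in blast)+
  then obtain m where m: "m \<in> {0..1}" and max: "\<And>t. t \<in> {0..1} \<Longrightarrow> norm (u t - v t) \<le> norm (u m - v m)"
    using continuous_attains_sup[of "{0..1}" "\<lambda>t. norm (u t - v t)"] by auto
  define W where "W = norm (u m - v m)"
  have W: "0 \<le> W" by (simp add: W_def)
  have xy: "norm (x s - y s) \<le> W" if s: "s \<in> {0..1}" for s
  proof -
    have "norm ((x s - y s) - (x 0 - y 0)) \<le> W * \<bar>s - 0\<bar>"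
      by (rule vector_derivative_bound[where f'="\<lambda>t. u t - v t"])
        (use s max spray_curveD[OF xu] spray_curveD[OF yv] in
          \<open>auto intro!: has_vector_derivative_diff simp: W_def\<close>)
    also have "\<dots> \<le> W * 1" using s W by (intro mult_left_mono) auto
    finally show ?thesis using init by simp
  qed
  have acc: "norm (- \<Gamma> (x s) (u s) (u s) - - \<Gamma> (y s) (v s) (v s)) \<le> 24 * \<theta> * W" if s: "s \<in> {0..1}" for s
  proof -
    have "norm (\<Gamma> (x s) (u s) (u s) - \<Gamma> (y s) (v s) (v s))
        \<le> \<Lambda> * (4 * \<delta>)\<^sup>2 * norm (x s - y s) + 2 * \<Lambda> * \<delta> * (4 * \<delta>) * norm (u s - v s)"
      by (intro \<Gamma>_diag_diff spray_curveD[OF xu s] spray_curveD[OF yv s] speed_bound_radius[OF xu s] speed_bound_radius[OF yv s])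
    also have "\<dots> \<le> \<Lambda> * (4 * \<delta>)\<^sup>2 * W + 2 * \<Lambda> * \<delta> * (4 * \<delta>) * W"
      using max[OF s] xy[OF s] \<Lambda>_nonneg \<delta>_pos by (intro add_mono mult_left_mono) (auto simp: W_def)
    also have "\<dots> = 24 * \<theta> * W" by (simp add: \<theta>_def power2_eq_square algebra_simps)
    finally show ?thesis by (simp add: norm_minus_commute)
  qed
  have near: "norm ((u s - v s) - ((x 1 - y 1) - (x 0 - y 0))) \<le> 24 * \<theta> * W" if "s \<in> {0..1}" for s
    by (rule velocity_near_mean[where f''="\<lambda>s. - \<Gamma> (x s) (u s) (u s) - - \<Gamma> (y s) (v s) (v s)"])
      (use that acc spray_curveD[OF xu] spray_curveD[OF yv] in
        \<open>auto intro!: has_vector_derivative_diff simp del: minus_diff_minus diff_minus_eq_add\<close>)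
  have "24 * \<theta> * W \<le> W / 2" using mult_right_mono[OF \<theta>(2) W] mult_nonneg_nonneg[OF \<theta>(1) W] by simp
  then have W2: "W \<le> 2 * norm (x 1 - y 1)"
    using near[OF m] init norm_triangle_ineq2[of "u m - v m" "x 1 - y 1"] by (simp add: W_def)
  show "norm (u t - v t) \<le> 2 * norm (x 1 - y 1)" using max[OF t] W2 by (simp add: W_def)
  show "norm (x t - y t) \<le> 2 * norm (x 1 - y 1)" using xy[OF t] W2 by simp
  have "24 * \<theta> * W \<le> 24 * \<theta> * (2 * norm (x 1 - y 1))" using W2 \<theta> by (intro mult_left_mono) auto
  then show "norm (u t - v t - (x 1 - y 1)) \<le> 48 * (\<Lambda> * \<delta>\<^sup>2) * norm (x 1 - y 1)"
    using order_trans[OF near[OF t]] init by (simp add: \<theta>_def)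
qed


end

section \<open>Existence of connecting curves\<close>

context flat_spray begin

text \<open>The velocity of the curve is a fixed point of the operator that sends \<open>u\<close> to the velocity of the
curve from \<open>q\<close> to \<open>r\<close> with acceleration \<open>- \<Gamma> x u u\<close>, where \<open>x\<close> is the primitive of \<open>u\<close> that
starts at \<open>q\<close>. Projecting \<open>x\<close> and \<open>u\<close> to closed balls makes the right-hand side globally
Lipschitz with a small constant, so the operator is a contraction on the bounded continuous
functions on the real line; its values are constant outside the unit interval. The fixed point turns out to
satisfy the bounds, so the projections have no effect on it. It lies in the ball of radius
\<open>\<delta>\<close> because the squared distance from \<open>p\<close> is a convex function along it.\<close>

lemma spray_curve_exists:
  assumes q: "q \<in> ball p \<delta>" and r: "r \<in> ball p \<delta>"
  obtains x u where "spray_curve x u" "x 0 = q" "x 1 = r"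
proof -
  define \<theta> where "\<theta> = \<Lambda> * \<delta>\<^sup>2"
  have \<theta>: "0 \<le> \<theta>" "\<theta> \<le> 1/500" using \<Lambda>_nonneg small by (auto simp: \<theta>_def)
  define P where "P = closest_point (cball p (5 * \<delta>))"
  define Q where "Q = closest_point (cball (0::'a) (4 * \<delta>))"
  have P: "P x \<in> cball p (5 * \<delta>)" "norm (P x - P y) \<le> norm (x - y)" for x y
    using closest_point_in_set[of "cball p (5 * \<delta>)" x] closest_point_lipschitz[of "cball p (5 * \<delta>)" x y] \<delta>_pos
    by (auto simp: P_def dist_norm)
  have Q: "norm (Q x) \<le> 4 * \<delta>" "norm (Q x - Q y) \<le> norm (x - y)" for x y
    using closest_point_in_set[of "cball 0 (4 * \<delta>)" x] closest_point_lipschitz[of "cball 0 (4 * \<delta>)" x y] \<delta>_pos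
    by (auto simp: Q_def dist_norm)
  define F where "F = (\<lambda>x u. - \<Gamma> (P x) (Q u) (Q u))"
  have F_lip: "norm (F x u - F y v) \<le> 16 * \<theta> * norm (x - y) + 40 * \<theta> * norm (u - v)" for x y u v
  proof -
    have "norm (F x u - F y v) = norm (\<Gamma> (P x) (Q u) (Q u) - \<Gamma> (P y) (Q v) (Q v))"
      by (simp add: F_def norm_minus_commute)
    also have "\<dots> \<le> \<Lambda> * (4 * \<delta>)\<^sup>2 * norm (P x - P y) + 2 * \<Lambda> * (5 * \<delta>) * (4 * \<delta>) * norm (Q u - Q v)"
      by (intro \<Gamma>_diag_diff P Q)
    also have "\<dots> \<le> \<Lambda> * (4 * \<delta>)\<^sup>2 * norm (x - y) + 2 * \<Lambda> * (5 * \<delta>) * (4 * \<delta>) * norm (u - v)"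
      by (intro add_mono mult_left_mono P Q) (use \<Lambda>_nonneg \<delta>_pos in auto)
    finally show ?thesis by (simp add: \<theta>_def power2_eq_square algebra_simps)
  qed
  have F_bound: "norm (F x u) \<le> 80 * \<theta> * \<delta>" for x u
  proof -
    have "norm (F x u) \<le> \<Lambda> * (5 * \<delta>) * norm (Q u) * norm (Q u)"
      unfolding F_def norm_minus_cancel by (intro \<Gamma>_bound P)
    also have "\<dots> \<le> \<Lambda> * (5 * \<delta>) * (4 * \<delta>) * (4 * \<delta>)"
      by (intro mult_mono order_refl Q) (use \<Lambda>_nonneg \<delta>_pos in auto)
    finally show ?thesis by (simp add: \<theta>_def power2_eq_square algebra_simps)
  qed
  define X where "X = (\<lambda>(u :: real \<Rightarrow> 'a) t. q + integral {0..t} u)"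
  define f where "f = (\<lambda>u s. F (X u s) (u s))"
  define a where "a = (\<lambda>u. r - q - integral {0..1} (\<lambda>t. integral {0..t} (f u)))"
  define T where "T = (\<lambda>u t. a u + integral {0..max 0 (min 1 t)} (f u))"
  have int_cont: "continuous_on {0..1} (\<lambda>t. integral {0..t} h)" if "continuous_on {0..1} h"
    for h :: "real \<Rightarrow> 'a"
    using indefinite_integral_continuous_1[OF integrable_continuous_real[OF that]] .
  have int_bound: "norm (integral {0..t} h) \<le> B"
    if "continuous_on {0..1} h" "t \<in> {0..1}" "\<And>s. s \<in> {0..1} \<Longrightarrow> norm (h s) \<le> B" for h :: "real \<Rightarrow> 'a" and B t
  proof -
    have "0 \<le> B" using that(3)[of 0] norm_ge_zero[of "h 0"] by (simp del: norm_ge_zero)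
    have "norm (integral {0..t} h) \<le> B * (t - 0)"
      by (rule integral_bound) (use that in \<open>auto intro: continuous_on_subset\<close>)
    also have "\<dots> \<le> B * 1" using that \<open>0 \<le> B\<close> by (intro mult_left_mono) auto
    finally show ?thesis by simp
  qed
  have int_diff: "norm (integral {0..t} h - integral {0..t} k) \<le> B"
    if "continuous_on {0..1} h" "continuous_on {0..1} k" "t \<in> {0..1}"
      "\<And>s. s \<in> {0..1} \<Longrightarrow> norm (h s - k s) \<le> B" for h k :: "real \<Rightarrow> 'a" and B t
  proof -
    have "continuous_on {0..t} h" "continuous_on {0..t} k" using that by (auto intro: continuous_on_subset)
    then have "integral {0..t} h - integral {0..t} k = integral {0..t} (\<lambda>s. h s - k s)"
      by (simp add: integral_diff integrable_continuous_real)
    then show ?thesis using int_bound[of "\<lambda>s. h s - k s" t B] that by (auto intro: continuous_intros)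
  qed
  have F_cont: "continuous_on {0..1} (\<lambda>s. F (x s) (u s))"
    if "continuous_on {0..1} x" "continuous_on {0..1} u" for x u :: "real \<Rightarrow> 'a"
    unfolding continuous_on_def
  proof
    fix s :: real assume s: "s \<in> {0..1}"
    have "((\<lambda>t. 16 * \<theta> * norm (x t - x s) + 40 * \<theta> * norm (u t - u s))
        \<longlongrightarrow> 16 * \<theta> * norm (x s - x s) + 40 * \<theta> * norm (u s - u s)) (at s within {0..1})"
      using that s by (intro tendsto_intros) (auto simp: continuous_on_def)
    then have lim: "((\<lambda>t. 16 * \<theta> * norm (x t - x s) + 40 * \<theta> * norm (u t - u s)) \<longlongrightarrow> 0) (at s within {0..1})"
      by simp
    have "((\<lambda>t. F (x t) (u t) - F (x s) (u s)) \<longlongrightarrow> 0) (at s within {0..1})"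
      by (rule Lim_null_comparison[OF _ lim]) (intro always_eventually allI F_lip)
    then show "((\<lambda>t. F (x t) (u t)) \<longlongrightarrow> F (x s) (u s)) (at s within {0..1})"
      by (simp add: LIM_zero_iff)
  qed
  have X_cont: "continuous_on {0..1} (X u)" if "continuous_on {0..1} u" for u
    unfolding X_def by (intro continuous_intros int_cont that)
  have f_cont: "continuous_on {0..1} (f u)" if "continuous_on {0..1} u" for u
    unfolding f_def by (intro F_cont X_cont that)
  have T_bcont: "T u \<in> bcontfun" if u: "continuous_on {0..1} u" for u
  proof -
    have "continuous_on UNIV (\<lambda>t. integral {0..max 0 (min 1 t)} (f u))"
      by (rule continuous_on_compose2[OF int_cont[OF f_cont[OF u]]]) (auto intro!: continuous_intros)
    then have "continuous_on UNIV (T u)" unfolding T_def by (intro continuous_intros)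
    moreover have "norm (T u t) \<le> norm (a u) + 80 * \<theta> * \<delta>" for t
      unfolding T_def
      by (intro norm_triangle_le add_mono int_bound[OF f_cont[OF u]] order_refl) (auto simp: f_def F_bound)
    then have "bounded (range (T u))" by (intro boundedI) auto
    ultimately show ?thesis by (simp add: bcontfun_def)
  qed
  define TC :: "(real \<Rightarrow>\<^sub>C 'a) \<Rightarrow> (real \<Rightarrow>\<^sub>C 'a)" where "TC = (\<lambda>u. Bcontfun (T (apply_bcontfun u)))"
  have TC: "apply_bcontfun (TC u) = T (apply_bcontfun u)" for u
    unfolding TC_def by (intro Bcontfun_inverse T_bcont) auto
  have "dist (TC u) (TC v) \<le> (1/2) * dist u v" for u v
  proof (rule dist_bound)
    fix t
    define d where "d = dist u v"
    have d: "0 \<le> d" "norm (u s - v s) \<le> d" for s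
      using dist_bounded[of u s v] by (auto simp: d_def dist_norm)
    have cu: "continuous_on {0..1} (apply_bcontfun u)" "continuous_on {0..1} (apply_bcontfun v)" by auto
    have Xd: "norm (X u s - X v s) \<le> d" if "s \<in> {0..1}" for s
      unfolding X_def using int_diff[OF cu that, of d] d by simp
    have fd: "norm (f u s - f v s) \<le> 56 * \<theta> * d" if "s \<in> {0..1}" for s
    proof -
      have "norm (f u s - f v s) \<le> 16 * \<theta> * norm (X u s - X v s) + 40 * \<theta> * norm (u s - v s)"
        unfolding f_def by (rule F_lip)
      also have "\<dots> \<le> 16 * \<theta> * d + 40 * \<theta> * d"
        by (intro add_mono mult_left_mono Xd that d) (use \<theta> in auto)
      finally show ?thesis by (simp add: algebra_simps)
    qed
    have I: "norm (integral {0..s} (f u) - integral {0..s} (f v)) \<le> 56 * \<theta> * d" if "s \<in> {0..1}" for s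
      by (rule int_diff[OF f_cont[OF cu(1)] f_cont[OF cu(2)] that fd])
    have II: "norm (integral {0..1} (\<lambda>t. integral {0..t} (f u)) - integral {0..1} (\<lambda>t. integral {0..t} (f v)))
        \<le> 56 * \<theta> * d"
      by (rule int_diff[OF int_cont[OF f_cont[OF cu(1)]] int_cont[OF f_cont[OF cu(2)]] _ I]) auto
    have "T u t - T v t = (integral {0..max 0 (min 1 t)} (f u) - integral {0..max 0 (min 1 t)} (f v))
        - (integral {0..1} (\<lambda>t. integral {0..t} (f u)) - integral {0..1} (\<lambda>t. integral {0..t} (f v)))"
      by (simp add: T_def a_def)
    also have "norm \<dots> \<le> 56 * \<theta> * d + 56 * \<theta> * d"
      by (rule norm_triangle_le_diff[OF add_mono[OF I II]]) auto
    also have "\<dots> \<le> (1/2) * d" using mult_right_mono[OF \<theta>(2) d(1)] mult_nonneg_nonneg[OF \<theta>(1) d(1)] by simp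
    finally show "dist (TC u t) (TC v t) \<le> (1/2) * dist u v" by (simp add: TC dist_norm d_def)
  qed
  then obtain w where w: "TC w = w"
    using banach_fix_type[of "1/2" TC] by auto
  define u where "u = apply_bcontfun w"
  have Tu: "T u = u" using TC[of w] by (simp add: u_def w)
  have cu: "continuous_on {0..1} u" by (simp add: u_def)
  have u_eq: "u t = a u + integral {0..t} (f u)" if "t \<in> {0..1}" for t
    using fun_cong[OF Tu, of t] that by (simp add: T_def)
  have X': "(X u has_vector_derivative u t) (at t within {0..1})" if "t \<in> {0..1}" for t
    unfolding X_def using integral_has_vector_derivative[OF cu that] by (auto intro!: derivative_eq_intros)
  have u': "(u has_vector_derivative f u t) (at t within {0..1})" if "t \<in> {0..1}" for t
  proof -
    have "((\<lambda>t. a u + integral {0..t} (f u)) has_vector_derivative f u t) (at t within {0..1})"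
      using integral_has_vector_derivative[OF f_cont[OF cu] that] by (auto intro!: derivative_eq_intros)
    from has_vector_derivative_transform[OF that u_eq this] show ?thesis .
  qed
  have X0: "X u 0 = q" by (simp add: X_def)
  have X1: "X u 1 = r"
  proof -
    have "integral {0..1} u = integral {0..1} (\<lambda>t. a u + integral {0..t} (f u))"
      by (rule integral_cong) (use u_eq in auto)
    also have "\<dots> = a u + integral {0..1} (\<lambda>t. integral {0..t} (f u))"
      by (subst integral_add) (auto intro!: integrable_continuous_real int_cont f_cont cu)
    finally show ?thesis by (simp add: X_def a_def)
  qed
  \<comment> \<open>From here on: the fixed point satisfies the bounds that the projections enforce.\<close>
  have u_bound: "norm (u t) \<le> 4 * \<delta>" if t: "t \<in> {0..1}" for t
  proof -
    have fb: "norm (f u s) \<le> 80 * \<theta> * \<delta>" for s by (simp add: f_def F_bound)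
    have I: "norm (integral {0..s} (f u)) \<le> 80 * \<theta> * \<delta>" if "s \<in> {0..1}" for s
      by (rule int_bound[OF f_cont[OF cu] that fb])
    have II: "norm (integral {0..1} (\<lambda>s. integral {0..s} (f u))) \<le> 80 * \<theta> * \<delta>"
      by (rule int_bound[OF int_cont[OF f_cont[OF cu]] _ I]) auto
    have "norm (u t) \<le> 2 * \<delta> + 80 * \<theta> * \<delta> + 80 * \<theta> * \<delta>"
      unfolding u_eq[OF t] a_def
      by (intro norm_triangle_le add_mono I t norm_triangle_le_diff II endpoints_close q r)
    also have "\<dots> \<le> 4 * \<delta>" using mult_right_mono[OF \<theta>(2), of \<delta>] \<delta>_pos by simp
    finally show ?thesis .
  qed
  have X5: "X u t \<in> cball p (5 * \<delta>)" if t: "t \<in> {0..1}" for t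
  proof -
    have "norm (X u t - q) \<le> 4 * \<delta>"
      unfolding X_def using int_bound[OF cu t u_bound] by simp
    then show ?thesis using q dist_triangle[of p "X u t" q] by (simp add: dist_norm norm_minus_commute)
  qed
  have fu: "f u t = - \<Gamma> (X u t) (u t) (u t)" if t: "t \<in> {0..1}" for t
    using X5[OF t] u_bound[OF t] by (simp add: f_def F_def P_def Q_def closest_point_self)
  \<comment> \<open>The term \<open>u \<bullet> u\<close> dominates in the second derivative of the squared distance from \<open>p\<close>.\<close>
  have inball: "X u t \<in> ball p \<delta>" if t: "t \<in> {0..1}" for t
  proof -
    let ?g = "\<lambda>t. (X u t - p) \<bullet> (X u t - p)"
    have "?g t \<le> max (?g 0) (?g 1)"
    proof (rule second_derivative_nonneg_imp_le_max[OF _ _ _ t,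
          where f'="\<lambda>t. 2 * (u t \<bullet> (X u t - p))" and f''="\<lambda>t. 2 * (f u t \<bullet> (X u t - p) + u t \<bullet> u t)"])
      fix s :: real assume s: "s \<in> {0..1}"
      have Xp: "((\<lambda>t. X u t - p) has_vector_derivative u s) (at s within {0..1})"
        by (rule has_vector_derivative_diff[OF X'[OF s] has_vector_derivative_const, unfolded diff_0_right])
      note inner_deriv = bounded_bilinear.has_vector_derivative[OF bounded_bilinear_inner]
      show "(?g has_vector_derivative 2 * (u s \<bullet> (X u s - p))) (at s within {0..1})"
        using inner_deriv[OF Xp Xp] by (simp add: inner_commute)
      from bounded_linear.has_vector_derivative[OF bounded_linear_mult_right inner_deriv[OF u'[OF s] Xp], of 2]
      show "((\<lambda>t. 2 * (u t \<bullet> (X u t - p))) has_vector_derivative 2 * (f u s \<bullet> (X u s - p) + u s \<bullet> u s)) (at s within {0..1})"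
        by (simp only: add.commute)
      have "\<bar>f u s \<bullet> (X u s - p)\<bar> \<le> norm (f u s) * norm (X u s - p)" by (rule Cauchy_Schwarz_ineq2)
      also have "\<dots> \<le> (\<Lambda> * (5 * \<delta>) * norm (u s) * norm (u s)) * (5 * \<delta>)"
        using X5[OF s] \<Lambda>_nonneg \<delta>_pos unfolding fu[OF s] norm_minus_cancel
        by (intro mult_mono \<Gamma>_bound) (auto simp: dist_norm norm_minus_commute)
      also have "\<dots> = 25 * \<theta> * (u s \<bullet> u s)" by (simp add: \<theta>_def power2_eq_square dot_square_norm)
      also have "\<dots> \<le> 1 * (u s \<bullet> u s)" using \<theta> by (intro mult_right_mono) auto
      finally have "0 \<le> f u s \<bullet> (X u s - p) + u s \<bullet> u s" by (simp add: abs_le_iff)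
      then show "0 \<le> 2 * (f u s \<bullet> (X u s - p) + u s \<bullet> u s)" by simp
    qed
    then have "(norm (X u t - p))\<^sup>2 \<le> (norm (q - p))\<^sup>2 \<or> (norm (X u t - p))\<^sup>2 \<le> (norm (r - p))\<^sup>2"
      unfolding X0 X1 dot_square_norm le_max_iff_disj .
    then have "norm (X u t - p) \<le> norm (q - p) \<or> norm (X u t - p) \<le> norm (r - p)"
      using power2_le_imp_le norm_ge_zero by blast
    then show ?thesis using q r by (auto simp: dist_norm norm_minus_commute)
  qed
  show ?thesis
  proof (rule that[of "X u" u])
    show "spray_curve (X u) u" unfolding spray_curve_def using inball X' u' fu by auto
  qed (rule X0 X1)+
qed

end

section \<open>The energy of connecting curves\<close>

lemma norm_matrix_vector_mult_le:
  fixes A :: "real ^ 'n ^ 'm" and x :: "real ^ 'n"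
  shows "norm (A *v x) \<le> norm A * norm x"
proof -
  have "norm (A *v x) = L2_set (\<lambda>i. norm (A $ i \<bullet> x)) UNIV"
    by (simp add: norm_vec_def matrix_vector_mul_component)
  also have "\<dots> \<le> L2_set (\<lambda>i. norm (A $ i) * norm x) UNIV"
    by (intro L2_set_mono) (auto simp: Cauchy_Schwarz_ineq2)
  also have "\<dots> = norm A * norm x"
    by (simp add: L2_set_left_distrib norm_vec_def)
  finally show ?thesis .
qed

lemma bounded_bilinear_matrix_vector_mult:
  "bounded_bilinear ((*v) :: real ^ 'n ^ 'm \<Rightarrow> real ^ 'n \<Rightarrow> real ^ 'm)"
proof
  show "\<exists>K. \<forall>(a::real^'n^'m) b. norm (a *v b) \<le> norm a * norm b * K"
    by (rule exI[of _ 1]) (simp add: norm_matrix_vector_mult_le)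
qed (simp_all add: matrix_vector_mult_add_rdistrib matrix_vector_right_distrib scaleR_matrix_vector_assoc
      matrix_vector_mult_scaleR)

lemma matrix_vector_mult_minus_right: "(A :: real ^ 'n ^ 'm) *v (- x) = - (A *v x)"
  by (rule bounded_bilinear.minus_right[OF bounded_bilinear_matrix_vector_mult])

lemma norm_bilinear_form_le:
  fixes A :: "real ^ 'n ^ 'n"
  assumes "norm a \<le> \<alpha>" "norm A \<le> M" "norm b \<le> \<beta>"
  shows "\<bar>a \<bullet> (A *v b)\<bar> \<le> \<alpha> * (M * \<beta>)"
proof -
  have "0 \<le> \<alpha>" "0 \<le> M" using assms norm_ge_zero order_trans by blast+
  have "\<bar>a \<bullet> (A *v b)\<bar> \<le> norm a * norm (A *v b)" by (rule Cauchy_Schwarz_ineq2)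
  also have "\<dots> \<le> norm a * (norm A * norm b)"
    by (intro mult_left_mono norm_matrix_vector_mult_le) auto
  also have "\<dots> \<le> \<alpha> * (M * \<beta>)"
    by (intro mult_mono assms) (use \<open>0 \<le> \<alpha>\<close> \<open>0 \<le> M\<close> in auto)
  finally show ?thesis .
qed

lemma bilinear_form_symmetric:
  fixes A :: "real ^ 'n ^ 'n"
  assumes "transpose A = A"
  shows "a \<bullet> (A *v b) = b \<bullet> (A *v a)"
proof -
  have "a \<bullet> (A *v b) = (a v* transpose A) \<bullet> b" by (simp only: assms dot_lmul_matrix)
  also have "\<dots> = b \<bullet> (A *v a)" by (simp only: vector_transpose_matrix inner_commute)
  finally show ?thesis .
qed

lemma has_vector_derivative_bilinear_form:
  fixes M :: "real \<Rightarrow> real ^ 'n ^ 'n"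
  assumes "(a has_vector_derivative a') (at t within S)" "(M has_vector_derivative M') (at t within S)"
    "(b has_vector_derivative b') (at t within S)"
  shows "((\<lambda>t. a t \<bullet> (M t *v b t)) has_vector_derivative
    a' \<bullet> (M t *v b t) + a t \<bullet> (M' *v b t) + a t \<bullet> (M t *v b')) (at t within S)"
  using bounded_bilinear.has_vector_derivative[OF bounded_bilinear_inner assms(1)
      bounded_bilinear.has_vector_derivative[OF bounded_bilinear_matrix_vector_mult assms(2,3)]]
  by (simp add: inner_add_right add_ac)

lemma lipschitz_derivative_remainder:
  fixes f :: "'a::real_normed_vector \<Rightarrow> 'b::real_normed_vector"
  assumes S: "convex S" "x \<in> S" "y \<in> S"
    and f: "\<And>z. z \<in> S \<Longrightarrow> (f has_derivative f' z) (at z)"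
    and lip: "\<And>z h. z \<in> S \<Longrightarrow> norm (f' z h - f' x h) \<le> L * norm (z - x) * norm h"
    and L: "0 \<le> L"
  shows "norm (f y - f x - f' x (y - x)) \<le> L * (norm (y - x))\<^sup>2"
proof -
  define h where "h = y - x"
  define c where "c = (\<lambda>t::real. x + t *\<^sub>R h)"
  have c: "c t \<in> S" if "t \<in> {0..1}" for t
  proof -
    have "c t = (1 - t) *\<^sub>R x + t *\<^sub>R y" by (simp add: c_def h_def algebra_simps)
    then show ?thesis using convexD_alt[OF S, of t] that by simp
  qed
  have c': "(c has_vector_derivative h) (at t within {0..1})" for t
    unfolding c_def by (auto intro!: derivative_eq_intros)
  have "norm ((f (c 1) - 1 *\<^sub>R f' x h) - (f (c 0) - 0 *\<^sub>R f' x h)) \<le> (L * norm h * norm h) * \<bar>1 - 0\<bar>"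
  proof (rule vector_derivative_bound[where a=0 and b=1 and f'="\<lambda>t. f' (c t) h - f' x h"])
    fix t :: real assume t: "t \<in> {0..1}"
    have "((f \<circ> c) has_vector_derivative f' (c t) h) (at t within {0..1})"
      by (rule vector_derivative_diff_chain_within[OF c' has_derivative_at_withinI[OF f[OF c[OF t]]]])
    then show "((\<lambda>t. f (c t) - t *\<^sub>R f' x h) has_vector_derivative f' (c t) h - f' x h) (at t within {0..1})"
      unfolding o_def by (intro has_vector_derivative_diff) (auto intro!: derivative_eq_intros)
    have "norm (f' (c t) h - f' x h) \<le> L * norm (c t - x) * norm h" by (rule lip[OF c[OF t]])
    also have "\<dots> \<le> L * norm h * norm h"
      using t L by (intro mult_right_mono mult_left_mono) (auto simp: c_def mult_left_le_one_le)
    finally show "norm (f' (c t) h - f' x h) \<le> L * norm h * norm h" .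
  qed auto
  then show ?thesis by (simp add: c_def h_def power2_eq_square algebra_simps)
qed

context flat_spray
begin

definition connecting :: "'a \<Rightarrow> 'a \<Rightarrow> (real \<Rightarrow> 'a) \<times> (real \<Rightarrow> 'a)" where
  "connecting q r = (SOME (x, u). spray_curve x u \<and> x 0 = q \<and> x 1 = r)"

definition cpos :: "'a \<Rightarrow> 'a \<Rightarrow> real \<Rightarrow> 'a" where "cpos q r = fst (connecting q r)"
definition cvel :: "'a \<Rightarrow> 'a \<Rightarrow> real \<Rightarrow> 'a" where "cvel q r = snd (connecting q r)"

lemma connecting:
  assumes "q \<in> ball p \<delta>" "r \<in> ball p \<delta>"
  shows "spray_curve (cpos q r) (cvel q r)" "cpos q r 0 = q" "cpos q r 1 = r"
proof -
  have "\<exists>xu. case xu of (x, u) \<Rightarrow> spray_curve x u \<and> x 0 = q \<and> x 1 = r"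
    by (rule spray_curve_exists[OF assms]) auto
  from someI_ex[OF this] show "spray_curve (cpos q r) (cvel q r)" "cpos q r 0 = q" "cpos q r 1 = r"
    by (auto simp: cpos_def cvel_def connecting_def split: prod.splits)
qed

lemma connecting_unique:
  assumes "spray_curve x u" "x 0 = q" "x 1 = r" "t \<in> {0..1}"
  shows "cpos q r t = x t" "cvel q r t = u t"
proof -
  have qr: "q \<in> ball p \<delta>" "r \<in> ball p \<delta>"
    using spray_curveD(1)[OF assms(1), of 0] spray_curveD(1)[OF assms(1), of 1] assms by auto
  note c = spray_curves_compare[OF connecting(1)[OF qr] assms(1) _ assms(4)]
  show "cpos q r t = x t" "cvel q r t = u t"
    using c(1,2) connecting[OF qr] assms by simp_all
qed

end

text \<open>The metric in coordinates. The assumption \<open>euler_lagrange\<close> is the only link between \<open>\<Gamma>\<close> and the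
metric: it says that \<open>x'' = - \<Gamma> x x' x'\<close> is the Euler-Lagrange equation of \<open>x' \<bullet> (G x *v x')\<close>.\<close>

locale metric_spray = flat_spray \<Gamma> p \<delta> \<Lambda>
  for \<Gamma> :: "real ^ 'n \<Rightarrow> real ^ 'n \<Rightarrow> real ^ 'n \<Rightarrow> real ^ 'n" and p \<delta> \<Lambda> +
  fixes G :: "real ^ 'n \<Rightarrow> real ^ 'n ^ 'n" and DG :: "real ^ 'n \<Rightarrow> real ^ 'n \<Rightarrow> real ^ 'n ^ 'n" and B :: real
  assumes G_deriv: "x \<in> ball p \<delta> \<Longrightarrow> (G has_derivative DG x) (at x)"
    and G_symmetric: "x \<in> ball p \<delta> \<Longrightarrow> transpose (G x) = G x"
    and G_bound: "x \<in> ball p \<delta> \<Longrightarrow> norm (G x) \<le> B"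
    and DG_lipschitz: "x \<in> ball p \<delta> \<Longrightarrow> y \<in> ball p \<delta> \<Longrightarrow>
      norm (DG x h - DG y h) \<le> \<Lambda> * norm (x - y) * norm h"
    and DG_center: "DG p h = 0"
    and euler_lagrange: "x \<in> ball p \<delta> \<Longrightarrow>
      a \<bullet> (G x *v \<Gamma> x u u) = a \<bullet> (DG x u *v u) - (1 / 2) * (u \<bullet> (DG x a *v u))"
begin

lemma B_nonneg: "0 \<le> B"
  using G_bound[of p] \<delta>_pos norm_ge_zero[of "G p"] by (simp del: norm_ge_zero)

lemma DG_bound: "x \<in> ball p \<delta> \<Longrightarrow> norm h \<le> \<eta> \<Longrightarrow> norm (DG x h) \<le> \<Lambda> * \<delta> * \<eta>"
proof -
  assume x: "x \<in> ball p \<delta>" and h: "norm h \<le> \<eta>"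
  have "norm (DG x h) \<le> \<Lambda> * norm (x - p) * norm h"
    using DG_lipschitz[OF x, of p h] DG_center \<delta>_pos by simp
  also have "\<dots> \<le> \<Lambda> * \<delta> * \<eta>"
    using x h \<Lambda>_nonneg \<delta>_pos by (intro mult_mono) (auto simp: dist_norm norm_minus_commute)
  finally show ?thesis .
qed

lemma metric_along_curve:
  assumes "spray_curve x u" "t \<in> {0..1}"
  shows "((\<lambda>t. G (x t)) has_vector_derivative DG (x t) (u t)) (at t within {0..1})"
  using vector_derivative_diff_chain_within[OF spray_curveD(2)[OF assms]
      has_derivative_at_withinI[OF G_deriv[OF spray_curveD(1)[OF assms]]]]
  by (simp add: o_def)

text \<open>The Euler-Lagrange equation tested with a vector field \<open>w\<close> along the curve. The derivative is half
of the first variation of \<open>x' \<bullet> (G x *v x')\<close> in the direction \<open>w\<close>.\<close>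

lemma momentum_derivative:
  assumes "spray_curve x u" "t \<in> {0..1}" "(w has_vector_derivative w') (at t within {0..1})"
  shows "((\<lambda>t. w t \<bullet> (G (x t) *v u t)) has_vector_derivative
    w' \<bullet> (G (x t) *v u t) + (1 / 2) * (u t \<bullet> (DG (x t) (w t) *v u t))) (at t within {0..1})"
proof -
  have "w' \<bullet> (G (x t) *v u t) + w t \<bullet> (DG (x t) (u t) *v u t) + w t \<bullet> (G (x t) *v - \<Gamma> (x t) (u t) (u t))
      = w' \<bullet> (G (x t) *v u t) + (1 / 2) * (u t \<bullet> (DG (x t) (w t) *v u t))"
    using euler_lagrange[OF spray_curveD(1)[OF assms(1,2)], of "w t" "u t"]
    by (simp add: matrix_vector_mult_minus_right)
  with has_vector_derivative_bilinear_form[OF assms(3) metric_along_curve[OF assms(1,2)] spray_curveD(3)[OF assms(1,2)]]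
  show ?thesis by simp
qed

definition energy :: "real ^ 'n \<Rightarrow> real ^ 'n \<Rightarrow> real" where
  "energy q r = cvel q r 0 \<bullet> (G q *v cvel q r 0)"

lemma energy_constant:
  assumes xu: "spray_curve x u" and t: "t \<in> {0..1}"
  shows "u t \<bullet> (G (x t) *v u t) = energy (x 0) (x 1)"
proof -
  have "norm (u t \<bullet> (G (x t) *v u t) - u 0 \<bullet> (G (x 0) *v u 0)) \<le> 0 * \<bar>t - 0\<bar>"
  proof (rule vector_derivative_bound[where a=0 and b=1 and f'="\<lambda>_. 0"])
    fix s :: real assume s: "s \<in> {0..1}"
    have "- \<Gamma> (x s) (u s) (u s) \<bullet> (G (x s) *v u s) = - (u s \<bullet> (G (x s) *v \<Gamma> (x s) (u s) (u s)))"
      using bilinear_form_symmetric[OF G_symmetric[OF spray_curveD(1)[OF xu s]]]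
      by (simp add: matrix_vector_mult_minus_right)
    then have "- \<Gamma> (x s) (u s) (u s) \<bullet> (G (x s) *v u s) + (1 / 2) * (u s \<bullet> (DG (x s) (u s) *v u s)) = 0"
      using euler_lagrange[OF spray_curveD(1)[OF xu s], of "u s" "u s"] by simp
    with momentum_derivative[OF xu s spray_curveD(3)[OF xu s]]
    show "((\<lambda>t. u t \<bullet> (G (x t) *v u t)) has_vector_derivative 0) (at s within {0..1})" by simp
  qed (use t in auto)
  then show ?thesis using connecting_unique(2)[OF xu refl refl, of 0] by (simp add: energy_def)
qed

text \<open>The geodesics from \<open>q\<close> to \<open>r\<close> and to \<open>r'\<close> differ by \<open>O(norm (r' - r))\<close> together with their
velocities, so their Lagrangians differ by the first variation up to a quadratic error. The
first variation is the derivative of \<open>2 * (w \<bullet> (G x *v u))\<close>, which vanishes at time \<open>0\<close> and is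
the asserted linear term at time \<open>1\<close>. Both Lagrangians are constant in time, so \<open>t * (energy q r' - energy q r)\<close> is
a primitive of their difference.\<close>

lemma energy_first_variation:
  assumes q: "q \<in> ball p \<delta>" and r: "r \<in> ball p \<delta>" and r': "r' \<in> ball p \<delta>"
  shows "\<bar>energy q r' - energy q r - 2 * ((r' - r) \<bullet> (G r *v cvel q r 1))\<bar>
    \<le> (4 * (24 * (\<Lambda> * \<delta>\<^sup>2) + B)) * (norm (r' - r))\<^sup>2"
proof -
  define x u y v where "x = cpos q r" and "u = cvel q r" and "y = cpos q r'" and "v = cvel q r'"
  have xu: "spray_curve x u" and x01: "x 0 = q" "x 1 = r" using connecting[OF q r] by (auto simp: x_def u_def)
  have yv: "spray_curve y v" and y01: "y 0 = q" "y 1 = r'" using connecting[OF q r'] by (auto simp: y_def v_def)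
  define w where "w = (\<lambda>t. y t - x t)"
  define w' where "w' = (\<lambda>t. v t - u t)"
  define d where "d = norm (r' - r)"
  have w_bound: "norm (w t) \<le> 2 * d" "norm (w' t) \<le> 2 * d" if "t \<in> {0..1}" for t
    using spray_curves_compare(1,2)[OF yv xu _ that] x01 y01 by (auto simp: w_def w'_def d_def)
  have wd: "(w has_vector_derivative w' t) (at t within {0..1})" if "t \<in> {0..1}" for t
    unfolding w_def w'_def by (intro has_vector_derivative_diff spray_curveD[OF xu that] spray_curveD[OF yv that])
  define K where "K = 4 * (24 * (\<Lambda> * \<delta>\<^sup>2) + B)"
  define \<Delta> where "\<Delta> = energy q r' - energy q r"
  \<comment> \<open>The derivative of \<open>?h\<close> is the remainder of the Lagrangian beyond first order.\<close>
  let ?h = "\<lambda>t. t *\<^sub>R \<Delta> - 2 *\<^sub>R (w t \<bullet> (G (x t) *v u t))"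
  let ?h' = "\<lambda>t. \<Delta> - 2 *\<^sub>R (w' t \<bullet> (G (x t) *v u t) + (1/2) * (u t \<bullet> (DG (x t) (w t) *v u t)))"
  have "norm (?h 1 - ?h 0) \<le> (K * d\<^sup>2) * \<bar>1 - 0\<bar>"
  proof (rule vector_derivative_bound[where a=0 and b=1 and f'="?h'"])
    fix t :: real assume t: "t \<in> {0..1}"
    have id: "((\<lambda>t. t *\<^sub>R \<Delta>) has_vector_derivative \<Delta>) (at t within {0..1})"
      by (auto intro!: derivative_eq_intros)
    show "(?h has_vector_derivative ?h' t) (at t within {0..1})"
      by (intro has_vector_derivative_diff id
          bounded_linear.has_vector_derivative[OF bounded_linear_scaleR_right] momentum_derivative[OF xu t wd[OF t]])
    have xb: "x t \<in> ball p \<delta>" and yb: "y t \<in> ball p \<delta>"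
      using spray_curveD(1)[OF xu t] spray_curveD(1)[OF yv t] by auto
    have uv: "norm (u t) \<le> 4 * \<delta>" "norm (v t) \<le> 4 * \<delta>"
      using speed_bound_radius[OF xu t] speed_bound_radius[OF yv t] by auto
    define R where "R = G (y t) - G (x t) - DG (x t) (w t)"
    have R: "norm R \<le> \<Lambda> * (2 * d)\<^sup>2"
    proof -
      have "norm R \<le> \<Lambda> * (norm (w t))\<^sup>2"
        unfolding R_def w_def
        by (rule lipschitz_derivative_remainder[where S="ball p \<delta>"])
          (use xb yb G_deriv DG_lipschitz \<Lambda>_nonneg in auto)
      also have "\<dots> \<le> \<Lambda> * (2 * d)\<^sup>2"
        using w_bound[OF t] \<Lambda>_nonneg by (intro mult_left_mono power_mono) auto
      finally show ?thesis .
    qed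
    have D: "norm (DG (x t) (w t)) \<le> \<Lambda> * \<delta> * (2 * d)" by (rule DG_bound[OF xb w_bound(1)[OF t]])
    have "\<Delta> = v t \<bullet> (G (y t) *v v t) - u t \<bullet> (G (x t) *v u t)"
      using energy_constant[OF xu t] energy_constant[OF yv t] x01 y01 by (simp add: \<Delta>_def)
    moreover have "G (y t) = R + G (x t) + DG (x t) (w t)" by (simp add: R_def)
    moreover have "v t = u t + w' t" by (simp add: w'_def)
    ultimately have "?h' t = v t \<bullet> (R *v v t) + w' t \<bullet> (DG (x t) (w t) *v v t)
        + u t \<bullet> (DG (x t) (w t) *v w' t) + w' t \<bullet> (G (x t) *v w' t)"
      using bilinear_form_symmetric[OF G_symmetric[OF xb], of "w' t" "u t"]
      by (simp add: matrix_vector_mult_add_rdistrib matrix_vector_right_distrib inner_add_left inner_add_right)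
    also have "\<bar>\<dots>\<bar> \<le> (4 * \<delta>) * (\<Lambda> * (2 * d)\<^sup>2 * (4 * \<delta>)) + (2 * d) * (\<Lambda> * \<delta> * (2 * d) * (4 * \<delta>))
        + (4 * \<delta>) * (\<Lambda> * \<delta> * (2 * d) * (2 * d)) + (2 * d) * (B * (2 * d))"
      by (intro order_trans[OF abs_triangle_ineq] add_mono norm_bilinear_form_le uv R D w_bound t G_bound xb)
    also have "\<dots> = K * d\<^sup>2" by (simp add: K_def power2_eq_square algebra_simps)
    finally show "norm (?h' t) \<le> K * d\<^sup>2" by simp
  qed auto
  moreover have "?h 1 - ?h 0 = \<Delta> - 2 * ((r' - r) \<bullet> (G r *v cvel q r 1))"
    using x01 y01 by (simp add: w_def u_def)
  ultimately show ?thesis by (simp add: K_def d_def \<Delta>_def)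
qed

lemma energy_derivative:
  assumes q: "q \<in> ball p \<delta>" and r: "r \<in> ball p \<delta>"
  shows "(energy q has_derivative (\<lambda>h. 2 * (h \<bullet> (G r *v cvel q r 1)))) (at r)"
  unfolding has_derivative_at_alt
proof (intro conjI allI impI)
  show "bounded_linear (\<lambda>h. 2 * (h \<bullet> (G r *v cvel q r 1)))"
    by (intro bounded_linear_mult_right[THEN bounded_linear_compose] bounded_linear_inner_left)
  fix e :: real assume e: "0 < e"
  define K where "K = 4 * (24 * (\<Lambda> * \<delta>\<^sup>2) + B)"
  have K: "0 \<le> K" using B_nonneg \<Lambda>_nonneg by (simp add: K_def)
  obtain d where d: "d > 0" "ball r d \<subseteq> ball p \<delta>" using r openE[OF open_ball] by blast
  show "\<exists>d>0. \<forall>y. norm (y - r) < d \<longrightarrow>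
      norm (energy q y - energy q r - 2 * ((y - r) \<bullet> (G r *v cvel q r 1))) \<le> e * norm (y - r)"
  proof (intro exI[of _ "min d (e / (K + 1))"] conjI allI impI)
    show "0 < min d (e / (K + 1))" using d e K by simp
    fix y assume y: "norm (y - r) < min d (e / (K + 1))"
    then have yb: "y \<in> ball p \<delta>" using d(2) by (auto simp: dist_norm norm_minus_commute)
    have "(K + 1) * norm (y - r) \<le> e" using y K by (simp add: pos_less_divide_eq mult.commute)
    then have Ky: "K * norm (y - r) \<le> e" using norm_ge_zero[of "y - r"] unfolding distrib_right by linarith
    have "norm (energy q y - energy q r - 2 * ((y - r) \<bullet> (G r *v cvel q r 1))) \<le> K * (norm (y - r))\<^sup>2"
      using energy_first_variation[OF q r yb] by (simp add: K_def)
    also have "\<dots> = (K * norm (y - r)) * norm (y - r)" by (simp add: power2_eq_square)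
    also have "\<dots> \<le> e * norm (y - r)" using Ky by (intro mult_right_mono) auto
    finally show "norm (energy q y - energy q r - 2 * ((y - r) \<bullet> (G r *v cvel q r 1))) \<le> e * norm (y - r)" .
  qed
qed

lemma energy_along_curve:
  assumes q: "q \<in> ball p \<delta>" and xu: "spray_curve x u" and t: "t \<in> {0..1}"
  shows "((\<lambda>t. energy q (x t)) has_real_derivative 2 * (u t \<bullet> (G (x t) *v cvel q (x t) 1))) (at t within {0..1})"
  using vector_derivative_diff_chain_within[OF spray_curveD(2)[OF xu t]
      has_derivative_at_withinI[OF energy_derivative[OF q spray_curveD(1)[OF xu t]]]]
  by (simp add: o_def has_real_derivative_iff_has_vector_derivative)

text \<open>Write \<open>P 0\<close> and \<open>P 1\<close> for the velocities with which the geodesics from \<open>q\<close> arrive at \<open>x 0\<close> and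
\<open>x 1\<close>. As \<open>energy (x 0) (x 1)\<close> is \<open>u 1 \<bullet> (G (x 1) *v u 1)\<close>, the left-hand side is twice the
absolute value of
\<open>(P 1 - P 0 - u 1) \<bullet> (G (x 1) *v u 1) + (P 0 \<bullet> (G (x 1) *v u 1) - P 0 \<bullet> (G (x 0) *v u 0))\<close>.
In the first summand, \<open>P 1 - P 0\<close> and \<open>u 1\<close> are both close to \<open>x 1 - x 0\<close>; the second one is the
increment of a function whose derivative is quadratic in the velocity, with the factor
\<open>\<Lambda> * \<delta> * norm (P 0)\<close>.\<close>

lemma energy_estimate:
  assumes q: "q \<in> ball p \<delta>" and xu: "spray_curve x u"
  shows "\<bar>2 * (u 1 \<bullet> (G (x 1) *v cvel q (x 1) 1)) - 2 * (u 0 \<bullet> (G (x 0) *v cvel q (x 0) 1)) - 2 * energy (x 0) (x 1)\<bar>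
    \<le> (256 * B + 32) * (\<Lambda> * \<delta>\<^sup>2) * (norm (x 1 - x 0))\<^sup>2"
proof -
  define \<theta> where "\<theta> = \<Lambda> * \<delta>\<^sup>2"
  define e where "e = norm (x 1 - x 0)"
  have xb: "x t \<in> ball p \<delta>" if "t \<in> {0..1}" for t using spray_curveD(1)[OF xu that] .
  note c0 = connecting[OF q xb[of 0]] and c1 = connecting[OF q xb[of 1]]
  define P where "P = (\<lambda>t. cvel q (x t) 1)"
  have "norm (P 1 - P 0 - (x 1 - x 0)) \<le> 48 * \<theta> * e"
    using spray_curves_compare(3)[OF c1(1) c0(1), of 1] c0 c1 by (simp add: P_def \<theta>_def e_def)
  moreover have "norm (u 1 - (x 1 - x 0)) \<le> 8 * \<theta> * e"
    using velocity_near_chord[OF xu, of 1] by (simp add: \<theta>_def e_def)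
  ultimately have dP: "norm (P 1 - P 0 - u 1) \<le> 56 * \<theta> * e"
    using norm_triangle_ineq4[of "P 1 - P 0 - (x 1 - x 0)" "u 1 - (x 1 - x 0)"]
    by (simp only: diff_diff_eq diff_add_cancel add_diff_cancel_right diff_diff_eq2)
  have P0: "norm (P 0) \<le> 4 * \<delta>" using speed_bound_radius[OF c0(1), of 1] by (simp add: P_def)
  have ub: "norm (u t) \<le> 2 * e" if "t \<in> {0..1}" for t using speed_bound[OF xu that] by (simp add: e_def)
  have "norm (P 0 \<bullet> (G (x 1) *v u 1) - P 0 \<bullet> (G (x 0) *v u 0)) \<le> (16 * \<theta> * (1 + B) * e\<^sup>2) * \<bar>1 - 0\<bar>"
  proof (rule vector_derivative_bound[where a=0 and b=1])
    fix t :: real assume t: "t \<in> {0..1}"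
    show "((\<lambda>t. P 0 \<bullet> (G (x t) *v u t)) has_vector_derivative
      0 \<bullet> (G (x t) *v u t) + P 0 \<bullet> (DG (x t) (u t) *v u t) + P 0 \<bullet> (G (x t) *v - \<Gamma> (x t) (u t) (u t))) (at t within {0..1})"
      by (intro has_vector_derivative_bilinear_form metric_along_curve spray_curveD xu t has_vector_derivative_const)
    have "\<bar>P 0 \<bullet> (DG (x t) (u t) *v u t) + P 0 \<bullet> (G (x t) *v - \<Gamma> (x t) (u t) (u t))\<bar>
      \<le> (4 * \<delta>) * (\<Lambda> * \<delta> * (2 * e) * (2 * e)) + (4 * \<delta>) * (B * (\<Lambda> * \<delta> * (2 * e)\<^sup>2))"
      by (intro order_trans[OF abs_triangle_ineq] add_mono norm_bilinear_form_le P0 DG_bound xb t ub G_bound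
          acceleration_bound[OF xu])
    also have "\<dots> = 16 * \<theta> * (1 + B) * e\<^sup>2" by (simp add: \<theta>_def power2_eq_square algebra_simps)
    finally show "norm (0 \<bullet> (G (x t) *v u t) + P 0 \<bullet> (DG (x t) (u t) *v u t) + P 0 \<bullet> (G (x t) *v - \<Gamma> (x t) (u t) (u t)))
      \<le> 16 * \<theta> * (1 + B) * e\<^sup>2" by simp
  qed auto
  then have t2: "\<bar>P 0 \<bullet> (G (x 1) *v u 1) - P 0 \<bullet> (G (x 0) *v u 0)\<bar> \<le> 16 * \<theta> * (1 + B) * e\<^sup>2" by simp
  have doubled: "\<bar>2 * a + 2 * b\<bar> \<le> 2 * c + 2 * d" if "\<bar>a\<bar> \<le> c" "\<bar>b\<bar> \<le> d" for a b c d :: real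
    using that by linarith
  have t1: "\<bar>(P 1 - P 0 - u 1) \<bullet> (G (x 1) *v u 1)\<bar> \<le> (56 * \<theta> * e) * (B * (2 * e))"
    by (intro norm_bilinear_form_le dP ub G_bound xb) auto
  have "u 1 \<bullet> (G (x 1) *v P 1) = P 1 \<bullet> (G (x 1) *v u 1)" "u 0 \<bullet> (G (x 0) *v P 0) = P 0 \<bullet> (G (x 0) *v u 0)"
    using bilinear_form_symmetric[OF G_symmetric[OF xb]] by auto
  moreover have "energy (x 0) (x 1) = u 1 \<bullet> (G (x 1) *v u 1)" using energy_constant[OF xu, of 1] by simp
  ultimately have "2 * (u 1 \<bullet> (G (x 1) *v P 1)) - 2 * (u 0 \<bullet> (G (x 0) *v P 0)) - 2 * energy (x 0) (x 1)
      = 2 * ((P 1 - P 0 - u 1) \<bullet> (G (x 1) *v u 1)) + 2 * (P 0 \<bullet> (G (x 1) *v u 1) - P 0 \<bullet> (G (x 0) *v u 0))"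
    by (simp add: inner_diff_left)
  also have "\<bar>\<dots>\<bar> \<le> 2 * ((56 * \<theta> * e) * (B * (2 * e))) + 2 * (16 * \<theta> * (1 + B) * e\<^sup>2)"
    by (rule doubled[OF t1 t2])
  also have "\<dots> = (256 * B + 32) * \<theta> * e\<^sup>2" by (simp add: power2_eq_square algebra_simps)
  finally show ?thesis by (simp add: P_def \<theta>_def e_def)
qed

end

section \<open>Local Lipschitz continuity\<close>

lemma locally_lipschitz_on_openD:
  assumes "locally_lipschitz_on S f" "open S" "x \<in> S"
  obtains e L where "e > 0" "ball x e \<subseteq> S" "L-lipschitz_on (ball x e) f"
proof -
  obtain e L where e: "e > 0" "L-lipschitz_on (ball x e \<inter> S) f"
    using assms unfolding locally_lipschitz_on_def by blast
  obtain r where r: "r > 0" "ball x r \<subseteq> S" using assms openE by blast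
  show ?thesis
  proof (rule that[of "min e r" L])
    show "L-lipschitz_on (ball x (min e r)) f"
      by (rule lipschitz_on_subset[OF e(2)]) (use r in auto)
  qed (use e r in auto)
qed

lemma lipschitz_imp_locally_lipschitz_on: "L-lipschitz_on S f \<Longrightarrow> locally_lipschitz_on S f"
  unfolding locally_lipschitz_on_def by (meson Int_lower2 lipschitz_on_subset zero_less_one)

lemma locally_lipschitz_on_subset:
  assumes "locally_lipschitz_on S f" "T \<subseteq> S"
  shows "locally_lipschitz_on T f"
  unfolding locally_lipschitz_on_def
proof
  fix x assume "x \<in> T"
  with assms obtain e L where "e > 0" "L-lipschitz_on (ball x e \<inter> S) f"
    unfolding locally_lipschitz_on_def by blast
  then show "\<exists>e>0. \<exists>L. L-lipschitz_on (ball x e \<inter> T) f"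
    using lipschitz_on_subset assms(2) by (metis Int_mono order_refl)
qed

lemma locally_lipschitz_on_compose:
  assumes f: "locally_lipschitz_on S f" and g: "locally_lipschitz_on T g" and fS: "f ` S \<subseteq> T"
  shows "locally_lipschitz_on S (\<lambda>x. g (f x))"
  unfolding locally_lipschitz_on_def
proof
  fix x assume x: "x \<in> S"
  obtain e L where e: "e > 0" "L-lipschitz_on (ball x e \<inter> S) f"
    using f x unfolding locally_lipschitz_on_def by blast
  obtain d M where d: "d > 0" "M-lipschitz_on (ball (f x) d \<inter> T) g"
    using g fS x unfolding locally_lipschitz_on_def by blast
  have L: "0 \<le> L" using e lipschitz_on_nonneg by blast
  define r where "r = min e (d / (L + 1))"
  have r: "r > 0" "r \<le> e" using e d L by (auto simp: r_def)
  have fr: "f ` (ball x r \<inter> S) \<subseteq> ball (f x) d \<inter> T"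
  proof
    fix y assume "y \<in> f ` (ball x r \<inter> S)"
    then obtain w where w: "w \<in> S" "dist x w < r" "y = f w" by auto
    have "dist (f x) y \<le> L * dist x w"
      using lipschitz_onD[OF e(2), of x w] w x r e(1) by auto
    also have "\<dots> \<le> (L + 1) * dist x w" by (simp add: distrib_right)
    also have "\<dots> < (L + 1) * (d / (L + 1))" using w L by (intro mult_strict_left_mono) (auto simp: r_def)
    also have "\<dots> = d" using L by simp
    finally show "y \<in> ball (f x) d \<inter> T" using w fS by auto
  qed
  have "(M * L)-lipschitz_on (ball x r \<inter> S) (\<lambda>x. g (f x))"
    by (rule lipschitz_on_compose2[OF lipschitz_on_subset[OF e(2)] lipschitz_on_subset[OF d(2) fr]]) (use r in auto)
  with r show "\<exists>e>0. \<exists>L. L-lipschitz_on (ball x e \<inter> S) (\<lambda>x. g (f x))" by blast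
qed

lemma locally_lipschitz_on_bounded_linear:
  assumes "bounded_linear h" "locally_lipschitz_on S f"
  shows "locally_lipschitz_on S (\<lambda>x. h (f x))"
proof (rule locally_lipschitz_on_compose[OF assms(2), where T=UNIV])
  obtain K where "K-lipschitz_on UNIV h" using bounded_linear.lipschitz_boundE[OF assms(1)] by blast
  then show "locally_lipschitz_on UNIV h" by (rule lipschitz_imp_locally_lipschitz_on)
qed auto

lemma locally_lipschitz_on_add:
  fixes f g :: "'a::metric_space \<Rightarrow> 'b::real_normed_vector"
  assumes "locally_lipschitz_on S f" "locally_lipschitz_on S g"
  shows "locally_lipschitz_on S (\<lambda>x. f x + g x)"
  unfolding locally_lipschitz_on_def
proof
  fix x assume x: "x \<in> S"
  obtain e L where e: "e > 0" "L-lipschitz_on (ball x e \<inter> S) f"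
    using assms x unfolding locally_lipschitz_on_def by blast
  obtain d M where d: "d > 0" "M-lipschitz_on (ball x d \<inter> S) g"
    using assms x unfolding locally_lipschitz_on_def by blast
  have "(L + M)-lipschitz_on (ball x (min e d) \<inter> S) (\<lambda>x. f x + g x)"
    by (intro lipschitz_on_add lipschitz_on_subset[OF e(2)] lipschitz_on_subset[OF d(2)]) auto
  then show "\<exists>e>0. \<exists>L. L-lipschitz_on (ball x e \<inter> S) (\<lambda>x. f x + g x)"
    using e d by (intro exI[of _ "min e d"]) auto
qed

lemma locally_lipschitz_on_sum:
  fixes f :: "'i \<Rightarrow> 'a::metric_space \<Rightarrow> 'b::real_normed_vector"
  assumes "\<And>i. i \<in> I \<Longrightarrow> locally_lipschitz_on S (f i)"
  shows "locally_lipschitz_on S (\<lambda>x. \<Sum>i\<in>I. f i x)"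
  using assms
proof (induction I rule: infinite_finite_induct)
  case (insert i I)
  then show ?case by (simp add: locally_lipschitz_on_add)
qed (auto intro!: lipschitz_imp_locally_lipschitz_on lipschitz_on_constant)

lemma locally_lipschitz_on_mult:
  fixes f g :: "'a::metric_space \<Rightarrow> real"
  assumes "locally_lipschitz_on S f" "locally_lipschitz_on S g"
  shows "locally_lipschitz_on S (\<lambda>x. f x * g x)"
  unfolding locally_lipschitz_on_def
proof
  fix x assume x: "x \<in> S"
  obtain e L where e: "e > 0" "L-lipschitz_on (ball x e \<inter> S) f"
    using assms x unfolding locally_lipschitz_on_def by blast
  obtain d M where d: "d > 0" "M-lipschitz_on (ball x d \<inter> S) g"
    using assms x unfolding locally_lipschitz_on_def by blast
  have LM: "0 \<le> L" "0 \<le> M" using e d lipschitz_on_nonneg by blast+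
  let ?T = "ball x (min e d) \<inter> S"
  define a b where "a = \<bar>f x\<bar> + L * e" and "b = \<bar>g x\<bar> + M * d"
  have fb: "\<bar>f y\<bar> \<le> a" if "y \<in> ?T" for y
  proof -
    have "dist (f y) (f x) \<le> L * dist y x" using lipschitz_onD[OF e(2), of y x] that x e by auto
    also have "\<dots> \<le> L * e" using that LM by (intro mult_left_mono) (auto simp: dist_commute)
    finally show ?thesis by (simp add: a_def dist_real_def)
  qed
  have gb: "\<bar>g y\<bar> \<le> b" if "y \<in> ?T" for y
  proof -
    have "dist (g y) (g x) \<le> M * dist y x" using lipschitz_onD[OF d(2), of y x] that x d by auto
    also have "\<dots> \<le> M * d" using that LM by (intro mult_left_mono) (auto simp: dist_commute)
    finally show ?thesis by (simp add: b_def dist_real_def)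
  qed
  have ab: "0 \<le> a" "0 \<le> b" using e d LM by (auto simp: a_def b_def)
  have "(a * M + b * L)-lipschitz_on ?T (\<lambda>x. f x * g x)"
  proof (rule lipschitz_onI)
    fix y w assume yw: "y \<in> ?T" "w \<in> ?T"
    have "f y * g y - f w * g w = f y * (g y - g w) + g w * (f y - f w)" by (simp add: algebra_simps)
    then have "dist (f y * g y) (f w * g w) \<le> \<bar>f y\<bar> * dist (g y) (g w) + \<bar>g w\<bar> * dist (f y) (f w)"
      using abs_triangle_ineq by (simp add: dist_real_def abs_mult[symmetric])
    also have "\<dots> \<le> a * (M * dist y w) + b * (L * dist y w)"
      using yw ab by (intro add_mono mult_mono fb gb lipschitz_onD[OF e(2)] lipschitz_onD[OF d(2)]) auto
    finally show "dist (f y * g y) (f w * g w) \<le> (a * M + b * L) * dist y w" by (simp add: algebra_simps)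
  qed (use ab LM in auto)
  then show "\<exists>e>0. \<exists>L. L-lipschitz_on (ball x e \<inter> S) (\<lambda>x. f x * g x)"
    using e d by (intro exI[of _ "min e d"]) auto
qed

lemma locally_lipschitz_on_uniform:
  fixes f :: "'i::finite \<Rightarrow> 'a::metric_space \<Rightarrow> 'b::metric_space"
  assumes "\<And>i. locally_lipschitz_on S (f i)" "open S" "x \<in> S"
  obtains e L where "e > 0" "ball x e \<subseteq> S" "\<And>i. L-lipschitz_on (ball x e) (f i)"
proof -
  have "\<forall>i. \<exists>e L. e > 0 \<and> ball x e \<subseteq> S \<and> L-lipschitz_on (ball x e) (f i)"
    using locally_lipschitz_on_openD[OF assms(1) assms(2,3)] by metis
  then obtain e L where eL: "\<And>i. e i > 0" "\<And>i. ball x (e i) \<subseteq> S" "\<And>i. (L i)-lipschitz_on (ball x (e i)) (f i)"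
    by metis
  define r where "r = Min (range e)"
  have r: "r > 0" "r \<le> e i" for i using eL(1) by (auto simp: r_def)
  have nn: "0 \<le> L i" for i using eL(3) lipschitz_on_nonneg by blast
  show ?thesis
  proof (rule that[of r "\<Sum>i\<in>UNIV. L i"])
    show "r > 0" by (rule r)
    show "ball x r \<subseteq> S" using eL(2)[of undefined] r(2)[of undefined] by auto
    fix i show "(\<Sum>i\<in>UNIV. L i)-lipschitz_on (ball x r) (f i)"
      by (rule lipschitz_on_mono[OF eL(3)[of i]]) (use r(2)[of i] nn in \<open>auto intro!: member_le_sum\<close>)
  qed
qed

lemma matrix_inv_mult:
  fixes A :: "real ^ 'n ^ 'n"
  assumes "invertible A"
  shows "A ** matrix_inv A = mat 1" "matrix_inv A ** A = mat 1"
  using someI_ex[OF assms[unfolded invertible_def]] by (auto simp: matrix_inv_def)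

text \<open>Matrices close to an invertible one have uniformly bounded inverses, and
\<open>G\<^sup>-\<^sup>1 - H\<^sup>-\<^sup>1 = G\<^sup>-\<^sup>1 (H - G) H\<^sup>-\<^sup>1\<close>.\<close>

lemma locally_lipschitz_on_matrix_inv:
  fixes G :: "'a::metric_space \<Rightarrow> real ^ 'n ^ 'n"
  assumes G: "locally_lipschitz_on S G" and inv: "\<And>y. y \<in> S \<Longrightarrow> invertible (G y)"
  shows "locally_lipschitz_on S (\<lambda>y. matrix_inv (G y) *v w)"
  unfolding locally_lipschitz_on_def
proof
  fix x assume x: "x \<in> S"
  obtain e L where e: "e > 0" "L-lipschitz_on (ball x e \<inter> S) G"
    using G x unfolding locally_lipschitz_on_def by blast
  have L: "0 \<le> L" using e lipschitz_on_nonneg by blast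
  define b where "b = norm (matrix_inv (G x))"
  have b: "0 \<le> b" by (simp add: b_def)
  define r where "r = min e (1 / (2 * (L * b + 1)))"
  have Lb: "0 \<le> L * b" using L b by simp
  then have r: "r > 0" "r \<le> e" using e by (auto simp: r_def)
  let ?T = "ball x r \<inter> S"
  have inv_mult: "matrix_inv (G y) *v (G y *v v) = v" "G y *v (matrix_inv (G y) *v v) = v" if "y \<in> S" for y v
    using inv[OF that] by (simp_all add: matrix_vector_mul_assoc matrix_inv_mult)
  have bound: "norm (matrix_inv (G y) *v u) \<le> 2 * b * norm u" if y: "y \<in> ?T" for y u
  proof -
    define v where "v = matrix_inv (G y) *v u"
    have "norm (G x - G y) \<le> L * dist x y"
      using lipschitz_onD[OF e(2), of x y] x y r by (auto simp: dist_norm)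
    also have "\<dots> \<le> L * (1 / (2 * (L * b + 1)))" using y L by (intro mult_left_mono) (auto simp: r_def)
    finally have "b * norm (G x - G y) \<le> b * (L * (1 / (2 * (L * b + 1))))" using b by (intro mult_left_mono)
    also have "\<dots> = (L * b) / (2 * (L * b + 1))" by simp
    also have "\<dots> \<le> 1 / 2" using Lb by (simp add: divide_simps)
    finally have half: "b * norm (G x - G y) \<le> 1 / 2" .
    have "v = matrix_inv (G x) *v (u + (G x - G y) *v v)"
      using inv_mult[of x v] inv_mult[of y u] x y
      by (simp add: v_def matrix_vector_mult_diff_rdistrib)
    then have "norm v = norm (matrix_inv (G x) *v (u + (G x - G y) *v v))" by simp
    also have "\<dots> \<le> b * norm (u + (G x - G y) *v v)" unfolding b_def by (rule norm_matrix_vector_mult_le)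
    also have "\<dots> \<le> b * (norm u + norm (G x - G y) * norm v)"
      using b norm_matrix_vector_mult_le[of "G x - G y" v] by (intro mult_left_mono norm_triangle_le) auto
    also have "\<dots> = b * norm u + (b * norm (G x - G y)) * norm v" by (simp add: algebra_simps)
    also have "\<dots> \<le> b * norm u + 1 / 2 * norm v" by (intro add_left_mono mult_right_mono half) auto
    finally show ?thesis by (simp add: v_def)
  qed
  have "(2 * b * (L * (2 * b * norm w)))-lipschitz_on ?T (\<lambda>y. matrix_inv (G y) *v w)"
  proof (rule lipschitz_onI)
    fix y y' assume y: "y \<in> ?T" and y': "y' \<in> ?T"
    have "matrix_inv (G y) *v w - matrix_inv (G y') *v w
        = matrix_inv (G y) *v ((G y' - G y) *v (matrix_inv (G y') *v w))"
      using inv_mult[of y' w] inv_mult[of y "matrix_inv (G y') *v w"] y y'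
      by (simp add: matrix_vector_mult_diff_rdistrib matrix_vector_mult_diff_distrib)
    then have "dist (matrix_inv (G y) *v w) (matrix_inv (G y') *v w)
        \<le> 2 * b * norm ((G y' - G y) *v (matrix_inv (G y') *v w))"
      using bound[OF y] by (simp add: dist_norm)
    also have "\<dots> \<le> 2 * b * (norm (G y' - G y) * norm (matrix_inv (G y') *v w))"
      using b norm_matrix_vector_mult_le by (intro mult_left_mono) auto
    also have "\<dots> \<le> 2 * b * ((L * dist y y') * (2 * b * norm w))"
    proof (intro mult_left_mono mult_mono bound y')
      show "norm (G y' - G y) \<le> L * dist y y'"
        using lipschitz_onD[OF e(2), of y y'] y y' r by (auto simp: dist_norm norm_minus_commute)
    qed (use b L in auto)
    finally show "dist (matrix_inv (G y) *v w) (matrix_inv (G y') *v w)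
        \<le> 2 * b * (L * (2 * b * norm w)) * dist y y'" by (simp add: mult_ac)
  qed (use b L in auto)
  with r show "\<exists>e>0. \<exists>L. L-lipschitz_on (ball x e \<inter> S) (\<lambda>y. matrix_inv (G y) *v w)" by blast
qed

text \<open>Each directional derivative is locally Lipschitz, hence locally bounded. Finitely many directions
span the space, so the derivative is locally bounded in operator norm, and the mean value
inequality on a ball applies.\<close>

lemma C1_imp_locally_lipschitz_on:
  fixes f :: "'a::euclidean_space \<Rightarrow> 'b::real_normed_vector"
  assumes S: "open S" and f: "Ck1_on (Suc 0) S f"
  shows "locally_lipschitz_on S f"
  unfolding locally_lipschitz_on_def
proof
  fix x assume x: "x \<in> S"
  have d: "(f has_derivative frechet_derivative f (at y)) (at y)" if "y \<in> S" for y
    using f S that by (simp add: differentiable_on_eq_differentiable_at frechet_derivative_works)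
  define F where "F = (\<lambda>y b. frechet_derivative f (at y) b)"
  have "\<exists>r M. r > 0 \<and> ball x r \<subseteq> S \<and> (\<forall>y\<in>ball x r. norm (F y b) \<le> M)" for b
  proof -
    obtain e L where e: "e > 0" "ball x e \<subseteq> S" "L-lipschitz_on (ball x e) (\<lambda>y. F y b)"
      using locally_lipschitz_on_openD[of S "\<lambda>y. F y b" x] f S x by (auto simp: F_def)
    have L: "0 \<le> L" using e lipschitz_on_nonneg by blast
    have "norm (F y b) \<le> norm (F x b) + L * e" if "y \<in> ball x e" for y
    proof -
      have "norm (F y b - F x b) \<le> L * norm (y - x)" using lipschitz_on_normD[OF e(3), of y x] that e(1) by auto
      also have "\<dots> \<le> L * e" using that L by (intro mult_left_mono) (auto simp: dist_norm norm_minus_commute)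
      finally show ?thesis using norm_triangle_ineq2[of "F y b" "F x b"] by linarith
    qed
    with e show ?thesis by blast
  qed
  then obtain r M where rM: "\<And>b. r b > 0" "\<And>b. ball x (r b) \<subseteq> S" "\<And>b y. y \<in> ball x (r b) \<Longrightarrow> norm (F y b) \<le> M b"
    by metis
  define \<rho> where "\<rho> = Min (r ` Basis)"
  have \<rho>: "\<rho> > 0" "\<And>b. b \<in> Basis \<Longrightarrow> \<rho> \<le> r b" using rM(1) by (auto simp: \<rho>_def)
  have \<rho>S: "ball x \<rho> \<subseteq> S" using \<rho>(2)[OF SOME_Basis] rM(2)[of "SOME i. i \<in> Basis"] by (meson order_trans subset_ball)
  define K where "K = (\<Sum>b\<in>Basis. M b)"
  have nK: "norm (F y h) \<le> K * norm h" if y: "y \<in> ball x \<rho>" for y h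
  proof -
    have lin: "linear (F y)" using has_derivative_linear[OF d[of y]] y \<rho>S by (auto simp: F_def)
    have "F y h = F y (\<Sum>b\<in>Basis. (h \<bullet> b) *\<^sub>R b)" by (simp add: euclidean_representation)
    also have "\<dots> = (\<Sum>b\<in>Basis. (h \<bullet> b) *\<^sub>R F y b)" by (simp add: linear_sum[OF lin] linear_scale[OF lin])
    also have "norm \<dots> \<le> (\<Sum>b\<in>Basis. norm h * M b)"
    proof (rule sum_norm_le)
      fix b :: 'a assume b: "b \<in> Basis"
      have "y \<in> ball x (r b)" using y \<rho>(2)[OF b] by auto
      then have "\<bar>h \<bullet> b\<bar> * norm (F y b) \<le> norm h * M b"
        using Basis_le_norm[OF b] rM(3) by (intro mult_mono) auto
      then show "norm ((h \<bullet> b) *\<^sub>R F y b) \<le> norm h * M b" by simp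
    qed
    also have "\<dots> = K * norm h" by (simp add: K_def sum_distrib_left mult.commute)
    finally show ?thesis .
  qed
  have "K-lipschitz_on (ball x \<rho>) f"
  proof (rule bounded_derivative_imp_lipschitz[where f'="F"])
    show "(f has_derivative F y) (at y within ball x \<rho>)" if "y \<in> ball x \<rho>" for y
      unfolding F_def by (rule has_derivative_at_withinI[OF d]) (use that \<rho>S in blast)
    show "onorm (F y) \<le> K" if "y \<in> ball x \<rho>" for y using nK[OF that] by (rule onorm_le)
    have "\<exists>b::'a. b \<in> Basis \<and> norm b = 1" using SOME_Basis by (auto intro!: exI[of _ "SOME b::'a. b \<in> Basis"])
    then obtain b :: 'a where "norm b = 1" by blast
    then show "0 \<le> K" using nK[of x b] \<rho>(1) norm_ge_zero[of "F x b"] by (simp del: norm_ge_zero)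
  qed auto
  then have "K-lipschitz_on (ball x \<rho> \<inter> S) f" by (rule lipschitz_on_subset) auto
  with \<rho> show "\<exists>e>0. \<exists>L. L-lipschitz_on (ball x e \<inter> S) f" by blast
qed


section \<open>The Levi-Civita connection in a chart\<close>

definition connection_form ::
  "('m, 'n::finite) tensor2 \<Rightarrow> ('m, 'n) chart \<Rightarrow> real ^ 'n \<Rightarrow> real ^ 'n \<Rightarrow> real ^ 'n \<Rightarrow> real ^ 'n" where
  "connection_form g c y u v =
     (\<chi> \<mu>. \<Sum>\<alpha>\<in>UNIV. \<Sum>\<beta>\<in>UNIV. christoffel g c y \<mu> \<alpha> \<beta> * u $ \<alpha> * v $ \<beta>)"

lemma bilinear_connection_form: "bilinear (connection_form g c y)"
  unfolding bilinear_def
  by (auto intro!: linearI simp: connection_form_def vec_eq_iff sum.distrib[symmetric] sum_distrib_left algebra_simps)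

lemma det_minkowski_nonzero: "det (minkowski z) \<noteq> 0"
proof -
  have "det (minkowski z) = (\<Prod>i\<in>UNIV. minkowski z $ i $ i)"
    by (rule det_diagonal) (simp add: minkowski_def)
  then show ?thesis by (simp add: minkowski_def)
qed

lemma lorentzian_matrix_invertible:
  assumes "lorentzian_matrix z A"
  shows "invertible A"
proof -
  obtain P where "transpose P ** A ** P = minkowski z"
    using assms unfolding lorentzian_matrix_def by blast
  then have "det (transpose P) * det A * det P \<noteq> 0"
    using det_minkowski_nonzero[of z] by (metis det_mul)
  then show ?thesis by (simp add: invertible_det_nz)
qed

locale lorentzian_chart =
  fixes g :: "('m, 'n::finite) tensor2" and c :: "('m, 'n) chart" and S :: "(real ^ 'n) set" and z :: 'n
  assumes open_S: "open S" and C11: "Ck1_on 1 S (g c)"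
    and lorentzian: "y \<in> S \<Longrightarrow> lorentzian_matrix z (g c y)"
begin

abbreviation "G \<equiv> g c"
abbreviation "DG y \<equiv> frechet_derivative (g c) (at y)"

lemma metric_invertible: "y \<in> S \<Longrightarrow> invertible (G y)"
  using lorentzian lorentzian_matrix_invertible by blast

lemma metric_symmetric: "y \<in> S \<Longrightarrow> transpose (G y) = G y"
  using lorentzian by (auto simp: lorentzian_matrix_def)

lemma metric_derivative: "y \<in> S \<Longrightarrow> (G has_derivative DG y) (at y)"
  using C11 open_S by (auto simp: differentiable_on_eq_differentiable_at frechet_derivative_works)

lemma DG_locally_lipschitz: "locally_lipschitz_on S (\<lambda>y. DG y h)"
  using C11 by simp

lemma DG_linear: "y \<in> S \<Longrightarrow> linear (DG y)"
  using metric_derivative has_derivative_linear by blast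

lemma DG_symmetric:
  assumes y: "y \<in> S"
  shows "DG y h $ i $ j = DG y h $ j $ i"
proof -
  have comp: "((\<lambda>x. G x $ i $ j) has_derivative (\<lambda>h. DG y h $ i $ j)) (at y)" for i j
    by (intro bounded_linear.has_derivative[OF bounded_linear_vec_nth] metric_derivative[OF y])
  have "G x $ i $ j = G x $ j $ i" if "x \<in> S" for x
    using metric_symmetric[OF that] by (metis transpose_def vec_lambda_beta)
  then have "((\<lambda>x. G x $ j $ i) has_derivative (\<lambda>h. DG y h $ i $ j)) (at y)"
    by (rule has_derivative_transform_within_open[OF comp open_S y])
  from fun_cong[OF has_derivative_unique[OF this comp]] show ?thesis .
qed

lemma DG_expand:
  assumes y: "y \<in> S"
  shows "DG y h = (\<Sum>\<alpha>\<in>UNIV. h $ \<alpha> *\<^sub>R DG y (axis \<alpha> 1))"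
proof -
  have "h = (\<Sum>\<alpha>\<in>UNIV. h $ \<alpha> *\<^sub>R axis \<alpha> 1)"
    using basis_expansion[of h] by (simp add: scalar_mult_eq_scaleR)
  then have "DG y h = DG y (\<Sum>\<alpha>\<in>UNIV. h $ \<alpha> *\<^sub>R axis \<alpha> 1)" by simp
  also have "\<dots> = (\<Sum>\<alpha>\<in>UNIV. h $ \<alpha> *\<^sub>R DG y (axis \<alpha> 1))"
    using DG_linear[OF y] by (simp add: linear_sum linear_scale)
  finally show ?thesis .
qed

lemma DG_component:
  assumes "y \<in> S"
  shows "DG y h $ i $ j = (\<Sum>\<alpha>\<in>UNIV. h $ \<alpha> * partial_metric g c y \<alpha> i j)"
  by (subst DG_expand[OF assms]) (simp add: partial_metric_def)

lemma christoffel_locally_lipschitz: "locally_lipschitz_on S (\<lambda>y. christoffel g c y \<mu> \<alpha> \<beta>)"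
proof -
  have pm: "locally_lipschitz_on S (\<lambda>y. partial_metric g c y \<alpha> \<beta> \<gamma>)" for \<alpha> \<beta> \<gamma>
    unfolding partial_metric_def
    by (intro locally_lipschitz_on_bounded_linear[OF bounded_linear_vec_nth] DG_locally_lipschitz)
  have pm_neg: "locally_lipschitz_on S (\<lambda>y. - partial_metric g c y \<alpha> \<beta> \<gamma>)" for \<alpha> \<beta> \<gamma>
    by (intro locally_lipschitz_on_bounded_linear[OF bounded_linear_minus[OF bounded_linear_ident]] pm)
  have "locally_lipschitz_on S G"
    using C1_imp_locally_lipschitz_on[OF open_S] C11 by simp
  then have "locally_lipschitz_on S (\<lambda>y. (matrix_inv (G y) *v axis \<sigma> 1) $ \<mu>)" for \<sigma> \<mu>
    by (intro locally_lipschitz_on_bounded_linear[OF bounded_linear_vec_nth]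
        locally_lipschitz_on_matrix_inv metric_invertible)
  then have inv: "locally_lipschitz_on S (\<lambda>y. matrix_inv (G y) $ \<mu> $ \<sigma>)" for \<sigma> \<mu>
    by (simp add: matrix_vector_mult_basis column_def)
  show ?thesis
    unfolding christoffel_def diff_conv_add_uminus
    by (intro locally_lipschitz_on_bounded_linear[OF bounded_linear_mult_right]
        locally_lipschitz_on_sum locally_lipschitz_on_mult inv locally_lipschitz_on_add pm pm_neg)
qed

lemma connection_form_locally_lipschitz:
  assumes y: "y \<in> S"
  obtains e L where "e > 0" "0 \<le> L" "ball y e \<subseteq> S"
    "\<And>x x' u v. x \<in> ball y e \<Longrightarrow> x' \<in> ball y e \<Longrightarrow>
      norm (connection_form g c x u v - connection_form g c x' u v) \<le> L * norm (x - x') * norm u * norm v"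
proof -
  let ?f = "\<lambda>(\<mu>, \<alpha>, \<beta>) y. christoffel g c y \<mu> \<alpha> \<beta>"
  obtain e L where e: "e > 0" "ball y e \<subseteq> S" "\<And>i. L-lipschitz_on (ball y e) (?f i)"
    using locally_lipschitz_on_uniform[OF _ open_S y, of ?f] christoffel_locally_lipschitz
    by (auto split: prod.splits)
  have L: "0 \<le> L" using e(3) lipschitz_on_nonneg by blast
  define N where "N = real CARD('n)"
  show ?thesis
  proof (rule that[of e "N * (N * (N * L))"])
    show "0 \<le> N * (N * (N * L))" using L by (simp add: N_def)
    fix x x' u v assume x: "x \<in> ball y e" "x' \<in> ball y e"
    let ?d = "\<lambda>\<mu> \<alpha> \<beta>. christoffel g c x \<mu> \<alpha> \<beta> - christoffel g c x' \<mu> \<alpha> \<beta>"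
    have d: "\<bar>?d \<mu> \<alpha> \<beta> * u $ \<alpha> * v $ \<beta>\<bar> \<le> L * norm (x - x') * norm u * norm v" for \<mu> \<alpha> \<beta>
      unfolding abs_mult
      using lipschitz_on_normD[OF e(3)[of "(\<mu>, \<alpha>, \<beta>)"] x] L
      by (intro mult_mono component_le_norm_cart) auto
    have "norm (connection_form g c x u v - connection_form g c x' u v)
      \<le> (\<Sum>\<mu>\<in>UNIV. \<bar>(connection_form g c x u v - connection_form g c x' u v) $ \<mu>\<bar>)"
      by (rule norm_le_l1_cart)
    also have "\<dots> = (\<Sum>\<mu>\<in>UNIV. \<bar>\<Sum>\<alpha>\<in>UNIV. \<Sum>\<beta>\<in>UNIV. ?d \<mu> \<alpha> \<beta> * u $ \<alpha> * v $ \<beta>\<bar>)"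
      by (simp add: connection_form_def sum_subtractf algebra_simps)
    also have "\<dots> \<le> (\<Sum>\<mu>\<in>(UNIV::'n set). \<Sum>\<alpha>\<in>(UNIV::'n set). \<Sum>\<beta>\<in>(UNIV::'n set). L * norm (x - x') * norm u * norm v)"
      by (intro sum_mono order_trans[OF sum_abs] d)
    also have "\<dots> = N * (N * (N * L)) * norm (x - x') * norm u * norm v"
      by (simp add: N_def)
    finally show "norm (connection_form g c x u v - connection_form g c x' u v)
      \<le> N * (N * (N * L)) * norm (x - x') * norm u * norm v" .
  qed (use e in auto)
qed

text \<open>Lowering the index removes the inverse metric from the Christoffel symbols. Contracted with
\<open>u\<close> twice, the first two of the remaining three derivatives of the metric coincide.\<close>

lemma euler_lagrange:
  assumes y: "y \<in> S"
  shows "a \<bullet> (G y *v connection_form g c y u u) = a \<bullet> (DG y u *v u) - (1 / 2) * (u \<bullet> (DG y a *v u))"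
proof -
  let ?D = "partial_metric g c y"
  define b :: "real ^ 'n" where
    "b = (\<chi> \<sigma>. (1 / 2) * (\<Sum>\<alpha>\<in>UNIV. \<Sum>\<beta>\<in>UNIV. (?D \<alpha> \<sigma> \<beta> + ?D \<beta> \<sigma> \<alpha> - ?D \<sigma> \<alpha> \<beta>) * u $ \<alpha> * u $ \<beta>))"
  have "connection_form g c y u u = matrix_inv (G y) *v b"
  proof (simp add: vec_eq_iff, intro allI)
    fix \<mu>
    have "connection_form g c y u u $ \<mu> = (\<Sum>\<alpha>\<in>UNIV. \<Sum>\<beta>\<in>UNIV. \<Sum>\<sigma>\<in>UNIV.
        matrix_inv (G y) $ \<mu> $ \<sigma> * ((1 / 2) * ((?D \<alpha> \<sigma> \<beta> + ?D \<beta> \<sigma> \<alpha> - ?D \<sigma> \<alpha> \<beta>) * u $ \<alpha> * u $ \<beta>)))"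
      by (simp add: connection_form_def christoffel_def sum_distrib_left sum_distrib_right mult_ac)
    also have "\<dots> = (\<Sum>\<alpha>\<in>UNIV. \<Sum>\<sigma>\<in>UNIV. \<Sum>\<beta>\<in>UNIV.
        matrix_inv (G y) $ \<mu> $ \<sigma> * ((1 / 2) * ((?D \<alpha> \<sigma> \<beta> + ?D \<beta> \<sigma> \<alpha> - ?D \<sigma> \<alpha> \<beta>) * u $ \<alpha> * u $ \<beta>)))"
      by (intro sum.cong refl sum.swap)
    also have "\<dots> = (\<Sum>\<sigma>\<in>UNIV. \<Sum>\<alpha>\<in>UNIV. \<Sum>\<beta>\<in>UNIV.
        matrix_inv (G y) $ \<mu> $ \<sigma> * ((1 / 2) * ((?D \<alpha> \<sigma> \<beta> + ?D \<beta> \<sigma> \<alpha> - ?D \<sigma> \<alpha> \<beta>) * u $ \<alpha> * u $ \<beta>)))"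
      by (rule sum.swap)
    also have "\<dots> = (matrix_inv (G y) *v b) $ \<mu>"
      by (simp only: matrix_vector_mult_def b_def vec_lambda_beta sum_distrib_left)
    finally show "connection_form g c y u u $ \<mu> = (matrix_inv (G y) *v b) $ \<mu>" .
  qed
  then have Gb: "G y *v connection_form g c y u u = b"
    using matrix_inv_mult[OF metric_invertible[OF y]] by (simp add: matrix_vector_mul_assoc)
  have form: "v \<bullet> (DG y h *v w) = (\<Sum>\<sigma>\<in>UNIV. \<Sum>\<alpha>\<in>UNIV. \<Sum>\<beta>\<in>UNIV. v $ \<sigma> * (h $ \<alpha> * ?D \<alpha> \<sigma> \<beta> * w $ \<beta>))" for v h w
  proof -
    have "v \<bullet> (DG y h *v w) = (\<Sum>\<sigma>\<in>UNIV. \<Sum>\<beta>\<in>UNIV. \<Sum>\<alpha>\<in>UNIV. v $ \<sigma> * (h $ \<alpha> * ?D \<alpha> \<sigma> \<beta> * w $ \<beta>))"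
      by (simp add: inner_vec_def matrix_vector_mult_def DG_component[OF y] sum_distrib_left sum_distrib_right)
    also have "\<dots> = (\<Sum>\<sigma>\<in>UNIV. \<Sum>\<alpha>\<in>UNIV. \<Sum>\<beta>\<in>UNIV. v $ \<sigma> * (h $ \<alpha> * ?D \<alpha> \<sigma> \<beta> * w $ \<beta>))"
      by (intro sum.cong refl sum.swap)
    finally show ?thesis .
  qed
  have X: "(\<Sum>\<sigma>\<in>UNIV. \<Sum>\<alpha>\<in>UNIV. \<Sum>\<beta>\<in>UNIV. a $ \<sigma> * (?D \<alpha> \<sigma> \<beta> * u $ \<alpha> * u $ \<beta>)) = a \<bullet> (DG y u *v u)"
    by (simp add: form mult_ac)
  have Y: "(\<Sum>\<sigma>\<in>UNIV. \<Sum>\<alpha>\<in>UNIV. \<Sum>\<beta>\<in>UNIV. a $ \<sigma> * (?D \<beta> \<sigma> \<alpha> * u $ \<alpha> * u $ \<beta>)) = a \<bullet> (DG y u *v u)"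
  proof -
    have "(\<Sum>\<sigma>\<in>UNIV. \<Sum>\<alpha>\<in>UNIV. \<Sum>\<beta>\<in>UNIV. a $ \<sigma> * (?D \<beta> \<sigma> \<alpha> * u $ \<alpha> * u $ \<beta>))
        = (\<Sum>\<sigma>\<in>UNIV. \<Sum>\<beta>\<in>UNIV. \<Sum>\<alpha>\<in>UNIV. a $ \<sigma> * (?D \<beta> \<sigma> \<alpha> * u $ \<alpha> * u $ \<beta>))"
      by (intro sum.cong refl sum.swap)
    then show ?thesis by (simp add: form mult_ac)
  qed
  have Z: "(\<Sum>\<sigma>\<in>UNIV. \<Sum>\<alpha>\<in>UNIV. \<Sum>\<beta>\<in>UNIV. a $ \<sigma> * (?D \<sigma> \<alpha> \<beta> * u $ \<alpha> * u $ \<beta>)) = u \<bullet> (DG y a *v u)"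
  proof -
    have "(\<Sum>\<sigma>\<in>UNIV. \<Sum>\<alpha>\<in>UNIV. \<Sum>\<beta>\<in>UNIV. a $ \<sigma> * (?D \<sigma> \<alpha> \<beta> * u $ \<alpha> * u $ \<beta>))
        = (\<Sum>\<alpha>\<in>UNIV. \<Sum>\<sigma>\<in>UNIV. \<Sum>\<beta>\<in>UNIV. a $ \<sigma> * (?D \<sigma> \<alpha> \<beta> * u $ \<alpha> * u $ \<beta>))"
      by (rule sum.swap)
    then show ?thesis by (simp add: form mult_ac)
  qed
  have "a \<bullet> b = (1 / 2) * (\<Sum>\<sigma>\<in>UNIV. \<Sum>\<alpha>\<in>UNIV. \<Sum>\<beta>\<in>UNIV.
      a $ \<sigma> * ((?D \<alpha> \<sigma> \<beta> + ?D \<beta> \<sigma> \<alpha> - ?D \<sigma> \<alpha> \<beta>) * u $ \<alpha> * u $ \<beta>))"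
    by (simp add: inner_vec_def b_def sum_distrib_left mult_ac)
  also have "\<dots> = (1 / 2) * (a \<bullet> (DG y u *v u) + a \<bullet> (DG y u *v u) - u \<bullet> (DG y a *v u))"
    unfolding ring_distribs sum.distrib sum_subtractf X Y Z ..
  finally show ?thesis by (simp add: Gb)
qed

text \<open>If all Christoffel symbols vanish, then \<open>\<partial>\<^sub>\<alpha> g\<^sub>\<sigma>\<^sub>\<beta> + \<partial>\<^sub>\<beta> g\<^sub>\<sigma>\<^sub>\<alpha> = \<partial>\<^sub>\<sigma> g\<^sub>\<alpha>\<^sub>\<beta>\<close> for
all indices. Adding the same equation with \<open>\<sigma>\<close> and \<open>\<alpha>\<close> interchanged leaves
\<open>2 * \<partial>\<^sub>\<beta> g\<^sub>\<sigma>\<^sub>\<alpha> = 0\<close>.\<close>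

lemma DG_zero_if_christoffel_zero:
  assumes y: "y \<in> S" and 0: "\<And>\<mu> \<alpha> \<beta>. christoffel g c y \<mu> \<alpha> \<beta> = 0"
  shows "DG y h = 0"
proof -
  let ?D = "partial_metric g c y"
  have sym: "?D \<gamma> \<alpha> \<beta> = ?D \<gamma> \<beta> \<alpha>" for \<alpha> \<beta> \<gamma>
    unfolding partial_metric_def by (rule DG_symmetric[OF y])
  have first: "?D \<alpha> \<sigma> \<beta> + ?D \<beta> \<sigma> \<alpha> - ?D \<sigma> \<alpha> \<beta> = 0" for \<alpha> \<beta> \<sigma>
  proof -
    let ?k = "(\<chi> \<sigma>. ?D \<alpha> \<sigma> \<beta> + ?D \<beta> \<sigma> \<alpha> - ?D \<sigma> \<alpha> \<beta>) :: real ^ 'n"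
    have "matrix_inv (G y) *v ?k = 0"
      using 0[of _ \<alpha> \<beta>] by (simp add: vec_eq_iff christoffel_def matrix_vector_mult_def)
    then have "G y *v (matrix_inv (G y) *v ?k) = 0" by simp
    then have "?k = 0"
      using matrix_inv_mult(1)[OF metric_invertible[OF y]] by (simp add: matrix_vector_mul_assoc)
    then show ?thesis by (simp add: vec_eq_iff)
  qed
  have "?D \<beta> \<sigma> \<alpha> = 0" for \<alpha> \<beta> \<sigma>
    using first[of \<alpha> \<sigma> \<beta>] first[of \<sigma> \<alpha> \<beta>] sym[of \<beta> \<alpha> \<sigma>] by linarith
  then show ?thesis by (simp add: vec_eq_iff DG_component[OF y])
qed

end

section \<open>Coordinate changes\<close>

locale lorentzian_manifold =
  fixes A :: "('m::t2_space, 'n::finite) chart set" and g :: "('m, 'n) tensor2" and z :: 'n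
  assumes atlas: "maximal_C21_atlas A" and metric: "C11_lorentzian_metric A z g"
begin

abbreviation coord_inv :: "('m, 'n) chart \<Rightarrow> real ^ 'n \<Rightarrow> 'm" where
  "coord_inv c \<equiv> inv_into (fst c) (snd c)"

lemma chart:
  assumes "c \<in> A"
  shows "open (fst c)" "open (snd c ` fst c)" "continuous_on (fst c) (snd c)"
    "continuous_on (snd c ` fst c) (coord_inv c)" "inj_on (snd c) (fst c)"
    "\<And>q. q \<in> fst c \<Longrightarrow> coord_inv c (snd c q) = q"
proof -
  have "is_chart c" using atlas assms by (auto simp: maximal_C21_atlas_def)
  then have "open (fst c)" "open (snd c ` fst c)"
    and h: "homeomorphism (fst c) (snd c ` fst c) (snd c) (coord_inv c)"
    by (auto simp: is_chart_def split: prod.splits)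
  then show "open (fst c)" "open (snd c ` fst c)" "continuous_on (fst c) (snd c)"
    "continuous_on (snd c ` fst c) (coord_inv c)"
    by (auto simp: homeomorphism_def)
  show inv: "\<And>q. q \<in> fst c \<Longrightarrow> coord_inv c (snd c q) = q"
    using h by (auto simp: homeomorphism_def)
  show "inj_on (snd c) (fst c)" using inv by (metis inj_onI)
qed

lemma charts_cover: obtains c where "c \<in> A" "q \<in> fst c"
  using atlas unfolding maximal_C21_atlas_def by blast

lemma lorentzian_chart: "c \<in> A \<Longrightarrow> lorentzian_chart g c (snd c ` fst c) z"
  using metric chart(2) by (auto simp: lorentzian_chart_def C11_lorentzian_metric_def)

abbreviation overlap :: "('m, 'n) chart \<Rightarrow> ('m, 'n) chart \<Rightarrow> (real ^ 'n) set" where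
  "overlap c c' \<equiv> snd c ` (fst c \<inter> fst c')"

abbreviation J :: "('m, 'n) chart \<Rightarrow> ('m, 'n) chart \<Rightarrow> real ^ 'n \<Rightarrow> real ^ 'n \<Rightarrow> real ^ 'n" where
  "J c c' y \<equiv> frechet_derivative (transition c c') (at y)"

text \<open>\<open>J2 c c' y a b\<close> is the second derivative of the coordinate change at \<open>y\<close>, in the directions \<open>a\<close>
and \<open>b\<close>.\<close>

abbreviation J2 :: "('m, 'n) chart \<Rightarrow> ('m, 'n) chart \<Rightarrow> real ^ 'n \<Rightarrow> real ^ 'n \<Rightarrow> real ^ 'n \<Rightarrow> real ^ 'n" where
  "J2 c c' y a \<equiv> frechet_derivative (\<lambda>x. J c c' x a) (at y)"

lemma open_image_chart:
  assumes "c \<in> A" "open V" "V \<subseteq> fst c"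
  shows "open (snd c ` V)"
proof -
  have "snd c ` V = snd c ` fst c \<inter> coord_inv c -` V"
    using chart(6)[OF assms(1)] assms(3) by auto
  then show ?thesis
    using continuous_open_preimage[OF chart(4)[OF assms(1)] chart(2)[OF assms(1)] assms(2)] by simp
qed

lemma open_overlap: "c \<in> A \<Longrightarrow> c' \<in> A \<Longrightarrow> open (overlap c c')"
  by (intro open_image_chart) (auto simp: chart(1))

lemma transition_coord: "c \<in> A \<Longrightarrow> q \<in> fst c \<Longrightarrow> transition c c' (snd c q) = snd c' q"
  by (simp add: transition_def chart(6))

context
  fixes c c' :: "('m, 'n) chart"
  assumes c: "c \<in> A" and c': "c' \<in> A"
begin

lemma transition_regularity:
  "transition c c' differentiable_on overlap c c'"
  "Ck1_on 1 (overlap c c') (\<lambda>x. J c c' x v)"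
proof -
  have "C21_compatible c c'" using atlas c c' unfolding maximal_C21_atlas_def by blast
  then have "Ck1_on (Suc (Suc 0)) (overlap c c') (transition c c')"
    unfolding C21_compatible_def by (simp add: numeral_2_eq_2)
  then show "transition c c' differentiable_on overlap c c'" "Ck1_on 1 (overlap c c') (\<lambda>x. J c c' x v)"
    by auto
qed

lemma transition_derivative: "y \<in> overlap c c' \<Longrightarrow> (transition c c' has_derivative J c c' y) (at y)"
  using transition_regularity(1) open_overlap[OF c c']
  by (auto simp: differentiable_on_eq_differentiable_at frechet_derivative_works)

lemma J_linear: "y \<in> overlap c c' \<Longrightarrow> linear (J c c' y)"
  using transition_derivative has_derivative_linear by blast

lemma J_derivative: "y \<in> overlap c c' \<Longrightarrow> ((\<lambda>x. J c c' x a) has_derivative J2 c c' y a) (at y)"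
  using transition_regularity(2)[of a] open_overlap[OF c c']
  by (auto simp: differentiable_on_eq_differentiable_at frechet_derivative_works)

lemma J2_symmetric: "y \<in> overlap c c' \<Longrightarrow> J2 c c' y a b = J2 c c' y b a"
proof -
  assume y: "y \<in> overlap c c'"
  show ?thesis
    using second_derivative_symmetric[OF open_overlap[OF c c'] y transition_derivative,
        where f''="\<lambda>h a. J2 c c' y a h" and a=b and b=a] J_derivative[OF y] by simp
qed

lemma transition_locally_lipschitz: "locally_lipschitz_on (overlap c c') (transition c c')"
proof (rule C1_imp_locally_lipschitz_on[OF open_overlap[OF c c']])
  have "locally_lipschitz_on (overlap c c') (\<lambda>x. J c c' x v)" for v
    by (rule C1_imp_locally_lipschitz_on[OF open_overlap[OF c c']]) (use transition_regularity(2) in simp)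
  then show "Ck1_on (Suc 0) (overlap c c') (transition c c')"
    using transition_regularity(1) by simp
qed

lemma J_expand:
  assumes "y \<in> overlap c c'"
  shows "J c c' y a = (\<Sum>i\<in>UNIV. a $ i *\<^sub>R J c c' y (axis i 1))"
proof -
  have "a = (\<Sum>i\<in>UNIV. a $ i *\<^sub>R axis i 1)"
    using basis_expansion[of a] by (simp add: scalar_mult_eq_scaleR)
  then have "J c c' y a = J c c' y (\<Sum>i\<in>UNIV. a $ i *\<^sub>R axis i 1)" by simp
  also have "\<dots> = (\<Sum>i\<in>UNIV. a $ i *\<^sub>R J c c' y (axis i 1))"
    using J_linear[OF assms] by (simp add: linear_sum linear_scale)
  finally show ?thesis .
qed

lemma J2_expand:
  assumes y: "y \<in> overlap c c'"
  shows "J2 c c' y a h = (\<Sum>i\<in>UNIV. a $ i *\<^sub>R J2 c c' y (axis i 1) h)"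
proof -
  have "((\<lambda>x. \<Sum>i\<in>UNIV. a $ i *\<^sub>R J c c' x (axis i 1)) has_derivative
      (\<lambda>h. \<Sum>i\<in>UNIV. a $ i *\<^sub>R J2 c c' y (axis i 1) h)) (at y)"
    by (intro has_derivative_sum bounded_linear.has_derivative[OF bounded_linear_scaleR_right] J_derivative[OF y])
  then have "((\<lambda>x. J c c' x a) has_derivative (\<lambda>h. \<Sum>i\<in>UNIV. a $ i *\<^sub>R J2 c c' y (axis i 1) h)) (at y)"
    by (rule has_derivative_transform_within_open[OF _ open_overlap[OF c c'] y]) (simp add: J_expand[symmetric])
  from fun_cong[OF has_derivative_unique[OF J_derivative[OF y] this]] show ?thesis .
qed

lemma metric_transform:
  assumes "x \<in> overlap c c'"
  shows "a \<bullet> (g c x *v b) = J c c' x a \<bullet> (g c' (transition c c' x) *v J c c' x b)"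
proof -
  obtain q where q: "q \<in> fst c" "q \<in> fst c'" "x = snd c q" using assms by auto
  define T where "T = matrix (J c c' x)"
  have T: "T *v h = J c c' x h" for h
    unfolding T_def using matrix_vector_mul(2)[OF J_linear[OF assms]] by metis
  have "g c x = transpose T ** g c' (snd c' q) ** T"
    using metric c c' q unfolding C11_lorentzian_metric_def Let_def jacobian_def T_def by blast
  then have "a \<bullet> (g c x *v b) = a \<bullet> (transpose T *v (g c' (snd c' q) *v (T *v b)))"
    by (simp add: matrix_vector_mul_assoc matrix_mul_assoc)
  also have "\<dots> = (T *v a) \<bullet> (g c' (snd c' q) *v (T *v b))"
    by (metis dot_lmul_matrix transpose_transpose vector_transpose_matrix)
  finally show ?thesis using q transition_coord[OF c q(1)] by (simp add: T)
qed

lemma metric_derivative_transform: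
  assumes x: "x \<in> overlap c c'"
  defines "y \<equiv> transition c c' x"
  shows "a \<bullet> (frechet_derivative (g c) (at x) h *v b) =
    J2 c c' x a h \<bullet> (g c' y *v J c c' x b)
    + J c c' x a \<bullet> (frechet_derivative (g c') (at y) (J c c' x h) *v J c c' x b)
    + J c c' x a \<bullet> (g c' y *v J2 c c' x b h)"
proof -
  interpret C: lorentzian_chart g c "snd c ` fst c" z by (rule lorentzian_chart[OF c])
  interpret C': lorentzian_chart g c' "snd c' ` fst c'" z by (rule lorentzian_chart[OF c'])
  have xS: "x \<in> snd c ` fst c" and yS: "y \<in> snd c' ` fst c'"
    using x transition_coord[OF c, of _ c'] by (auto simp: y_def)
  note bl_inner = bounded_bilinear.FDERIV[OF bounded_bilinear_inner]
  note bl_mult = bounded_bilinear.FDERIV[OF bounded_bilinear_matrix_vector_mult]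
  have gy: "((\<lambda>x. g c' (transition c c' x)) has_derivative
      (\<lambda>h. frechet_derivative (g c') (at y) (J c c' x h))) (at x)"
    using has_derivative_compose[OF transition_derivative[OF x], of "g c'"] C'.metric_derivative[OF yS]
    unfolding y_def by blast
  have L: "((\<lambda>x. a \<bullet> (g c x *v b)) has_derivative (\<lambda>h. a \<bullet> (frechet_derivative (g c) (at x) h *v b))) (at x)"
    using bl_inner[OF has_derivative_const bl_mult[OF C.metric_derivative[OF xS] has_derivative_const]]
    by simp
  have "((\<lambda>x. J c c' x a \<bullet> (g c' (transition c c' x) *v J c c' x b)) has_derivative
      (\<lambda>h. J c c' x a \<bullet> (g c' (transition c c' x) *v J2 c c' x b h
          + frechet_derivative (g c') (at y) (J c c' x h) *v J c c' x b)
        + J2 c c' x a h \<bullet> (g c' (transition c c' x) *v J c c' x b))) (at x)"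
    by (intro bl_inner bl_mult gy J_derivative x)
  then have "((\<lambda>x. a \<bullet> (g c x *v b)) has_derivative
      (\<lambda>h. J c c' x a \<bullet> (g c' (transition c c' x) *v J2 c c' x b h
          + frechet_derivative (g c') (at y) (J c c' x h) *v J c c' x b)
        + J2 c c' x a h \<bullet> (g c' (transition c c' x) *v J c c' x b))) (at x)"
    by (rule has_derivative_transform_within_open[OF _ open_overlap[OF c c'] x]) (simp add: metric_transform)
  from fun_cong[OF has_derivative_unique[OF L this], of h]
  show ?thesis by (simp add: y_def inner_add_right)
qed

end

lemma J_inverse:
  assumes c: "c \<in> A" and c': "c' \<in> A" and q: "q \<in> fst c" "q \<in> fst c'"
  shows "J c' c (snd c' q) (J c c' (snd c q) h) = h"
proof -
  have x: "snd c q \<in> overlap c c'" and y: "snd c' q \<in> overlap c' c" using q by auto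
  have "((\<lambda>x. transition c' c (transition c c' x)) has_derivative (\<lambda>h. J c' c (snd c' q) (J c c' (snd c q) h))) (at (snd c q))"
    using has_derivative_compose[OF transition_derivative[OF c c' x], of "transition c' c" "J c' c (snd c' q)"]
      transition_derivative[OF c' c y] by (simp add: transition_coord[OF c q(1)])
  then have "((\<lambda>x. x) has_derivative (\<lambda>h. J c' c (snd c' q) (J c c' (snd c q) h))) (at (snd c q))"
    by (rule has_derivative_transform_within_open[OF _ open_overlap[OF c c'] x])
      (auto simp: transition_coord[OF c] transition_coord[OF c'])
  from fun_cong[OF has_derivative_unique[OF this has_derivative_ident]] show ?thesis by simp
qed

text \<open>The transformation law of the connection for a metric that is only once differentiable. Let
\<open>r\<close> be the difference of the two sides. Pairing \<open>r\<close> with \<open>J c c' x b\<close> in the metric of the chart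
\<open>c'\<close> and using the Euler-Lagrange identity in both charts leaves first derivatives of the
metric. The derivative of the transformation law of the metric turns those in \<open>c\<close> into those in
\<open>c'\<close> and terms with \<open>J2\<close>, which cancel by symmetry of \<open>J2\<close>. As \<open>J c c' x\<close> is onto and the
metric is nondegenerate, \<open>r = 0\<close>.\<close>

lemma connection_transform:
  assumes c: "c \<in> A" and c': "c' \<in> A" and q: "q \<in> fst c" "q \<in> fst c'"
  defines "x \<equiv> snd c q" and "y \<equiv> snd c' q"
  shows "J2 c c' x u u - J c c' x (connection_form g c x u u)
    = - connection_form g c' y (J c c' x u) (J c c' x u)"
proof -
  interpret C: lorentzian_chart g c "snd c ` fst c" z by (rule lorentzian_chart[OF c])
  interpret C': lorentzian_chart g c' "snd c' ` fst c'" z by (rule lorentzian_chart[OF c'])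
  have xS: "x \<in> snd c ` fst c" and yS: "y \<in> snd c' ` fst c'" and x: "x \<in> overlap c c'"
    and y: "transition c c' x = y" using q transition_coord[OF c q(1)] by (auto simp: x_def y_def)
  define w where "w = J c c' x u"
  define r where "r = J2 c c' x u u - J c c' x (connection_form g c x u u) + connection_form g c' y w w"
  note sym = bilinear_form_symmetric[OF C'.metric_symmetric[OF yS]]
  have orth: "J c c' x b \<bullet> (g c' y *v r) = 0" for b
  proof -
    have 1: "J c c' x b \<bullet> (g c' y *v J c c' x (connection_form g c x u u))
        = b \<bullet> (frechet_derivative (g c) (at x) u *v u) - (1 / 2) * (u \<bullet> (frechet_derivative (g c) (at x) b *v u))"
      using metric_transform[OF c c' x, of b "connection_form g c x u u"] C.euler_lagrange[OF xS, of b u] y by simp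
    have 2: "J c c' x b \<bullet> (g c' y *v connection_form g c' y w w)
        = J c c' x b \<bullet> (frechet_derivative (g c') (at y) w *v w)
          - (1 / 2) * (w \<bullet> (frechet_derivative (g c') (at y) (J c c' x b) *v w))"
      by (rule C'.euler_lagrange[OF yS])
    have 3: "b \<bullet> (frechet_derivative (g c) (at x) u *v u)
      = J2 c c' x b u \<bullet> (g c' y *v w) + J c c' x b \<bullet> (frechet_derivative (g c') (at y) w *v w)
        + J c c' x b \<bullet> (g c' y *v J2 c c' x u u)"
      using metric_derivative_transform[OF c c' x, of b u u] by (simp add: y w_def)
    have 4: "u \<bullet> (frechet_derivative (g c) (at x) b *v u)
      = 2 * (J2 c c' x b u \<bullet> (g c' y *v w)) + w \<bullet> (frechet_derivative (g c') (at y) (J c c' x b) *v w)"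
      using metric_derivative_transform[OF c c' x, of u b u] J2_symmetric[OF c c' x, of u b]
        sym[of w "J2 c c' x b u"] by (simp add: y w_def)
    have "J c c' x b \<bullet> (g c' y *v r) = J c c' x b \<bullet> (g c' y *v J2 c c' x u u)
        - J c c' x b \<bullet> (g c' y *v J c c' x (connection_form g c x u u))
        + J c c' x b \<bullet> (g c' y *v connection_form g c' y w w)"
      unfolding r_def
      by (simp add: matrix_vector_right_distrib matrix_vector_mult_diff_distrib inner_add_right inner_diff_right)
    also have "\<dots> = 0" unfolding 1 2 3 4 by (simp add: add_divide_distrib)
    finally show ?thesis .
  qed
  have "g c' y *v r = 0"
  proof -
    have "v \<bullet> (g c' y *v r) = 0" for v
      using orth[of "J c' c y v"] J_inverse[OF c' c q(2,1)] by (simp add: x_def y_def)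
    then show ?thesis by (metis inner_eq_zero_iff)
  qed
  then have "r = 0"
    using matrix_inv_mult(2)[OF C'.metric_invertible[OF yS]]
    by (metis matrix_vector_mul_assoc matrix_vector_mul_lid matrix_vector_mult_0_right)
  then show ?thesis by (simp add: r_def w_def add_eq_0_iff2 algebra_simps eq_neg_iff_add_eq_0)
qed

lemma geodesic_solution_iff_connection_form:
  "geodesic_solution A g I \<gamma> \<longleftrightarrow> continuous_on I \<gamma> \<and>
     (\<forall>c\<in>A. \<exists>u. \<forall>t\<in>I. \<gamma> t \<in> fst c \<longrightarrow>
        ((snd c \<circ> \<gamma>) has_vector_derivative u t) (at t within I) \<and>
        (u has_vector_derivative - connection_form g c (snd c (\<gamma> t)) (u t) (u t)) (at t within I))"
proof -
  have "(\<chi> \<mu>. - (\<Sum>\<alpha>\<in>UNIV. \<Sum>\<beta>\<in>UNIV. christoffel g c y \<mu> \<alpha> \<beta> * u $ \<alpha> * u $ \<beta>)) = - connection_form g c y u u" for c y u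
    by (simp add: connection_form_def vec_eq_iff)
  then show ?thesis unfolding geodesic_solution_def by simp
qed

text \<open>In another chart \<open>c'\<close> the velocity is \<open>J c c' x u\<close>. Differentiating it produces the left-hand
side of \<open>connection_transform\<close>.\<close>

lemma geodesic_solution_from_chart:
  assumes c: "c \<in> A" and cont: "continuous_on I \<gamma>" and sub: "\<gamma> ` I \<subseteq> fst c"
    and x: "\<And>t. t \<in> I \<Longrightarrow> ((snd c \<circ> \<gamma>) has_vector_derivative u t) (at t within I)"
    and u: "\<And>t. t \<in> I \<Longrightarrow> (u has_vector_derivative - connection_form g c (snd c (\<gamma> t)) (u t) (u t)) (at t within I)"
  shows "geodesic_solution A g I \<gamma>"
  unfolding geodesic_solution_iff_connection_form
proof (intro conjI ballI cont)
  fix c' assume c': "c' \<in> A"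
  \<comment> \<open>The velocity \<open>J c c' x u\<close> in the other chart, expanded in the basis so that it can be
differentiated by the product rule.\<close>
  define w where "w = (\<lambda>t. \<Sum>i\<in>UNIV. u t $ i *\<^sub>R J c c' (snd c (\<gamma> t)) (axis i 1))"
  have "((snd c' \<circ> \<gamma>) has_vector_derivative w t) (at t within I) \<and>
        (w has_vector_derivative - connection_form g c' (snd c' (\<gamma> t)) (w t) (w t)) (at t within I)"
    if t: "t \<in> I" "\<gamma> t \<in> fst c'" for t
  proof
    have tc: "\<gamma> t \<in> fst c" using t sub by auto
    have ov: "snd c (\<gamma> t) \<in> overlap c c'" using tc t by auto
    have w: "w t = J c c' (snd c (\<gamma> t)) (u t)" unfolding w_def by (rule J_expand[OF c c' ov, symmetric])
    have "((transition c c' \<circ> (snd c \<circ> \<gamma>)) has_vector_derivative J c c' (snd c (\<gamma> t)) (u t)) (at t within I)"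
      by (rule vector_derivative_diff_chain_within[OF x[OF t(1)]])
        (use transition_derivative[OF c c' ov] in \<open>simp add: has_derivative_at_withinI\<close>)
    then show "((snd c' \<circ> \<gamma>) has_vector_derivative w t) (at t within I)"
      unfolding w
      by (rule has_vector_derivative_transform[OF t(1), rotated]) (use sub in \<open>auto simp: transition_coord[OF c]\<close>)
    have Ji: "((\<lambda>t. J c c' (snd c (\<gamma> t)) (axis i 1)) has_vector_derivative
        J2 c c' (snd c (\<gamma> t)) (axis i 1) (u t)) (at t within I)" for i
      using vector_derivative_diff_chain_within[OF x[OF t(1)],
          of "\<lambda>y. J c c' y (axis i 1)" "J2 c c' (snd c (\<gamma> t)) (axis i 1)"] J_derivative[OF c c' ov]
      by (simp add: has_derivative_at_withinI o_def)
    have ui: "((\<lambda>t. u t $ i) has_vector_derivative (- connection_form g c (snd c (\<gamma> t)) (u t) (u t)) $ i) (at t within I)" for i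
      by (rule bounded_linear.has_vector_derivative[OF bounded_linear_vec_nth u[OF t(1)]])
    let ?a = "- connection_form g c (snd c (\<gamma> t)) (u t) (u t)"
    have "(w has_vector_derivative (\<Sum>i\<in>UNIV. u t $ i *\<^sub>R J2 c c' (snd c (\<gamma> t)) (axis i 1) (u t)
        + ?a $ i *\<^sub>R J c c' (snd c (\<gamma> t)) (axis i 1))) (at t within I)"
      unfolding w_def
      by (intro has_vector_derivative_sum bounded_bilinear.has_vector_derivative[OF bounded_bilinear_scaleR] Ji ui)
    also have "(\<Sum>i\<in>UNIV. u t $ i *\<^sub>R J2 c c' (snd c (\<gamma> t)) (axis i 1) (u t)
        + ?a $ i *\<^sub>R J c c' (snd c (\<gamma> t)) (axis i 1))
        = J2 c c' (snd c (\<gamma> t)) (u t) (u t) + J c c' (snd c (\<gamma> t)) ?a"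
      unfolding sum.distrib J_expand[OF c c' ov, of ?a] J2_expand[OF c c' ov, of "u t"] ..
    also have "\<dots> = - connection_form g c' (snd c' (\<gamma> t)) (w t) (w t)"
      unfolding w using connection_transform[OF c c' tc t(2), of "u t"]
      by (simp add: linear_neg[OF J_linear[OF c c' ov]])
    finally show "(w has_vector_derivative - connection_form g c' (snd c' (\<gamma> t)) (w t) (w t)) (at t within I)" .
  qed
  then show "\<exists>u. \<forall>t\<in>I. \<gamma> t \<in> fst c' \<longrightarrow>
        ((snd c' \<circ> \<gamma>) has_vector_derivative u t) (at t within I) \<and>
        (u has_vector_derivative - connection_form g c' (snd c' (\<gamma> t)) (u t) (u t)) (at t within I)"
    by blast
qed

end

section \<open>Uniqueness of geodesics and the exponential map\<close>

text \<open>The geodesic equation as a first order system for position and velocity. Its right-hand side is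
quadratic in the velocity, hence Lipschitz only on bounded sets.\<close>

lemma (in lorentzian_chart) spray_field_locally_lipschitz:
  assumes y: "y \<in> S"
  obtains e L where "e > 0" "L-lipschitz_on (ball (y, u) e) (\<lambda>(x, u). (u, - connection_form g c x u u))"
proof -
  obtain e L where e: "e > 0" "0 \<le> L" "ball y e \<subseteq> S"
    and lip: "\<And>x x' u v. x \<in> ball y e \<Longrightarrow> x' \<in> ball y e \<Longrightarrow>
      norm (connection_form g c x u v - connection_form g c x' u v) \<le> L * norm (x - x') * norm u * norm v"
    using connection_form_locally_lipschitz[OF y] by metis
  obtain K where K: "K > 0" "\<And>a b. norm (connection_form g c y a b) \<le> K * norm a * norm b"
    using bilinear_bounded_pos[OF bilinear_connection_form[of g c y]] by metis
  define N where "N = K + L * e"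
  have bound: "norm (connection_form g c x a b) \<le> N * norm a * norm b" if x: "x \<in> ball y e" for x a b
  proof -
    have "norm (connection_form g c x a b - connection_form g c y a b) \<le> L * norm (x - y) * norm a * norm b"
      using lip x e(1) by simp
    also have "\<dots> \<le> L * e * norm a * norm b"
      by (intro mult_right_mono mult_left_mono) (use x e in \<open>auto simp: dist_norm norm_minus_commute\<close>)
    finally show ?thesis
      using K(2)[of a b] norm_triangle_ineq2[of "connection_form g c x a b" "connection_form g c y a b"]
      by (simp add: N_def algebra_simps)
  qed
  have N: "0 \<le> N" using K e by (simp add: N_def)
  define M where "M = norm u + 1"
  have M: "0 \<le> M" by (simp add: M_def)
  define r where "r = min e 1"
  have "(1 + (L * M\<^sup>2 + 2 * N * M))-lipschitz_on (ball (y, u) r) (\<lambda>(x, u). (u, - connection_form g c x u u))"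
  proof (rule lipschitz_onI)
    fix w w' assume w: "w \<in> ball (y, u) r" and w': "w' \<in> ball (y, u) r"
    obtain x a x' a' where xa: "w = (x, a)" "w' = (x', a')" by fastforce
    have near: "b \<in> ball y e \<and> norm d \<le> M" if "(b, d) \<in> ball (y, u) r" for b d
    proof -
      have "dist y b < r" "dist u d < r"
        using that dist_fst_le[of "(y, u)" "(b, d)"] dist_snd_le[of "(y, u)" "(b, d)"] by auto
      then show ?thesis using norm_triangle_ineq2[of d u] by (auto simp: r_def M_def dist_norm norm_minus_commute)
    qed
    have x: "x \<in> ball y e" "norm a \<le> M" and x': "x' \<in> ball y e" "norm a' \<le> M"
      using near w w' by (auto simp: xa)
    have d: "norm (x - x') \<le> dist w w'" "norm (a - a') \<le> dist w w'"
      using dist_fst_le[of w w'] dist_snd_le[of w w'] by (auto simp: xa dist_norm)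
    have "connection_form g c x a a - connection_form g c x' a' a'
        = (connection_form g c x a a - connection_form g c x' a a)
          + (connection_form g c x' (a - a') a + connection_form g c x' a' (a - a'))"
      using bilinear_connection_form[of g c x'] by (simp add: bilinear_lsub bilinear_rsub)
    also have "norm \<dots> \<le> L * norm (x - x') * norm a * norm a
        + (N * norm (a - a') * norm a + N * norm a' * norm (a - a'))"
      by (intro norm_triangle_le add_mono lip bound order_trans[OF norm_triangle_ineq] x x')
    also have "\<dots> \<le> L * dist w w' * M * M + (N * dist w w' * M + N * M * dist w w')"
      by (intro add_mono mult_mono d x x' order_refl) (use e N M in auto)
    finally have "norm (connection_form g c x a a - connection_form g c x' a' a') \<le> (L * M\<^sup>2 + 2 * N * M) * dist w w'"
      by (simp add: power2_eq_square algebra_simps)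
    moreover have "dist (a, - connection_form g c x a a) (a', - connection_form g c x' a' a')
        \<le> norm (a - a') + norm (connection_form g c x a a - connection_form g c x' a' a')"
      unfolding dist_Pair_Pair
      by (rule order_trans[OF sqrt_sum_squares_le_sum]) (auto simp: dist_norm norm_minus_commute)
    ultimately show "dist ((\<lambda>(x, u). (u, - connection_form g c x u u)) w) ((\<lambda>(x, u). (u, - connection_form g c x u u)) w')
        \<le> (1 + (L * M\<^sup>2 + 2 * N * M)) * dist w w'"
      using d(2) by (simp add: xa distrib_right)
  qed (use e N M in auto)
  then show ?thesis using e by (intro that[of r]) (auto simp: r_def)
qed

lemma continuous_on_stays_open:
  fixes \<gamma> :: "real \<Rightarrow> 'a::topological_space"
  assumes "continuous_on I \<gamma>" "open V" "m \<in> I" "\<gamma> m \<in> V"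
  obtains d where "d > 0" "\<And>t. t \<in> I \<Longrightarrow> \<bar>t - m\<bar> < d \<Longrightarrow> \<gamma> t \<in> V"
proof -
  have "openin (top_of_set I) (I \<inter> \<gamma> -` V)" by (rule continuous_openin_preimage_gen[OF assms(1,2)])
  then obtain d where d: "d > 0" "ball m d \<inter> I \<subseteq> I \<inter> \<gamma> -` V"
    using assms unfolding openin_contains_ball by blast
  show ?thesis by (rule that[OF d(1)]) (use d(2) in \<open>auto simp: dist_real_def abs_minus_commute subset_iff\<close>)
qed

lemma agree_at_endpoint:
  fixes \<gamma> \<gamma>' :: "real \<Rightarrow> 'a::t2_space"
  assumes "continuous_on {0..1} \<gamma>" "continuous_on {0..1} \<gamma>'" "0 < m" "m \<le> 1"
    and eq: "\<And>s. 0 < s \<Longrightarrow> s < m \<Longrightarrow> \<gamma> s = \<gamma>' s"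
  shows "\<gamma> m = \<gamma>' m"
proof (rule tendsto_unique)
  let ?F = "at m within {0<..<m}"
  show "?F \<noteq> bot" using islimpt_greaterThanLessThan2[OF \<open>0 < m\<close>] trivial_limit_within by blast
  have sub: "(\<eta> \<longlongrightarrow> \<eta> m) ?F" if "continuous_on {0..1} \<eta>" for \<eta> :: "real \<Rightarrow> 'a"
    using that assms(3,4) unfolding continuous_on_def
    by (meson atLeastAtMost_iff greaterThanLessThan_subseteq_atLeastAtMost_iff less_eq_real_def order_refl tendsto_within_subset)
  show "(\<gamma> \<longlongrightarrow> \<gamma> m) ?F" by (rule sub[OF assms(1)])
  have "(\<gamma>' \<longlongrightarrow> \<gamma>' m) ?F" by (rule sub[OF assms(2)])
  moreover have "\<forall>\<^sub>F s in ?F. \<gamma>' s = \<gamma> s" by (auto simp: eventually_at_filter eq)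
  ultimately show "(\<gamma> \<longlongrightarrow> \<gamma>' m) ?F" using tendsto_cong by blast
qed

context lorentzian_manifold
begin

text \<open>Let \<open>[0, m]\<close> be the largest interval on which the geodesics agree. In a chart around their common
position at time \<open>m\<close> their velocities agree too: for \<open>m > 0\<close> as left derivatives of the same
curve, for \<open>m = 0\<close> by assumption. If \<open>m < 1\<close>, local uniqueness in this chart would extend the
interval. The geodesics may leave the chart \<open>c0\<close>, so a new chart is needed at every such time.\<close>

lemma geodesic_from_unique:
  assumes c0: "c0 \<in> A" "q \<in> fst c0"
    and \<gamma>: "geodesic_from A g c0 q v \<gamma>" and \<gamma>': "geodesic_from A g c0 q v \<gamma>'"
    and t: "t \<in> {0..1}"
  shows "\<gamma> t = \<gamma>' t"
proof -
  have cont: "continuous_on {0..1} \<gamma>" "continuous_on {0..1} \<gamma>'"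
    and sol: "geodesic_solution A g {0..1} \<gamma>" "geodesic_solution A g {0..1} \<gamma>'"
    and init: "\<gamma> 0 = q" "\<gamma>' 0 = q"
    and vel: "((snd c0 \<circ> \<gamma>) has_vector_derivative v) (at 0 within {0..1})"
      "((snd c0 \<circ> \<gamma>') has_vector_derivative v) (at 0 within {0..1})"
    using \<gamma> \<gamma>' by (auto simp: geodesic_from_def geodesic_solution_def)
  define T where "T = {t \<in> {0..1}. \<forall>s\<in>{0..t}. \<gamma> s = \<gamma>' s}"
  define m where "m = Sup T"
  have T0: "0 \<in> T" using init by (auto simp: T_def)
  have bdd: "bdd_above T" by (rule bdd_aboveI[of _ 1]) (auto simp: T_def)
  have m01: "0 \<le> m" "m \<le> 1"
    unfolding m_def using cSup_upper[OF T0 bdd] by (auto intro!: cSup_least simp: T_def init)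
  have below: "\<gamma> s = \<gamma>' s" if s: "0 \<le> s" "s < m" for s
  proof -
    have "T \<noteq> {}" using T0 by blast
    then obtain t where "t \<in> T" "s < t"
      using s(2) less_cSup_iff[OF _ bdd, of s] unfolding m_def by metis
    then show ?thesis using that by (auto simp: T_def)
  qed
  have at_m: "\<gamma> m = \<gamma>' m"
  proof (cases "m = 0")
    case False
    with m01 have "0 < m" by simp
    from agree_at_endpoint[OF cont this m01(2)] below show ?thesis by simp
  qed (simp add: init)
  have upto: "\<gamma> s = \<gamma>' s" if "s \<in> {0..m}" for s
    using that below at_m by (cases "s = m") auto
  have "m = 1"
  proof (rule ccontr)
    assume "m \<noteq> 1"
    then have m1: "m < 1" using m01 by simp
    obtain c where c: "c \<in> A" "\<gamma> m \<in> fst c" "m = 0 \<Longrightarrow> c = c0"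
    proof (cases "m = 0")
      case True then show ?thesis using that[of c0] c0 init by simp
    next
      case False then show ?thesis using charts_cover[of "\<gamma> m"] that by metis
    qed
    interpret C: lorentzian_chart g c "snd c ` fst c" z by (rule lorentzian_chart[OF c(1)])
    obtain u where u: "\<And>t. t \<in> {0..1} \<Longrightarrow> \<gamma> t \<in> fst c \<Longrightarrow>
        ((snd c \<circ> \<gamma>) has_vector_derivative u t) (at t within {0..1}) \<and>
        (u has_vector_derivative - connection_form g c (snd c (\<gamma> t)) (u t) (u t)) (at t within {0..1})"
      using sol(1) c(1) unfolding geodesic_solution_iff_connection_form by blast
    obtain u' where u': "\<And>t. t \<in> {0..1} \<Longrightarrow> \<gamma>' t \<in> fst c \<Longrightarrow>
        ((snd c \<circ> \<gamma>') has_vector_derivative u' t) (at t within {0..1}) \<and>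
        (u' has_vector_derivative - connection_form g c (snd c (\<gamma>' t)) (u' t) (u' t)) (at t within {0..1})"
      using sol(2) c(1) unfolding geodesic_solution_iff_connection_form by blast
    have um: "u m = u' m"
    proof (cases "m = 0")
      case True
      have "u m = v" "u' m = v"
        using u[of 0] u'[of 0] vel c(2) at_m c(3)[OF True] True m01
        by (auto intro: vector_derivative_unique_within_closed_interval[of 0 1 0])
      then show ?thesis by simp
    next
      case False
      then have m0: "0 < m" using m01 by simp
      have d: "((snd c \<circ> \<gamma>) has_vector_derivative u m) (at m within {0..m})"
        "((snd c \<circ> \<gamma>') has_vector_derivative u' m) (at m within {0..m})"
        using u[of m] u'[of m] c(2) at_m m01 has_vector_derivative_within_subset[of _ _ m "{0..1}" "{0..m}"] by auto
      have "((snd c \<circ> \<gamma>) has_vector_derivative u' m) (at m within {0..m})"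
        by (rule has_vector_derivative_transform[OF _ _ d(2)]) (use m0 upto in auto)
      then show ?thesis
        using vector_derivative_unique_within_closed_interval[of 0 m m "snd c \<circ> \<gamma>" "u m" "u' m"] d(1) m0 by auto
    qed
    obtain d where d: "d > 0" "\<And>t. t \<in> {0..1} \<Longrightarrow> \<bar>t - m\<bar> < d \<Longrightarrow> \<gamma> t \<in> fst c"
      using continuous_on_stays_open[OF cont(1) chart(1)[OF c(1)], of m] c(2) m01 by auto
    obtain d' where d': "d' > 0" "\<And>t. t \<in> {0..1} \<Longrightarrow> \<bar>t - m\<bar> < d' \<Longrightarrow> \<gamma>' t \<in> fst c"
      using continuous_on_stays_open[OF cont(2) chart(1)[OF c(1)], of m] c(2) at_m m01 by auto
    define b where "b = min 1 (m + min d d' / 2)"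
    have b: "m < b" "b \<le> 1" using m1 d d' by (auto simp: b_def)
    have in_c: "\<gamma> t \<in> fst c" "\<gamma>' t \<in> fst c" "t \<in> {0..1}" if "t \<in> {m..b}" for t
      using that d(2)[of t] d'(2)[of t] d(1) d'(1) m01 by (auto simp: b_def min_def split: if_splits)
    define F where "F = (\<lambda>(x, u). (u, - connection_form g c x u u))"
    have mS: "snd c (\<gamma> m) \<in> snd c ` fst c" using c(2) by auto
    obtain e L where e: "e > 0" "L-lipschitz_on (ball (snd c (\<gamma> m), u m) e) F"
      unfolding F_def by (rule C.spray_field_locally_lipschitz[OF mS, of "u m"])
    have sub: "{m..b} \<subseteq> {0..1}" using m01 b by auto
    obtain h where h: "m < h" "h \<le> b"
      and eq: "\<And>t. t \<in> {m..h} \<Longrightarrow> (snd c (\<gamma> t), u t) = (snd c (\<gamma>' t), u' t)"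
    proof (rule ode_solution_unique_right[of m b "\<lambda>t. (snd c (\<gamma> t), u t)" F "\<lambda>t. (snd c (\<gamma>' t), u' t)" e L])
      show "((\<lambda>t. (snd c (\<gamma> t), u t)) has_vector_derivative F (snd c (\<gamma> t), u t)) (at t within {m..b})"
        if t: "t \<in> {m..b}" for t
        unfolding F_def prod.case
        using u[OF in_c(3,1)[OF t]] has_vector_derivative_within_subset[OF _ sub]
        by (intro has_vector_derivative_Pair) (auto simp: o_def)
      show "((\<lambda>t. (snd c (\<gamma>' t), u' t)) has_vector_derivative F (snd c (\<gamma>' t), u' t)) (at t within {m..b})"
        if t: "t \<in> {m..b}" for t
        unfolding F_def prod.case
        using u'[OF in_c(3,2)[OF t]] has_vector_derivative_within_subset[OF _ sub]
        by (intro has_vector_derivative_Pair) (auto simp: o_def)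
    qed (use b e um at_m that in auto)
    have "\<gamma> s = \<gamma>' s" if "s \<in> {0..h}" for s
    proof (cases "s \<le> m")
      case True then show ?thesis using upto that by auto
    next
      case False
      then have "s \<in> {m..h}" "s \<in> {m..b}" using that h by auto
      then show ?thesis using eq[of s] in_c[of s] inj_onD[OF chart(5)[OF c(1)]] by auto
    qed
    then have "h \<in> T" using h b m01 by (auto simp: T_def)
    then have "h \<le> m" unfolding m_def by (rule cSup_upper[OF _ bdd])
    then show False using h by simp
  qed
  then show ?thesis using upto t by simp
qed

lemma exp_map_eq:
  assumes c: "c \<in> A" "q \<in> fst c" and \<gamma>: "geodesic_from A g c q v \<gamma>"
  shows "exp_map A g c q v = \<gamma> 1"
  unfolding exp_map_def
proof (rule the_equality)
  show "\<exists>\<gamma>'. geodesic_from A g c q v \<gamma>' \<and> \<gamma>' 1 = \<gamma> 1" using \<gamma> by blast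
  show "r = \<gamma> 1" if "\<exists>\<gamma>'. geodesic_from A g c q v \<gamma>' \<and> \<gamma>' 1 = r" for r
    using that geodesic_from_unique[OF c _ \<gamma>, of _ 1] by auto
qed

lemma geodesic_from_scale:
  assumes \<gamma>: "geodesic_from A g c q v \<gamma>" and s: "s \<in> {0..1}"
  shows "geodesic_from A g c q (s *\<^sub>R v) (\<lambda>t. \<gamma> (s * t))"
proof -
  have st: "(\<lambda>t. s * t) ` {0..1} \<subseteq> {0..1}" using s by (auto simp: mult_le_one)
  have chain: "((\<lambda>t. f (s * t)) has_vector_derivative s *\<^sub>R f') (at t within {0..1})"
    if "(f has_vector_derivative f') (at (s * t) within {0..1})" for f :: "real \<Rightarrow> real ^ 'n" and f' t
  proof -
    have "((\<lambda>t. s * t) has_vector_derivative s) (at t within {0..1})"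
      by (auto intro!: derivative_eq_intros)
    from vector_diff_chain_within[OF this has_vector_derivative_within_subset[OF that st]]
    show ?thesis by (simp add: o_def)
  qed
  have sol: "geodesic_solution A g {0..1} \<gamma>" and init: "\<gamma> 0 = q"
    and vel: "((snd c \<circ> \<gamma>) has_vector_derivative v) (at 0 within {0..1})"
    using \<gamma> by (auto simp: geodesic_from_def)
  have "geodesic_solution A g {0..1} (\<lambda>t. \<gamma> (s * t))"
    unfolding geodesic_solution_iff_connection_form
  proof (intro conjI ballI)
    show "continuous_on {0..1} (\<lambda>t. \<gamma> (s * t))"
    proof (rule continuous_on_compose2[OF _ _ st])
      show "continuous_on {0..1} \<gamma>" using sol by (simp add: geodesic_solution_def)
    qed (intro continuous_intros)
    fix c assume c: "c \<in> A"
    obtain u where u: "\<And>t. t \<in> {0..1} \<Longrightarrow> \<gamma> t \<in> fst c \<Longrightarrow>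
        ((snd c \<circ> \<gamma>) has_vector_derivative u t) (at t within {0..1}) \<and>
        (u has_vector_derivative - connection_form g c (snd c (\<gamma> t)) (u t) (u t)) (at t within {0..1})"
      using sol c unfolding geodesic_solution_iff_connection_form by blast
    show "\<exists>w. \<forall>t\<in>{0..1}. \<gamma> (s * t) \<in> fst c \<longrightarrow>
        ((snd c \<circ> (\<lambda>t. \<gamma> (s * t))) has_vector_derivative w t) (at t within {0..1}) \<and>
        (w has_vector_derivative - connection_form g c (snd c (\<gamma> (s * t))) (w t) (w t)) (at t within {0..1})"
    proof (intro exI ballI impI conjI)
      fix t assume t: "t \<in> {0..(1::real)}" and tc: "\<gamma> (s * t) \<in> fst c"
      have ts: "s * t \<in> {0..1}" using st t by blast
      show "((snd c \<circ> (\<lambda>t. \<gamma> (s * t))) has_vector_derivative s *\<^sub>R u (s * t)) (at t within {0..1})"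
        using chain[of "snd c \<circ> \<gamma>"] u[OF ts tc] by (simp add: o_def)
      have "((\<lambda>t. s *\<^sub>R u (s * t)) has_vector_derivative
          s *\<^sub>R (s *\<^sub>R (- connection_form g c (snd c (\<gamma> (s * t))) (u (s * t)) (u (s * t))))) (at t within {0..1})"
        using u[OF ts tc] by (intro bounded_linear.has_vector_derivative[OF bounded_linear_scaleR_right] chain) blast
      then show "((\<lambda>t. s *\<^sub>R u (s * t)) has_vector_derivative
          - connection_form g c (snd c (\<gamma> (s * t))) (s *\<^sub>R u (s * t)) (s *\<^sub>R u (s * t))) (at t within {0..1})"
        by (simp add: bilinear_lmul[OF bilinear_connection_form] bilinear_rmul[OF bilinear_connection_form])
    qed
  qed
  moreover have "((snd c \<circ> (\<lambda>t. \<gamma> (s * t))) has_vector_derivative s *\<^sub>R v) (at 0 within {0..1})"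
    using chain[of "snd c \<circ> \<gamma>" v 0] vel by (simp add: o_def)
  ultimately show ?thesis using init by (simp add: geodesic_from_def)
qed

lemma exp_map_scale:
  assumes c: "c \<in> A" "q \<in> fst c" and \<gamma>: "geodesic_from A g c q v \<gamma>" and s: "s \<in> {0..1}"
  shows "exp_map A g c q (s *\<^sub>R v) = \<gamma> s"
  using exp_map_eq[OF c geodesic_from_scale[OF \<gamma> s]] by simp

end

section \<open>Small coordinate balls are convex normal\<close>

lemma locally_lipschitz_on_transform:
  assumes "locally_lipschitz_on S f" "\<And>x. x \<in> S \<Longrightarrow> g x = f x"
  shows "locally_lipschitz_on S g"
  unfolding locally_lipschitz_on_def
proof
  fix x assume "x \<in> S"
  with assms(1) obtain e L where "e > 0" "L-lipschitz_on (ball x e \<inter> S) f"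
    unfolding locally_lipschitz_on_def by blast
  moreover from this(2) have "L-lipschitz_on (ball x e \<inter> S) g"
    by (rule lipschitz_on_transform) (use assms(2) in auto)
  ultimately show "\<exists>e>0. \<exists>L. L-lipschitz_on (ball x e \<inter> S) g" by blast
qed

context flat_spray
begin

text \<open>The initial velocity differs from the chord by a map with Lipschitz constant less than \<open>1 / 2\<close>.\<close>

lemma initial_velocity_bilipschitz:
  assumes q: "q \<in> ball p \<delta>" and r: "r \<in> ball p \<delta>" "r' \<in> ball p \<delta>"
  shows "norm (cvel q r 0 - cvel q r' 0) \<le> 2 * norm (r - r')"
    and "norm (r - r') \<le> 2 * norm (cvel q r 0 - cvel q r' 0)"
proof -
  note c = connecting[OF q r(1)] and c' = connecting[OF q r(2)]
  note cmp = spray_curves_compare[OF c(1) c'(1), of 0, unfolded c(2,3) c'(2,3)]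
  show "norm (cvel q r 0 - cvel q r' 0) \<le> 2 * norm (r - r')" using cmp(1) by simp
  have "48 * (\<Lambda> * \<delta>\<^sup>2) * norm (r - r') \<le> (1/2) * norm (r - r')"
    by (intro mult_right_mono) (use small in auto)
  moreover have "norm (cvel q r 0 - cvel q r' 0 - (r - r')) \<le> 48 * (\<Lambda> * \<delta>\<^sup>2) * norm (r - r')"
    using cmp(3) by simp
  ultimately show "norm (r - r') \<le> 2 * norm (cvel q r 0 - cvel q r' 0)"
    using norm_triangle_ineq2[of "r - r'" "cvel q r 0 - cvel q r' 0"]
    by (simp add: norm_minus_commute)
qed

lemma spray_curve_scale:
  assumes xu: "spray_curve x u" and s: "s \<in> {0..1}"
  shows "spray_curve (\<lambda>t. x (s * t)) (\<lambda>t. s *\<^sub>R u (s * t))"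
  unfolding spray_curve_def
proof (intro ballI conjI)
  fix t :: real assume t: "t \<in> {0..1}"
  have st: "(\<lambda>t. s * t) ` {0..1} \<subseteq> {0..1}" using s by (auto simp: mult_le_one)
  then have ts: "s * t \<in> {0..1}" using t by blast
  have chain: "((\<lambda>t. f (s * t)) has_vector_derivative s *\<^sub>R f') (at t within {0..1})"
    if "(f has_vector_derivative f') (at (s * t) within {0..1})" for f :: "real \<Rightarrow> 'a" and f'
  proof -
    have "((\<lambda>t. s * t) has_vector_derivative s) (at t within {0..1})"
      by (auto intro!: derivative_eq_intros)
    from vector_diff_chain_within[OF this has_vector_derivative_within_subset[OF that st]]
    show ?thesis by (simp add: o_def)
  qed
  show "x (s * t) \<in> ball p \<delta>" by (rule spray_curveD(1)[OF xu ts])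
  show "((\<lambda>t. x (s * t)) has_vector_derivative s *\<^sub>R u (s * t)) (at t within {0..1})"
    by (rule chain[OF spray_curveD(2)[OF xu ts]])
  have "((\<lambda>t. s *\<^sub>R u (s * t)) has_vector_derivative
      s *\<^sub>R (s *\<^sub>R (- \<Gamma> (x (s * t)) (u (s * t)) (u (s * t))))) (at t within {0..1})"
    by (intro bounded_linear.has_vector_derivative[OF bounded_linear_scaleR_right] chain spray_curveD(3)[OF xu ts])
  then show "((\<lambda>t. s *\<^sub>R u (s * t)) has_vector_derivative
      - \<Gamma> (x (s * t)) (s *\<^sub>R u (s * t)) (s *\<^sub>R u (s * t))) (at t within {0..1})"
    by (simp add: bilinear_lmul[OF bilinear_\<Gamma>] bilinear_rmul[OF bilinear_\<Gamma>])
qed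

lemma initial_velocity_scale:
  assumes "q \<in> ball p \<delta>" "r \<in> ball p \<delta>" and s: "s \<in> {0..1}"
  shows "cvel q (cpos q r s) 0 = s *\<^sub>R cvel q r 0"
proof -
  note c = connecting[OF assms(1,2)]
  show ?thesis
    using connecting_unique(2)[OF spray_curve_scale[OF c(1) s], of q "cpos q r s" 0] c by simp
qed

end

locale normal_ball = lorentzian_manifold A g z +
  metric_spray "connection_form g c\<^sub>0" "snd c\<^sub>0 p" \<delta> \<Lambda> "g c\<^sub>0" "\<lambda>x. frechet_derivative (g c\<^sub>0) (at x)" B
  for A :: "('m::t2_space, 'n::finite) chart set" and g z c\<^sub>0 p \<delta> \<Lambda> B +
  assumes c\<^sub>0: "c\<^sub>0 \<in> A"
    and ball_in_chart: "ball (snd c\<^sub>0 p) \<delta> \<subseteq> snd c\<^sub>0 ` fst c\<^sub>0"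
begin

abbreviation "\<phi> \<equiv> snd c\<^sub>0"
abbreviation "\<psi> \<equiv> coord_inv c\<^sub>0"
abbreviation "C \<equiv> coordinate_ball c\<^sub>0 p \<delta>"

lemma C_iff: "q \<in> C \<longleftrightarrow> q \<in> fst c\<^sub>0 \<and> \<phi> q \<in> ball (\<phi> p) \<delta>"
  by (auto simp: coordinate_ball_def dist_commute)

lemma CD: "q \<in> C \<Longrightarrow> q \<in> fst c\<^sub>0" "q \<in> C \<Longrightarrow> \<phi> q \<in> ball (\<phi> p) \<delta>" "q \<in> C \<Longrightarrow> \<psi> (\<phi> q) = q"
  using C_iff chart(6)[OF c\<^sub>0] by auto

lemma \<psi>: "y \<in> ball (\<phi> p) \<delta> \<Longrightarrow> \<psi> y \<in> C" "y \<in> ball (\<phi> p) \<delta> \<Longrightarrow> \<phi> (\<psi> y) = y"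
proof -
  assume y: "y \<in> ball (\<phi> p) \<delta>"
  then obtain q where "q \<in> fst c\<^sub>0" "y = \<phi> q" using ball_in_chart by blast
  with y show "\<psi> y \<in> C" "\<phi> (\<psi> y) = y" using chart(6)[OF c\<^sub>0] by (auto simp: C_iff)
qed

lemma image_C: "\<phi> ` C = ball (\<phi> p) \<delta>"
  using CD(2) \<psi> by (metis image_eqI image_subsetI subsetI subset_antisym)

lemma open_C: "open C"
proof -
  have "C = fst c\<^sub>0 \<inter> \<phi> -` ball (\<phi> p) \<delta>" using C_iff by blast
  then show ?thesis
    using continuous_open_preimage[OF chart(3)[OF c\<^sub>0] chart(1)[OF c\<^sub>0] open_ball] by simp
qed

lemma spray_curve_imp_geodesic_solution:
  assumes xu: "spray_curve x u"
  shows "geodesic_solution A g {0..1} (\<lambda>t. \<psi> (x t))"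
proof -
  have eq: "\<phi> (\<psi> (x t)) = x t" if "t \<in> {0..1}" for t by (rule \<psi>(2)[OF spray_curveD(1)[OF xu that]])
  show ?thesis
  proof (rule geodesic_solution_from_chart[OF c\<^sub>0, of _ _ u])
    have "continuous_on {0..1} x"
      unfolding continuous_on_eq_continuous_within
      using spray_curveD(2)[OF xu] has_vector_derivative_continuous by blast
    then show "continuous_on {0..1} (\<lambda>t. \<psi> (x t))"
      by (rule continuous_on_compose2[OF chart(4)[OF c\<^sub>0]])
        (use spray_curveD(1)[OF xu] ball_in_chart in blast)
    show "(\<lambda>t. \<psi> (x t)) ` {0..1} \<subseteq> fst c\<^sub>0"
      using \<psi>(1) CD(1) spray_curveD(1)[OF xu] by blast
    fix t :: real assume t: "t \<in> {0..1}"
    show "(\<phi> \<circ> (\<lambda>t. \<psi> (x t)) has_vector_derivative u t) (at t within {0..1})"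
      by (rule has_vector_derivative_transform[OF t _ spray_curveD(2)[OF xu t]]) (simp add: eq)
    show "(u has_vector_derivative - connection_form g c\<^sub>0 (\<phi> (\<psi> (x t))) (u t) (u t)) (at t within {0..1})"
      unfolding eq[OF t] by (rule spray_curveD(3)[OF xu t])
  qed
qed

lemma geodesic_solution_imp_spray_curve:
  assumes \<gamma>: "geodesic_solution A g {0..1} \<gamma>" and sub: "\<gamma> ` {0..1} \<subseteq> C"
  obtains u where "spray_curve (\<phi> \<circ> \<gamma>) u"
proof -
  obtain u where u: "\<And>t. t \<in> {0..1} \<Longrightarrow> \<gamma> t \<in> fst c\<^sub>0 \<Longrightarrow>
      ((\<phi> \<circ> \<gamma>) has_vector_derivative u t) (at t within {0..1}) \<and>
      (u has_vector_derivative - connection_form g c\<^sub>0 (\<phi> (\<gamma> t)) (u t) (u t)) (at t within {0..1})"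
    using \<gamma> c\<^sub>0 unfolding geodesic_solution_iff_connection_form by blast
  have "spray_curve (\<phi> \<circ> \<gamma>) u"
    unfolding spray_curve_def
  proof (intro ballI)
    fix t :: real assume t: "t \<in> {0..1}"
    then have "\<gamma> t \<in> C" using sub by blast
    then show "(\<phi> \<circ> \<gamma>) t \<in> ball (\<phi> p) \<delta> \<and> ((\<phi> \<circ> \<gamma>) has_vector_derivative u t) (at t within {0..1}) \<and>
      (u has_vector_derivative - connection_form g c\<^sub>0 ((\<phi> \<circ> \<gamma>) t) (u t) (u t)) (at t within {0..1})"
      using u[OF t] CD by simp
  qed
  then show ?thesis by (rule that)
qed

text \<open>The inverse of the exponential map at \<open>q\<close>, with the tangent space at \<open>q\<close> represented through the
chart \<open>c\<close>.\<close>

definition normal_coords :: "('m, 'n) chart \<Rightarrow> 'm \<Rightarrow> 'm \<Rightarrow> real ^ 'n" where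
  "normal_coords c q r = J c\<^sub>0 c (\<phi> q) (cvel (\<phi> q) (\<phi> r) 0)"

context
  fixes c q
  assumes c: "c \<in> A" and q: "q \<in> C" "q \<in> fst c"
begin

lemma q_overlap: "\<phi> q \<in> overlap c\<^sub>0 c" using q CD(1) by blast

lemma geodesic_from_connecting:
  assumes r: "r \<in> C"
  shows "geodesic_from A g c q (normal_coords c q r) (\<lambda>t. \<psi> (cpos (\<phi> q) (\<phi> r) t))"
proof -
  note xu = connecting[OF CD(2)[OF q(1)] CD(2)[OF r]]
  have 0: "(0::real) \<in> {0..1}" by simp
  have J: "(transition c\<^sub>0 c has_derivative J c\<^sub>0 c (\<phi> q)) (at (cpos (\<phi> q) (\<phi> r) 0) within cpos (\<phi> q) (\<phi> r) ` {0..1})"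
    using transition_derivative[OF c\<^sub>0 c q_overlap] xu(2) by (simp add: has_derivative_at_withinI)
  have eq: "snd c (\<psi> (cpos (\<phi> q) (\<phi> r) t)) = transition c\<^sub>0 c (cpos (\<phi> q) (\<phi> r) t)" if t: "t \<in> {0..1}" for t
    using transition_coord[OF c\<^sub>0, of "\<psi> (cpos (\<phi> q) (\<phi> r) t)" c] \<psi>[OF spray_curveD(1)[OF xu(1) t]] CD(1) by simp
  have "((snd c \<circ> (\<lambda>t. \<psi> (cpos (\<phi> q) (\<phi> r) t))) has_vector_derivative normal_coords c q r) (at 0 within {0..1})"
    unfolding normal_coords_def
    by (rule has_vector_derivative_transform[OF 0 _ vector_derivative_diff_chain_within[OF spray_curveD(2)[OF xu(1) 0] J]])
      (simp add: eq)
  then show ?thesis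
    using spray_curve_imp_geodesic_solution[OF xu(1)] xu(2) CD(3)[OF q(1)] by (simp add: geodesic_from_def)
qed

lemma exp_map_normal_coords:
  assumes r: "r \<in> C"
  shows "exp_map A g c q (normal_coords c q r) = r"
  using exp_map_eq[OF c q(2) geodesic_from_connecting[OF r]] connecting(3)[OF CD(2)[OF q(1)] CD(2)[OF r]] CD(3)[OF r]
  by simp

lemma normal_coords_lipschitz: "\<exists>L. L-lipschitz_on (ball (\<phi> p) \<delta>) (\<lambda>y. J c\<^sub>0 c (\<phi> q) (cvel (\<phi> q) y 0))"
proof -
  have "bounded_linear (J c\<^sub>0 c (\<phi> q))"
    using J_linear[OF c\<^sub>0 c q_overlap] linear_conv_bounded_linear by blast
  then obtain K where "K-lipschitz_on UNIV (J c\<^sub>0 c (\<phi> q))"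
    using bounded_linear.lipschitz_boundE by blast
  moreover have "2-lipschitz_on (ball (\<phi> p) \<delta>) (\<lambda>y. cvel (\<phi> q) y 0)"
    by (rule lipschitz_onI) (use initial_velocity_bilipschitz(1)[OF CD(2)[OF q(1)]] in \<open>auto simp: dist_norm\<close>)
  ultimately have "(K * 2)-lipschitz_on (ball (\<phi> p) \<delta>) (\<lambda>y. J c\<^sub>0 c (\<phi> q) (cvel (\<phi> q) y 0))"
    by (intro lipschitz_on_compose2[of 2 _ _ K]) (auto intro: lipschitz_on_subset)
  then show ?thesis by blast
qed

lemma normal_coords_expansive:
  obtains L where "0 \<le> L"
    "\<And>r r'. r \<in> C \<Longrightarrow> r' \<in> C \<Longrightarrow> norm (\<phi> r - \<phi> r') \<le> L * norm (normal_coords c q r - normal_coords c q r')"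
proof -
  let ?J' = "J c c\<^sub>0 (snd c q)"
  have ov: "snd c q \<in> overlap c c\<^sub>0" using q CD(1) by blast
  obtain K where K: "0 \<le> K" "\<And>v. norm (?J' v) \<le> K * norm v"
    using linear_bounded_pos[OF J_linear[OF c c\<^sub>0 ov]] by (metis less_imp_le)
  show ?thesis
  proof (rule that[of "2 * K"])
    fix r r' assume r: "r \<in> C" "r' \<in> C"
    have "cvel (\<phi> q) (\<phi> r) 0 - cvel (\<phi> q) (\<phi> r') 0 = ?J' (normal_coords c q r - normal_coords c q r')"
      using J_inverse[OF c\<^sub>0 c CD(1)[OF q(1)] q(2)]
      by (simp add: normal_coords_def linear_diff[OF J_linear[OF c c\<^sub>0 ov]])
    then have "norm (cvel (\<phi> q) (\<phi> r) 0 - cvel (\<phi> q) (\<phi> r') 0) \<le> K * norm (normal_coords c q r - normal_coords c q r')"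
      using K(2) by simp
    then show "norm (\<phi> r - \<phi> r') \<le> 2 * K * norm (normal_coords c q r - normal_coords c q r')"
      using initial_velocity_bilipschitz(2)[OF CD(2)[OF q(1)] CD(2)[OF r(1)] CD(2)[OF r(2)]] by simp
  qed (use K in simp)
qed

text \<open>By \<open>exp_map_normal_coords\<close>, the exponential map is a left inverse of the normal coordinates, which
form a bi-Lipschitz function of the end point. Their image is open by invariance of domain, and
star-shaped because a reparametrized initial piece of a connecting geodesic connects \<open>q\<close> to an
intermediate point.\<close>

lemma exists_normal_domain: "normal_domain A g c q C (normal_coords c q ` C)"
proof -
  define N where "N = normal_coords c q ` C"
  let ?exp = "exp_map A g c q"
  have inj: "inj_on ?exp N"
    by (rule inj_onI) (auto simp: N_def exp_map_normal_coords)
  have inv: "inv_into N ?exp r = normal_coords c q r" if "r \<in> C" for r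
    by (rule inv_into_f_eq[OF inj]) (use that in \<open>auto simp: N_def exp_map_normal_coords\<close>)
  obtain L where L: "L-lipschitz_on (ball (\<phi> p) \<delta>) (\<lambda>y. J c\<^sub>0 c (\<phi> q) (cvel (\<phi> q) y 0))"
    using normal_coords_lipschitz by blast
  obtain L' where L': "0 \<le> L'"
    "\<And>r r'. r \<in> C \<Longrightarrow> r' \<in> C \<Longrightarrow> norm (\<phi> r - \<phi> r') \<le> L' * norm (normal_coords c q r - normal_coords c q r')"
    using normal_coords_expansive by metis
  have exp_lip: "L'-lipschitz_on N (\<lambda>v. \<phi> (?exp v))"
    by (rule lipschitz_onI) (use L' in \<open>auto simp: N_def exp_map_normal_coords dist_norm\<close>)
  have N_image: "N = (\<lambda>y. J c\<^sub>0 c (\<phi> q) (cvel (\<phi> q) y 0)) ` ball (\<phi> p) \<delta>"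
    unfolding N_def image_C[symmetric] image_image normal_coords_def ..
  have "open N"
    unfolding N_image
  proof (rule invariance_of_domain[OF lipschitz_on_continuous_on[OF L] open_ball])
    show "inj_on (\<lambda>y. J c\<^sub>0 c (\<phi> q) (cvel (\<phi> q) y 0)) (ball (\<phi> p) \<delta>)"
    proof (rule inj_onI)
      fix y y' assume y: "y \<in> ball (\<phi> p) \<delta>" "y' \<in> ball (\<phi> p) \<delta>"
        and "J c\<^sub>0 c (\<phi> q) (cvel (\<phi> q) y 0) = J c\<^sub>0 c (\<phi> q) (cvel (\<phi> q) y' 0)"
      then have "normal_coords c q (\<psi> y) = normal_coords c q (\<psi> y')"
        by (simp add: normal_coords_def \<psi>)
      then have "\<psi> y = \<psi> y'" using exp_map_normal_coords \<psi>(1) y by metis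
      then show "y = y'" using \<psi>(2) y by metis
    qed
  qed
  moreover have "N \<subseteq> exp_domain A g c q"
    using geodesic_from_connecting by (auto simp: N_def exp_domain_def)
  moreover have "\<forall>v\<in>N. \<forall>s\<in>{0..1}. s *\<^sub>R v \<in> N"
  proof (intro ballI)
    fix v and s :: real assume "v \<in> N" and s: "s \<in> {0..1}"
    then obtain r where r: "r \<in> C" "v = normal_coords c q r" by (auto simp: N_def)
    let ?y = "cpos (\<phi> q) (\<phi> r) s"
    have y: "?y \<in> ball (\<phi> p) \<delta>"
      using spray_curveD(1)[OF connecting(1)[OF CD(2)[OF q(1)] CD(2)[OF r(1)]] s] .
    have "s *\<^sub>R v = normal_coords c q (\<psi> ?y)"
      using initial_velocity_scale[OF CD(2)[OF q(1)] CD(2)[OF r(1)] s]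
      by (simp add: r(2) normal_coords_def \<psi>(2)[OF y] linear_scale[OF J_linear[OF c\<^sub>0 c q_overlap]])
    then show "s *\<^sub>R v \<in> N" using \<psi>(1)[OF y] by (simp add: N_def)
  qed
  moreover have "homeomorphism N C ?exp (inv_into N ?exp)"
  proof (rule homeomorphismI)
    have exp_C: "?exp v \<in> C" if "v \<in> N" for v using that by (auto simp: N_def exp_map_normal_coords)
    have "continuous_on N (\<lambda>v. \<psi> (\<phi> (?exp v)))"
      by (rule continuous_on_compose2[OF chart(4)[OF c\<^sub>0] lipschitz_on_continuous_on[OF exp_lip]])
        (use exp_C CD(1) in blast)
    then show "continuous_on N ?exp"
      by (rule continuous_on_eq) (simp add: CD(3) exp_C)
    have "continuous_on C (\<lambda>r. J c\<^sub>0 c (\<phi> q) (cvel (\<phi> q) (\<phi> r) 0))"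
      by (rule continuous_on_compose2[OF lipschitz_on_continuous_on[OF L] continuous_on_subset[OF chart(3)[OF c\<^sub>0]]])
        (use CD in blast)+
    then show "continuous_on C (inv_into N ?exp)"
      by (rule continuous_on_eq) (simp add: inv normal_coords_def)
    show "?exp ` N \<subseteq> C" using exp_C by blast
    show "inv_into N ?exp ` C \<subseteq> N" using inv unfolding N_def by auto
    show "inv_into N ?exp (?exp v) = v" if "v \<in> N" for v using inj that by simp
    show "?exp (inv_into N ?exp r) = r" if "r \<in> C" for r using that by (simp add: inv exp_map_normal_coords)
  qed
  moreover have "locally_lipschitz_on {v \<in> N. ?exp v \<in> V} (\<omega> \<circ> ?exp)"
    and "locally_lipschitz_on (\<omega> ` (V \<inter> C)) (inv_into N ?exp \<circ> inv_into V \<omega>)"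
    if c': "(V, \<omega>) \<in> A" for V \<omega>
  proof -
    have exp_c\<^sub>0: "?exp v \<in> fst c\<^sub>0" if "v \<in> N" for v using that CD(1) by (auto simp: N_def exp_map_normal_coords)
    have "locally_lipschitz_on {v \<in> N. ?exp v \<in> V} (\<lambda>v. transition c\<^sub>0 (V, \<omega>) (\<phi> (?exp v)))"
    proof (rule locally_lipschitz_on_compose[OF _ transition_locally_lipschitz[OF c\<^sub>0 c']])
      show "locally_lipschitz_on {v \<in> N. ?exp v \<in> V} (\<lambda>v. \<phi> (?exp v))"
        by (rule locally_lipschitz_on_subset[OF lipschitz_imp_locally_lipschitz_on[OF exp_lip]]) auto
      show "(\<lambda>v. \<phi> (?exp v)) ` {v \<in> N. ?exp v \<in> V} \<subseteq> overlap c\<^sub>0 (V, \<omega>)" using exp_c\<^sub>0 by auto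
    qed
    then show "locally_lipschitz_on {v \<in> N. ?exp v \<in> V} (\<omega> \<circ> ?exp)"
      by (rule locally_lipschitz_on_transform) (simp add: transition_coord[OF c\<^sub>0 exp_c\<^sub>0])
    have trans: "transition (V, \<omega>) c\<^sub>0 (\<omega> r) = \<phi> r" "inv_into V \<omega> (\<omega> r) = r" if "r \<in> V" for r
      using transition_coord[OF c', of r c\<^sub>0] chart(6)[OF c', of r] that by auto
    have "locally_lipschitz_on (\<omega> ` (V \<inter> C))
        (\<lambda>y. (\<lambda>y. J c\<^sub>0 c (\<phi> q) (cvel (\<phi> q) y 0)) (transition (V, \<omega>) c\<^sub>0 y))"
    proof (rule locally_lipschitz_on_compose[OF _ lipschitz_imp_locally_lipschitz_on[OF L]])
      show "locally_lipschitz_on (\<omega> ` (V \<inter> C)) (transition (V, \<omega>) c\<^sub>0)"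
        by (rule locally_lipschitz_on_subset[OF transition_locally_lipschitz[OF c' c\<^sub>0]]) (use CD(1) in auto)
      show "transition (V, \<omega>) c\<^sub>0 ` \<omega> ` (V \<inter> C) \<subseteq> ball (\<phi> p) \<delta>"
        using CD(2) trans(1) by auto
    qed
    then show "locally_lipschitz_on (\<omega> ` (V \<inter> C)) (inv_into N ?exp \<circ> inv_into V \<omega>)"
      by (rule locally_lipschitz_on_transform) (auto simp: trans inv normal_coords_def)
  qed
  ultimately show ?thesis
    unfolding normal_domain_def N_def by blast
qed

end

lemma convex_normal_C: "convex_normal A g C"
  using open_C exists_normal_domain unfolding convex_normal_def by blast

text \<open>The vector \<open>v\<close> in \<open>N\<close> with end point \<open>r\<close> generates a geodesic that stays in the ball, because
\<open>N\<close> is star-shaped and is mapped into the ball. So it is the connecting geodesic from \<open>q\<close> to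
\<open>r\<close>, whatever \<open>N\<close> is.\<close>

lemma normal_domain_inverse:
  assumes N: "normal_domain A g c\<^sub>0 q C N" and q: "q \<in> C" and r: "r \<in> C"
  shows "inv_into N (exp_map A g c\<^sub>0 q) r = cvel (\<phi> q) (\<phi> r) 0"
proof -
  let ?exp = "exp_map A g c\<^sub>0 q"
  define v where "v = inv_into N ?exp r"
  have hom: "homeomorphism N C ?exp (inv_into N ?exp)" and star: "\<And>v s. v \<in> N \<Longrightarrow> s \<in> {0..1} \<Longrightarrow> s *\<^sub>R v \<in> N"
    and dom: "N \<subseteq> exp_domain A g c\<^sub>0 q"
    using N by (auto simp: normal_domain_def)
  have v: "v \<in> N" "?exp v = r" using hom r by (auto simp: homeomorphism_def v_def)
  obtain \<gamma> where \<gamma>: "geodesic_from A g c\<^sub>0 q v \<gamma>" using v(1) dom by (auto simp: exp_domain_def)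
  have \<gamma>_exp: "\<gamma> s = ?exp (s *\<^sub>R v)" if "s \<in> {0..1}" for s
    using exp_map_scale[OF c\<^sub>0 CD(1)[OF q] \<gamma> that] by simp
  have sub: "\<gamma> ` {0..1} \<subseteq> C"
  proof
    fix r assume "r \<in> \<gamma> ` {0..1}"
    then obtain s where "s \<in> {0..1}" "r = ?exp (s *\<^sub>R v)" using \<gamma>_exp by auto
    then show "r \<in> C" using star[OF v(1)] hom by (auto simp: homeomorphism_def)
  qed
  have sol: "geodesic_solution A g {0..1} \<gamma>" and init: "\<gamma> 0 = q"
    and vel: "((\<phi> \<circ> \<gamma>) has_vector_derivative v) (at 0 within {0..1})"
    using \<gamma> by (auto simp: geodesic_from_def)
  obtain u where u: "spray_curve (\<phi> \<circ> \<gamma>) u" using geodesic_solution_imp_spray_curve[OF sol sub] .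
  have "u 0 = v"
    by (rule vector_derivative_unique_within_closed_interval[of 0 1 0 "\<phi> \<circ> \<gamma>"])
      (use vel spray_curveD(2)[OF u, of 0] in auto)
  moreover have "\<gamma> 1 = r" using \<gamma>_exp[of 1] v(2) by simp
  ultimately show ?thesis
    using connecting_unique(2)[OF u, of "\<phi> q" "\<phi> r" 0] init by (simp add: v_def)
qed

lemma D2_eq_energy:
  assumes q: "q \<in> C" and r: "r \<in> C"
  shows "D2 A g c\<^sub>0 C q r = energy (\<phi> q) (\<phi> r)"
proof -
  have "normal_domain A g c\<^sub>0 q C (SOME N. normal_domain A g c\<^sub>0 q C N)"
    using exists_normal_domain[OF c\<^sub>0 q CD(1)[OF q]] by (rule someI)
  from normal_domain_inverse[OF this q r]
  have "exp_inv A g c\<^sub>0 C q r = cvel (\<phi> q) (\<phi> r) 0" by (simp add: exp_inv_def)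
  then show ?thesis by (simp add: D2_def energy_def Let_def)
qed

lemma D2_estimate:
  assumes x: "geodesic_solution A g {0..1} x" "x ` {0..1} \<subseteq> C" and q: "q \<in> C"
  shows "\<exists>d\<^sub>0 d\<^sub>1.
    ((\<lambda>t. D2 A g c\<^sub>0 C q (x t)) has_real_derivative d\<^sub>0) (at 0 within {0..1}) \<and>
    ((\<lambda>t. D2 A g c\<^sub>0 C q (x t)) has_real_derivative d\<^sub>1) (at 1 within {0..1}) \<and>
    \<bar>d\<^sub>1 - d\<^sub>0 - 2 * D2 A g c\<^sub>0 C (x 0) (x 1)\<bar> \<le> (256 * B + 32) * (\<Lambda> * \<delta>\<^sup>2) * (norm (\<phi> (x 1) - \<phi> (x 0)))\<^sup>2"
proof -
  obtain u where u: "spray_curve (\<phi> \<circ> x) u" using geodesic_solution_imp_spray_curve[OF x] .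
  have xC: "x t \<in> C" if "t \<in> {0..1}" for t using x(2) that by blast
  define d where "d = (\<lambda>t. 2 * (u t \<bullet> (g c\<^sub>0 (\<phi> (x t)) *v cvel (\<phi> q) (\<phi> (x t)) 1)))"
  have deriv: "((\<lambda>t. D2 A g c\<^sub>0 C q (x t)) has_real_derivative d t) (at t within {0..1})" if t: "t \<in> {0..1}" for t
  proof -
    have "((\<lambda>t. energy (\<phi> q) (\<phi> (x t))) has_vector_derivative d t) (at t within {0..1})"
      using energy_along_curve[OF CD(2)[OF q] u t]
      by (simp add: has_real_derivative_iff_has_vector_derivative d_def)
    then have "((\<lambda>t. D2 A g c\<^sub>0 C q (x t)) has_vector_derivative d t) (at t within {0..1})"
      by (rule has_vector_derivative_transform[OF t, rotated]) (simp add: D2_eq_energy[OF q] xC)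
    then show ?thesis by (simp add: has_real_derivative_iff_has_vector_derivative)
  qed
  have "\<bar>d 1 - d 0 - 2 * D2 A g c\<^sub>0 C (x 0) (x 1)\<bar> \<le> (256 * B + 32) * (\<Lambda> * \<delta>\<^sup>2) * (norm (\<phi> (x 1) - \<phi> (x 0)))\<^sup>2"
    using energy_estimate[OF CD(2)[OF q] u] D2_eq_energy[OF xC xC, of 0 1] by (simp add: d_def)
  then show ?thesis using deriv[of 0] deriv[of 1] by auto
qed

end

section \<open>The estimate\<close>

lemma (in lorentzian_chart) local_bounds:
  assumes y: "y \<in> S"
  obtains R \<Lambda> B where "R > 0" "0 \<le> \<Lambda>" "ball y R \<subseteq> S"
    "\<And>x x' u v. x \<in> ball y R \<Longrightarrow> x' \<in> ball y R \<Longrightarrow>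
      norm (connection_form g c x u v - connection_form g c x' u v) \<le> \<Lambda> * norm (x - x') * norm u * norm v"
    "\<And>x x' h. x \<in> ball y R \<Longrightarrow> x' \<in> ball y R \<Longrightarrow> norm (DG x h - DG x' h) \<le> \<Lambda> * norm (x - x') * norm h"
    "\<And>x. x \<in> ball y R \<Longrightarrow> norm (G x) \<le> B"
proof -
  obtain e\<^sub>1 L\<^sub>1 where e1: "e\<^sub>1 > 0" "0 \<le> L\<^sub>1" "ball y e\<^sub>1 \<subseteq> S"
    and l1: "\<And>x x' u v. x \<in> ball y e\<^sub>1 \<Longrightarrow> x' \<in> ball y e\<^sub>1 \<Longrightarrow>
      norm (connection_form g c x u v - connection_form g c x' u v) \<le> L\<^sub>1 * norm (x - x') * norm u * norm v"
    using connection_form_locally_lipschitz[OF y] by metis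
  obtain e\<^sub>2 L\<^sub>2 where e2: "e\<^sub>2 > 0" "ball y e\<^sub>2 \<subseteq> S"
    and l2: "\<And>\<alpha>. L\<^sub>2-lipschitz_on (ball y e\<^sub>2) (\<lambda>x. DG x (axis \<alpha> 1))"
    using locally_lipschitz_on_uniform[OF DG_locally_lipschitz open_S y, of "\<lambda>\<alpha>. axis \<alpha> 1"] by metis
  have "locally_lipschitz_on S G" using C1_imp_locally_lipschitz_on[OF open_S] C11 by simp
  then obtain e\<^sub>3 L\<^sub>3 where e3: "e\<^sub>3 > 0" "L\<^sub>3-lipschitz_on (ball y e\<^sub>3) G"
    using locally_lipschitz_on_openD[OF _ open_S y] by metis
  have L: "0 \<le> L\<^sub>2" "0 \<le> L\<^sub>3" using lipschitz_on_nonneg l2 e3 by blast+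
  define n where "n = real CARD('n)"
  define \<Lambda> where "\<Lambda> = L\<^sub>1 + n * L\<^sub>2"
  define R where "R = min e\<^sub>1 (min e\<^sub>2 e\<^sub>3)"
  have n: "0 \<le> n * L\<^sub>2" using L by (simp add: n_def)
  have R: "ball y R \<subseteq> ball y e\<^sub>1" "ball y R \<subseteq> ball y e\<^sub>2" "ball y R \<subseteq> ball y e\<^sub>3" by (auto simp: R_def)
  show ?thesis
  proof (rule that[of R \<Lambda> "norm (G y) + L\<^sub>3 * e\<^sub>3"])
    show "R > 0" "0 \<le> \<Lambda>" "ball y R \<subseteq> S" using e1 e2 e3 n R by (auto simp: R_def \<Lambda>_def)
    fix x assume x: "x \<in> ball y R"
    have "norm (G x - G y) \<le> L\<^sub>3 * norm (x - y)"
      using lipschitz_on_normD[OF e3(2), of x y] x R(3) e3(1) by auto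
    also have "\<dots> \<le> L\<^sub>3 * e\<^sub>3"
      using x R(3) L by (intro mult_left_mono) (auto simp: dist_norm norm_minus_commute R_def)
    finally show "norm (G x) \<le> norm (G y) + L\<^sub>3 * e\<^sub>3"
      using norm_triangle_ineq2[of "G x" "G y"] by simp
    fix x' assume x': "x' \<in> ball y R"
    show "norm (connection_form g c x u v - connection_form g c x' u v) \<le> \<Lambda> * norm (x - x') * norm u * norm v" for u v
    proof -
      have "norm (connection_form g c x u v - connection_form g c x' u v) \<le> L\<^sub>1 * norm (x - x') * norm u * norm v"
        using l1 x x' R(1) by blast
      also have "\<dots> \<le> \<Lambda> * norm (x - x') * norm u * norm v"
        using n by (intro mult_right_mono) (auto simp: \<Lambda>_def)
      finally show ?thesis .
    qed
    show "norm (DG x h - DG x' h) \<le> \<Lambda> * norm (x - x') * norm h" for h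
    proof -
      have xS: "x \<in> S" "x' \<in> S" using x x' R(1) e1(3) by auto
      have "DG x h - DG x' h = (\<Sum>\<alpha>\<in>UNIV. h $ \<alpha> *\<^sub>R (DG x (axis \<alpha> 1) - DG x' (axis \<alpha> 1)))"
        unfolding DG_expand[OF xS(1), of h] DG_expand[OF xS(2), of h] scaleR_diff_right sum_subtractf ..
      also have "norm \<dots> \<le> (\<Sum>\<alpha>\<in>(UNIV::'n set). norm h * (L\<^sub>2 * norm (x - x')))"
      proof (rule sum_norm_le)
        fix \<alpha> :: 'n
        have "norm (DG x (axis \<alpha> 1) - DG x' (axis \<alpha> 1)) \<le> L\<^sub>2 * norm (x - x')"
          using lipschitz_on_normD[OF l2] x x' R(2) by blast
        then have "\<bar>h $ \<alpha>\<bar> * norm (DG x (axis \<alpha> 1) - DG x' (axis \<alpha> 1)) \<le> norm h * (L\<^sub>2 * norm (x - x'))"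
          by (intro mult_mono component_le_norm_cart) auto
        then show "norm (h $ \<alpha> *\<^sub>R (DG x (axis \<alpha> 1) - DG x' (axis \<alpha> 1))) \<le> norm h * (L\<^sub>2 * norm (x - x'))"
          by simp
      qed
      also have "\<dots> = n * L\<^sub>2 * norm (x - x') * norm h" by (simp add: n_def)
      also have "\<dots> \<le> \<Lambda> * norm (x - x') * norm h"
        using e1(2) by (intro mult_right_mono) (auto simp: \<Lambda>_def)
      finally show ?thesis .
    qed
  qed
qed

theorem theorem10:
  fixes A :: "('m::t2_space, 'n::finite) chart set"
    and g :: "('m, 'n) tensor2"
    and z :: 'n and p :: 'm and \<epsilon> :: real
    and U :: "'m set" and \<phi> :: "'m \<Rightarrow> real ^ 'n"
  assumes "C21_manifold A"
    and "C11_lorentzian_metric A z g"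
    and "\<epsilon> > 0"
    and "(U, \<phi>) \<in> A" and "p \<in> U"
    and "g (U, \<phi>) (\<phi> p) = minkowski z"
    and "\<forall>\<mu> \<alpha> \<beta>. christoffel g (U, \<phi>) (\<phi> p) \<mu> \<alpha> \<beta> = 0"
  shows "\<exists>\<delta>\<^sub>0>0. \<forall>\<delta>. 0 < \<delta> \<and> \<delta> < \<delta>\<^sub>0 \<longrightarrow>
    (let C = coordinate_ball (U, \<phi>) p \<delta>; D = D2 A g (U, \<phi>) C in
      convex_normal A g C \<and>
      (\<forall>x q. geodesic A g {0..1} x \<and> x ` {0..1} \<subseteq> C \<and> q \<in> C \<longrightarrow>
        (\<exists>d\<^sub>0 d\<^sub>1.
          ((\<lambda>t. D q (x t)) has_real_derivative d\<^sub>0) (at 0 within {0..1}) \<and>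
          ((\<lambda>t. D q (x t)) has_real_derivative d\<^sub>1) (at 1 within {0..1}) \<and>
          \<bar>d\<^sub>1 - d\<^sub>0 - 2 * D (x 0) (x 1)\<bar> \<le> \<epsilon> * (norm (\<phi> (x 1) - \<phi> (x 0)))\<^sup>2)))"
proof -
  interpret M: lorentzian_manifold A g z
    using assms(1,2) by (simp add: lorentzian_manifold_def C21_manifold_def)
  define c where "c = (U, \<phi>)"
  have c: "c \<in> A" "p \<in> fst c" using assms(4,5) by (auto simp: c_def)
  interpret G: lorentzian_chart g c "snd c ` fst c" z by (rule M.lorentzian_chart[OF c(1)])
  have y: "snd c p \<in> snd c ` fst c" using c(2) by blast
  have \<Gamma>0: "christoffel g c (snd c p) \<mu> \<alpha> \<beta> = 0" for \<mu> \<alpha> \<beta>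
    using assms(7) by (simp add: c_def)
  obtain R \<Lambda> B where R: "R > 0" "0 \<le> \<Lambda>" "ball (snd c p) R \<subseteq> snd c ` fst c"
    and \<Gamma>_lip: "\<And>x x' u v. x \<in> ball (snd c p) R \<Longrightarrow> x' \<in> ball (snd c p) R \<Longrightarrow>
      norm (connection_form g c x u v - connection_form g c x' u v) \<le> \<Lambda> * norm (x - x') * norm u * norm v"
    and DG_lip: "\<And>x x' h. x \<in> ball (snd c p) R \<Longrightarrow> x' \<in> ball (snd c p) R \<Longrightarrow>
      norm (G.DG x h - G.DG x' h) \<le> \<Lambda> * norm (x - x') * norm h"
    and G_bound: "\<And>x. x \<in> ball (snd c p) R \<Longrightarrow> norm (G.G x) \<le> B"
    using G.local_bounds[OF y] by metis
  have "0 \<le> B" using G_bound[of "snd c p"] R(1) norm_ge_zero[of "G.G (snd c p)"] by (simp del: norm_ge_zero)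
  define K where "K = 256 * B + 32"
  have K: "K > 0" using \<open>0 \<le> B\<close> by (simp add: K_def)
  define \<eta> where "\<eta> = min (1 / 500) (\<epsilon> / K)"
  have \<eta>: "\<eta> > 0" using assms(3) K by (simp add: \<eta>_def)
  \<comment> \<open>For \<open>\<delta> < \<delta>\<^sub>0\<close> the ball of radius \<open>5 * \<delta>\<close> lies in the region of the local bounds, and
\<open>\<Lambda> * \<delta>\<^sup>2 \<le> (\<Lambda> + 1) * \<delta> \<le> \<eta>\<close> as \<open>\<delta> \<le> 1\<close>.\<close>
  define \<delta>\<^sub>0 where "\<delta>\<^sub>0 = min (R / 5) (min 1 (\<eta> / (\<Lambda> + 1)))"
  have pos: "\<delta>\<^sub>0 > 0" using R \<eta> by (simp add: \<delta>\<^sub>0_def)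
  have main: "convex_normal A g (coordinate_ball c p \<delta>) \<and>
      (\<forall>x q. geodesic A g {0..1} x \<and> x ` {0..1} \<subseteq> coordinate_ball c p \<delta> \<and> q \<in> coordinate_ball c p \<delta> \<longrightarrow>
        (\<exists>d\<^sub>0 d\<^sub>1.
          ((\<lambda>t. D2 A g c (coordinate_ball c p \<delta>) q (x t)) has_real_derivative d\<^sub>0) (at 0 within {0..1}) \<and>
          ((\<lambda>t. D2 A g c (coordinate_ball c p \<delta>) q (x t)) has_real_derivative d\<^sub>1) (at 1 within {0..1}) \<and>
          \<bar>d\<^sub>1 - d\<^sub>0 - 2 * D2 A g c (coordinate_ball c p \<delta>) (x 0) (x 1)\<bar>
            \<le> \<epsilon> * (norm (snd c (x 1) - snd c (x 0)))\<^sup>2))"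
    if \<delta>: "0 < \<delta>" "\<delta> < \<delta>\<^sub>0" for \<delta>
  proof -
    have 5: "cball (snd c p) (5 * \<delta>) \<subseteq> ball (snd c p) R" and ball: "ball (snd c p) \<delta> \<subseteq> ball (snd c p) R"
      using \<delta> R by (auto simp: \<delta>\<^sub>0_def)
    have "\<Lambda> * \<delta>\<^sup>2 \<le> (\<Lambda> + 1) * \<delta>"
      using \<delta> R(2) by (intro mult_mono) (auto simp: \<delta>\<^sub>0_def power2_eq_square mult_left_le_one_le)
    also have "\<dots> \<le> (\<Lambda> + 1) * (\<eta> / (\<Lambda> + 1))" using \<delta> R(2) by (intro mult_left_mono) (auto simp: \<delta>\<^sub>0_def)
    also have "\<dots> = \<eta>" using R(2) by simp
    finally have small: "\<Lambda> * \<delta>\<^sup>2 \<le> 1 / 500" "\<Lambda> * \<delta>\<^sup>2 \<le> \<epsilon> / K" by (auto simp: \<eta>_def)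
    have in_chart: "x \<in> snd c ` fst c" if "x \<in> ball (snd c p) \<delta>" for x using that ball R(3) by blast
    interpret N: normal_ball A g z c p \<delta> \<Lambda> B
    proof unfold_locales
      show "bilinear (connection_form g c x)" for x by (rule bilinear_connection_form)
      show "connection_form g c (snd c p) u v = 0" for u v
        by (simp add: connection_form_def vec_eq_iff \<Gamma>0)
      show "0 < \<delta>" "0 \<le> \<Lambda>" "\<Lambda> * \<delta>\<^sup>2 \<le> 1 / 500" "c \<in> A" using \<delta> R small c by auto
      show "norm (connection_form g c x u v - connection_form g c x' u v) \<le> \<Lambda> * norm (x - x') * norm u * norm v"
        if "x \<in> cball (snd c p) (5 * \<delta>)" "x' \<in> cball (snd c p) (5 * \<delta>)" for x x' u v
        using that 5 \<Gamma>_lip by blast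
      show "ball (snd c p) \<delta> \<subseteq> snd c ` fst c" using in_chart by blast
      show "G.DG (snd c p) h = 0" for h by (rule G.DG_zero_if_christoffel_zero[OF y \<Gamma>0])
      fix x assume x: "x \<in> ball (snd c p) \<delta>"
      show "(G.G has_derivative G.DG x) (at x)" by (rule G.metric_derivative[OF in_chart[OF x]])
      show "transpose (G.G x) = G.G x" by (rule G.metric_symmetric[OF in_chart[OF x]])
      show "norm (G.G x) \<le> B" using x ball G_bound by blast
      show "a \<bullet> (G.G x *v connection_form g c x u u) = a \<bullet> (G.DG x u *v u) - 1 / 2 * (u \<bullet> (G.DG x a *v u))" for a u
        by (rule G.euler_lagrange[OF in_chart[OF x]])
      show "norm (G.DG x h - G.DG x' h) \<le> \<Lambda> * norm (x - x') * norm h" if "x' \<in> ball (snd c p) \<delta>" for x' h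
        using x that ball DG_lip by blast
    qed
    have "K * (\<Lambda> * \<delta>\<^sup>2) \<le> \<epsilon>" using small(2) K by (simp add: le_divide_eq mult.commute)
    then have K\<epsilon>: "(256 * B + 32) * (\<Lambda> * \<delta>\<^sup>2) * s\<^sup>2 \<le> \<epsilon> * s\<^sup>2" for s :: real
      unfolding K_def by (intro mult_right_mono) auto
    show ?thesis
      using N.convex_normal_C N.D2_estimate order_trans[OF _ K\<epsilon>] unfolding geodesic_def by meson
  qed
  show ?thesis
    unfolding Let_def
    by (rule exI[of _ \<delta>\<^sub>0], rule conjI[OF pos], rule allI, rule impI, elim conjE,
        rule main[unfolded c_def snd_conv])
qed

end
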